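(* Let $\alpha,\beta\in\mathbb{R}$. Then, as an identity of meromorphic functions of $(u,\tau)\in\mathbb{C}\times\mathbb{H}$, \begin{equation*} \begin{split} &\vartheta(u;\tau)^3 \left( 4\pi i \frac{\partial}{\partial \tau} + \frac{\partial^2}{\partial u^2}\right) \left\{ e^{2\pi i \alpha u-\pi i \alpha^2 \tau} \mu\left(u,\alpha\tau+\beta;\tau\right) \right\}\\ &= e^{2\pi i \alpha u-\pi i \alpha^2 \tau} \frac{16 \pi^2 \eta(\tau)^6}{\vartheta\left(\alpha\tau+\beta;\tau\right)^2} \big\{ a_1(\tau)\ \vartheta_0\left(2u+\alpha\tau+\beta;2\tau\right) - a_0(\tau)\ \vartheta_1\left(2u+\alpha\tau+\beta;2\tau\right)\big\}. \end{split} \end{equation*}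
   Context: Let $\mathbb{H}$ be the upper half-plane, $\tau\in\mathbb{H}$, $q=e^{2\pi i\tau}$, and $\eta(\tau)=q^{1/24}\prod_{n\ge1}(1-q^n)$ the Dedekind eta function. Define $\vartheta(u;\tau)=\sum_{\nu\in\mathbb{Z}+\frac12} e^{\pi i\nu^2\tau+2\pi i\nu(u+\frac12)}$, and the Lerch sum $\mu(u,v;\tau)=\frac{e^{\pi i u}}{\vartheta(v;\tau)}\sum_{n\in\mathbb{Z}}(-1)^n\frac{e^{\pi i(n^2+n)\tau+2\pi i v n}}{1-e^{2\pi i n\tau+2\pi i u}}$. Further define $\vartheta_0(u;\tau)=\sum_{n\in\mathbb{Z}} e^{\pi i n^2\tau+2\pi i n u}$, $\vartheta_1(u;\tau)=\sum_{n\in\frac12+\mathbb{Z}} e^{\pi i n^2\tau+2\pi i n u}$, $a_0(\tau)=\sum_{n\in\mathbb{Z}}(n+\alpha/2)\,e^{2\pi i n^2\tau+2\pi i n(\alpha\tau+\beta)}$, and $a_1(\tau)=\sum_{n\in\frac12+\mathbb{Z}}(n+\alpha/2)\,e^{2\pi i n^2\tau+2\pi i n(\alpha\tau+\beta)}$. *)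

theory Defs
  imports "HOL-Complex_Analysis.Complex_Analysis"
begin

definition upper_half_plane :: "complex set" where
  "upper_half_plane = {\<tau>. Im \<tau> > 0}"

text \<open>The lattice of zeros of \<open>\<vartheta>(\<cdot>;\<tau>)\<close>, that is, the poles of \<open>\<mu>(\<cdot>,v;\<tau>)\<close>.\<close>
definition period_lattice :: "complex \<Rightarrow> complex set" where
  "period_lattice \<tau> = {of_int m * \<tau> + of_int n | m n. True}"

text \<open>A sum over \<open>\<nu> \<in> \<int> + 1/2\<close> is written as a sum over integers \<open>n\<close> with \<open>\<nu> = n + 1/2\<close>.\<close>

definition vartheta :: "complex \<Rightarrow> complex \<Rightarrow> complex" where
  "vartheta u \<tau> = (\<Sum>\<^sub>\<infinity>n\<in>(UNIV::int set).
     exp (pi * \<i> * (of_int n + 1/2)^2 * \<tau> + 2 * pi * \<i> * (of_int n + 1/2) * (u + 1/2)))"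

definition dedekind_eta :: "complex \<Rightarrow> complex" where
  "dedekind_eta \<tau> = exp (2 * pi * \<i> * \<tau> / 24) * (\<Prod>n. 1 - exp (2 * pi * \<i> * \<tau>) ^ Suc n)"

text \<open>If \<open>v \<in> \<int>\<tau> + \<int>\<close>, where the Lerch sum is undefined, this has the value 0,
  because \<open>vartheta v \<tau> = 0\<close> and division by zero gives zero.\<close>
definition lerch_mu :: "complex \<Rightarrow> complex \<Rightarrow> complex \<Rightarrow> complex" where
  "lerch_mu u v \<tau> = exp (pi * \<i> * u) / vartheta v \<tau> *
     (\<Sum>\<^sub>\<infinity>n\<in>(UNIV::int set). (-1) powi n *
        exp (pi * \<i> * (of_int n ^ 2 + of_int n) * \<tau> + 2 * pi * \<i> * v * of_int n) /
        (1 - exp (2 * pi * \<i> * of_int n * \<tau> + 2 * pi * \<i> * u)))"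

definition vartheta0 :: "complex \<Rightarrow> complex \<Rightarrow> complex" where
  "vartheta0 u \<tau> = (\<Sum>\<^sub>\<infinity>n\<in>(UNIV::int set).
     exp (pi * \<i> * of_int n ^ 2 * \<tau> + 2 * pi * \<i> * of_int n * u))"

definition vartheta1 :: "complex \<Rightarrow> complex \<Rightarrow> complex" where
  "vartheta1 u \<tau> = (\<Sum>\<^sub>\<infinity>n\<in>(UNIV::int set).
     exp (pi * \<i> * (of_int n + 1/2)^2 * \<tau> + 2 * pi * \<i> * (of_int n + 1/2) * u))"

definition coeff_a0 :: "real \<Rightarrow> real \<Rightarrow> complex \<Rightarrow> complex" where
  "coeff_a0 \<alpha> \<beta> \<tau> = (\<Sum>\<^sub>\<infinity>n\<in>(UNIV::int set). (of_int n + of_real \<alpha> / 2) *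
     exp (2 * pi * \<i> * of_int n ^ 2 * \<tau> + 2 * pi * \<i> * of_int n * (of_real \<alpha> * \<tau> + of_real \<beta>)))"

definition coeff_a1 :: "real \<Rightarrow> real \<Rightarrow> complex \<Rightarrow> complex" where
  "coeff_a1 \<alpha> \<beta> \<tau> = (\<Sum>\<^sub>\<infinity>n\<in>(UNIV::int set). ((of_int n + 1/2) + of_real \<alpha> / 2) *
     exp (2 * pi * \<i> * (of_int n + 1/2)^2 * \<tau> +
          2 * pi * \<i> * (of_int n + 1/2) * (of_real \<alpha> * \<tau> + of_real \<beta>)))"

text \<open>The operator \<open>4\<pi>i \<partial>/\<partial>\<tau> + \<partial>\<^sup>2/\<partial>u\<^sup>2\<close>, applied to \<open>F\<close> and evaluated at \<open>(u, \<tau>)\<close>.\<close>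
definition heat_operator :: "(complex \<Rightarrow> complex \<Rightarrow> complex) \<Rightarrow> complex \<Rightarrow> complex \<Rightarrow> complex" where
  "heat_operator F u \<tau> = 4 * pi * \<i> * deriv (\<lambda>t. F u t) \<tau> + (deriv ^^ 2) (\<lambda>w. F w \<tau>) u"

text \<open>Holomorphy in two variables: jointly continuous and holomorphic in each variable
  (equivalent to the other usual definitions by Osgood's lemma). Intended for open sets.\<close>
definition holomorphic2_on :: "(complex \<times> complex \<Rightarrow> complex) \<Rightarrow> (complex \<times> complex) set \<Rightarrow> bool" where
  "holomorphic2_on f S \<longleftrightarrow> continuous_on S f \<and>
     (\<forall>(a, b)\<in>S. (\<lambda>z. f (z, b)) field_differentiable at a \<and>
                  (\<lambda>w. f (a, w)) field_differentiable at b)"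

text \<open>A total function represents a meromorphic function if it is locally a quotient of
  holomorphic functions, the denominator not vanishing identically on any nonempty open set.
  Its values at zeros of the denominator are irrelevant.\<close>
definition meromorphic2_on :: "(complex \<times> complex \<Rightarrow> complex) \<Rightarrow> (complex \<times> complex) set \<Rightarrow> bool" where
  "meromorphic2_on f S \<longleftrightarrow> (\<forall>p\<in>S. \<exists>U g h. open U \<and> p \<in> U \<and>
     holomorphic2_on g U \<and> holomorphic2_on h U \<and>
     (\<forall>V. open V \<and> V \<noteq> {} \<and> V \<subseteq> U \<longrightarrow> (\<exists>x\<in>V. h x \<noteq> 0)) \<and>
     (\<forall>x\<in>U. h x \<noteq> 0 \<longrightarrow> f x = g x / h x))"

end

theory Submission
  imports Defs
begin

text \<open>
  Write \<open>v = \<alpha>\<tau> + \<beta>\<close>. The function \<open>f = exp (2\<pi>i\<alpha>u - \<pi>i\<alpha>\<^sup>2\<tau>) \<mu>(u,v;\<tau>)\<close> picks up a multiplier and an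
  inhomogeneous term when \<open>u\<close> is shifted by \<open>\<tau>\<close>; the heat operator kills the inhomogeneous term.
  So both sides, divided by \<open>\<vartheta>(u)\<^sup>2\<close>, have the same multipliers, \<open>exp (2\<pi>i\<alpha>)\<close> for \<open>u \<mapsto> u + 1\<close> and
  \<open>exp (-2\<pi>i\<beta>)\<close> for \<open>u \<mapsto> u + \<tau>\<close>, both of modulus 1. Their difference has no pole at \<open>u = 0\<close>, hence is
  constant by Liouville's theorem, hence 0 unless \<open>\<alpha>\<close> and \<open>\<beta>\<close> are both integers. In that case \<open>\<vartheta>(v) = 0\<close>, and
  both sides are 0 because of the convention for division by 0.

  Cancellation of the poles needs two facts: the Wronskian of \<open>\<vartheta>\<^sub>0(\<cdot>;2\<tau>)\<close> and \<open>\<vartheta>\<^sub>1(\<cdot>;2\<tau>)\<close> at \<open>v\<close> is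
  \<open>-\<vartheta>'(0) \<vartheta>(v) / 2\<close> (rearrange the double series), and \<open>\<vartheta>'(0) = -2\<pi> \<eta>\<^sup>3\<close>. The latter, like the location
  of the zeros of \<open>\<vartheta>\<close>, comes from the Jacobi triple product, the limit of the finite q-binomial theorem.
\<close>

section \<open>Theta series\<close>

text \<open>The pole of \<open>lerch_mu\<close> at \<open>u = 0\<close> is simple and the second
  derivative makes it triple, hence the cube of \<open>vartheta u \<tau>\<close>. The multipliers
  confine the cleared left-hand side to a two-dimensional space, spanned by the common exponential
  times \<open>vartheta0 (2 * u + v) (2 * \<tau>)\<close> and
  \<open>vartheta1 (2 * u + v) (2 * \<tau>)\<close>, so its value and derivative at
  \<open>u = 0\<close> should decide. Up to a common factor \<open>coeff_a0\<close> and
  \<open>coeff_a1\<close> are the \<open>u\<close>-derivatives of these two basis functions at 0;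
  the combination on the right therefore has derivative 0 there, and its value is the Wronskian,
  since the terms with \<alpha> cancel. The inhomogeneous term is an exponential
  \<open>exp (2 pi i c u - pi i c^2 \<tau>)\<close> with \<open>c = \<alpha> - 1/2\<close>, and 4 pi
  i (- pi i c^2) + (2 pi i c)^2 = 0. The shift of \<open>u\<close> by \<tau> does not commute with
  differentiation in \<tau>. Hence the \<tau>-derivative of the Lerch series is first rewritten by
  \<open>u\<close>-derivatives and weighted sums; the comparison of the two sides then runs at fixed
  \<tau>.\<close>

definition normally_summable_on :: "('i \<Rightarrow> complex \<Rightarrow> complex) \<Rightarrow> 'i set \<Rightarrow> complex set \<Rightarrow> bool" where
  "normally_summable_on f I S \<longleftrightarrow> (\<forall>z\<in>S. \<exists>r>0. \<exists>M. cball z r \<subseteq> S \<and> M summable_on I \<and>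
     (\<forall>w\<in>cball z r. \<forall>n\<in>I. norm (f n w) \<le> M n))"

text \<open>By the Weierstrass M-test the finite partial sums converge uniformly on a closed ball,
  along the filter of finite subsets; complex differentiation passes to such limits in every
  order.\<close>

lemma normally_summable_higher_deriv:
  assumes f: "normally_summable_on f I S" and hol: "\<And>n. n \<in> I \<Longrightarrow> f n holomorphic_on S" and z: "z \<in> S"
  shows "((\<lambda>n. (deriv ^^ m) (f n) z) has_sum (deriv ^^ m) (\<lambda>w. \<Sum>\<^sub>\<infinity>n\<in>I. f n w) z) I"
    and "(\<lambda>w. \<Sum>\<^sub>\<infinity>n\<in>I. f n w) field_differentiable at z"
proof -
  obtain r M where r: "r > 0" "cball z r \<subseteq> S" and M: "M summable_on I"
    and le: "\<And>w n. w \<in> cball z r \<Longrightarrow> n \<in> I \<Longrightarrow> norm (f n w) \<le> M n"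
    using f z unfolding normally_summable_on_def by meson
  have ul: "uniform_limit (cball z r) (\<lambda>X w. \<Sum>n\<in>X. f n w) (\<lambda>w. \<Sum>\<^sub>\<infinity>n\<in>I. f n w) (finite_subsets_at_top I)"
    by (rule Weierstrass_m_test_general[OF le M])
  have "((\<lambda>X. (deriv ^^ m) (\<lambda>w. \<Sum>n\<in>X. f n w) z) \<longlongrightarrow> (deriv ^^ m) (\<lambda>w. \<Sum>\<^sub>\<infinity>n\<in>I. f n w) z) (finite_subsets_at_top I)"
  proof (rule higher_deriv_complex_uniform_limit)
    show "uniform_limit (ball z r) (\<lambda>X w. \<Sum>n\<in>X. f n w) (\<lambda>w. \<Sum>\<^sub>\<infinity>n\<in>I. f n w) (finite_subsets_at_top I)"
      by (rule uniform_limit_on_subset[OF ul]) auto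
    show "\<forall>\<^sub>F X in finite_subsets_at_top I. (\<lambda>w. \<Sum>n\<in>X. f n w) holomorphic_on ball z r"
    proof (rule eventually_finite_subsets_at_top_weakI)
      fix X assume "finite X" "X \<subseteq> I"
      then show "(\<lambda>w. \<Sum>n\<in>X. f n w) holomorphic_on ball z r"
        using r by (intro holomorphic_on_sum holomorphic_on_subset[OF hol]) auto
    qed
  qed (use r in auto)
  moreover have "(deriv ^^ m) (\<lambda>w. \<Sum>n\<in>X. f n w) z = (\<Sum>n\<in>X. (deriv ^^ m) (f n) z)"
    if "finite X" "X \<subseteq> I" for X
    using that
  proof (induction X rule: finite_induct)
    case empty
    then show ?case by (simp add: higher_deriv_const)
  next
    case (insert n X)
    have h: "f i holomorphic_on ball z r" if "i \<in> I" for i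
      using r that by (intro holomorphic_on_subset[OF hol]) auto
    have "(deriv ^^ m) (\<lambda>w. f n w + (\<Sum>n\<in>X. f n w)) z = (deriv ^^ m) (f n) z + (deriv ^^ m) (\<lambda>w. \<Sum>n\<in>X. f n w) z"
      using r insert.prems by (intro higher_deriv_add[of _ "ball z r"] holomorphic_on_sum h) auto
    with insert show ?case by simp
  qed
  ultimately show "((\<lambda>n. (deriv ^^ m) (f n) z) has_sum (deriv ^^ m) (\<lambda>w. \<Sum>\<^sub>\<infinity>n\<in>I. f n w) z) I"
    unfolding has_sum_def
    by (elim Lim_transform_eventually) (auto intro!: eventually_finite_subsets_at_top_weakI)
  have ev: "\<forall>\<^sub>F X in finite_subsets_at_top I. continuous_on (cball z r) (\<lambda>w. \<Sum>n\<in>X. f n w) \<and>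
              (\<lambda>w. \<Sum>n\<in>X. f n w) holomorphic_on ball z r"
  proof (rule eventually_finite_subsets_at_top_weakI)
    fix X assume X: "finite X" "X \<subseteq> I"
    have "(\<lambda>w. \<Sum>n\<in>X. f n w) holomorphic_on cball z r"
      using r X by (intro holomorphic_on_sum holomorphic_on_subset[OF hol]) auto
    then show "continuous_on (cball z r) (\<lambda>w. \<Sum>n\<in>X. f n w) \<and> (\<lambda>w. \<Sum>n\<in>X. f n w) holomorphic_on ball z r"
      by (meson ball_subset_cball holomorphic_on_imp_continuous_on holomorphic_on_subset)
  qed
  have "(\<lambda>w. \<Sum>\<^sub>\<infinity>n\<in>I. f n w) holomorphic_on ball z r"
    using holomorphic_uniform_limit[OF ev ul] by auto
  then show "(\<lambda>w. \<Sum>\<^sub>\<infinity>n\<in>I. f n w) field_differentiable at z"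
    using r(1) by (meson centre_in_ball holomorphic_on_imp_differentiable_at open_ball)
qed

lemma normally_summable_holomorphic:
  assumes "normally_summable_on f I S" "\<And>n. n \<in> I \<Longrightarrow> f n holomorphic_on S"
  shows "(\<lambda>w. \<Sum>\<^sub>\<infinity>n\<in>I. f n w) holomorphic_on S"
  using normally_summable_higher_deriv(2)[OF assms]
  by (simp add: holomorphic_on_def field_differentiable_at_within)

lemma normally_summable_has_sum:
  assumes "normally_summable_on f I S" "\<And>n. n \<in> I \<Longrightarrow> f n holomorphic_on S" "z \<in> S"
  shows "((\<lambda>n. f n z) has_sum (\<Sum>\<^sub>\<infinity>n\<in>I. f n z)) I"
  using normally_summable_higher_deriv(1)[OF assms, of 0] by simp

text \<open>Lets the derivative be given in advance as a known sum \<open>D\<close> of explicit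
  termwise derivatives; uniqueness of sums identifies it with the derivative of the limit.\<close>

lemma normally_summable_DERIV:
  assumes "normally_summable_on f I S" "open S" "z \<in> S" "((\<lambda>n. f' n z) has_sum D) I"
    and "\<And>n w. n \<in> I \<Longrightarrow> w \<in> S \<Longrightarrow> (f n has_field_derivative f' n w) (at w)"
  shows "((\<lambda>w. \<Sum>\<^sub>\<infinity>n\<in>I. f n w) has_field_derivative D) (at z)"
proof -
  have hol: "f n holomorphic_on S" if "n \<in> I" for n
    using assms(2,5) that by (auto simp: holomorphic_on_open)
  note D = normally_summable_higher_deriv[OF assms(1) hol assms(3), simplified]
  have "((\<lambda>n. f' n z) has_sum deriv (\<lambda>w. \<Sum>\<^sub>\<infinity>n\<in>I. f n w) z) I"
  proof (rule has_sum_cong[THEN iffD1])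
    show "((\<lambda>n. deriv (f n) z) has_sum deriv (\<lambda>w. \<Sum>\<^sub>\<infinity>n\<in>I. f n w) z) I"
      using D(1)[of 1] by simp
  qed (use assms in \<open>auto intro: DERIV_imp_deriv\<close>)
  with assms(4) have "D = deriv (\<lambda>w. \<Sum>\<^sub>\<infinity>n\<in>I. f n w) z"
    using has_sum_unique by blast
  with D(2) show ?thesis
    by (simp add: DERIV_deriv_iff_field_differentiable)
qed

section \<open>Gaussian majorants and differentiation of the theta family\<close>

lemma summable_on_exp_minus_abs: "(\<lambda>n::int. exp (- \<bar>of_int n\<bar> :: real)) summable_on UNIV"
proof -
  have g: "(\<lambda>k::nat. exp (- real k)) summable_on UNIV"
  proof (rule summable_nonneg_imp_summable_on)
    have "summable (\<lambda>k::nat. (exp (-1::real)) ^ k)"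
      by (rule summable_geometric) auto
    then show "summable (\<lambda>k::nat. exp (- real k))"
      by (simp flip: exp_of_nat_mult)
  qed auto
  have "(\<lambda>n::int. exp (- \<bar>of_int n\<bar> :: real)) summable_on range int"
    by (subst summable_on_reindex) (use g in \<open>auto simp: o_def\<close>)
  moreover have "(\<lambda>n::int. exp (- \<bar>of_int n\<bar> :: real)) summable_on range (\<lambda>k. - int k)"
    by (subst summable_on_reindex) (use g in \<open>auto simp: o_def inj_on_def\<close>)
  ultimately have "(\<lambda>n::int. exp (- \<bar>of_int n\<bar> :: real)) summable_on (range int \<union> range (\<lambda>k. - int k))"
    by (rule summable_on_union)
  moreover have "range int \<union> range (\<lambda>k. - int k) = UNIV"
    by (auto intro: int_cases2)
  ultimately show ?thesis by simp
qed

text \<open>Completing the square leaves \<open>exp (- 2 * x)\<close> to spare, where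
  \<open>x = \<bar>of_int n + a\<bar>\<close>: one factor \<open>exp (- x)\<close> absorbs the power
  \<open>x ^ k\<close>, the other is the geometric majorant. The summand 1 in \<open>b\<close>
  provides this reserve.\<close>

lemma summable_gauss:
  fixes y R a :: real
  assumes y: "y > 0"
  obtains M where "M summable_on (UNIV::int set)"
    "\<And>n. \<bar>of_int n + a\<bar> ^ k * exp (- pi * y * (of_int n + a)\<^sup>2 + 2 * pi * R * \<bar>of_int n + a\<bar>) \<le> M n"
proof
  define b c where "b = 1 + pi * R" and "c = pi * y"
  have c: "c > 0" using y by (simp add: c_def)
  define C where "C = fact k * exp (b\<^sup>2 / c) * exp \<bar>a\<bar>"
  show "(\<lambda>n::int. C * exp (- \<bar>of_int n\<bar>)) summable_on UNIV"
    by (intro summable_on_cmult_right summable_on_exp_minus_abs)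
  fix n :: int
  define x where "x = \<bar>of_int n + a\<bar>"
  have x: "x \<ge> 0" by (simp add: x_def)
  have "x ^ k / fact k \<le> exp x"
  proof -
    have "sum (\<lambda>n. x ^ n /\<^sub>R fact n) {k} \<le> exp x"
      unfolding exp_def by (rule sum_le_suminf[OF summable_exp_generic]) (use x in auto)
    then show ?thesis by (simp add: divide_inverse mult.commute)
  qed
  then have "x ^ k \<le> fact k * exp x" by (simp add: field_simps)
  moreover have "- pi * y * x\<^sup>2 + 2 * pi * R * x \<le> b\<^sup>2 / c - 2 * x"
  proof -
    have "0 \<le> (c * x - b)\<^sup>2 / c" using c by simp
    also have "\<dots> = c * x\<^sup>2 - 2 * b * x + b\<^sup>2 / c"
      using c by (simp add: field_simps power2_eq_square)
    finally show ?thesis by (simp add: b_def c_def algebra_simps)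
  qed
  ultimately have "x ^ k * exp (- pi * y * x\<^sup>2 + 2 * pi * R * x) \<le> (fact k * exp x) * exp (b\<^sup>2 / c - 2 * x)"
    by (intro mult_mono) auto
  also have "\<dots> = fact k * exp (b\<^sup>2 / c) * exp (- x)"
    unfolding mult.assoc mult_exp_exp by simp
  also have "\<dots> \<le> fact k * exp (b\<^sup>2 / c) * exp (\<bar>a\<bar> - \<bar>of_int n\<bar>)"
    by (intro mult_left_mono) (auto simp: x_def)
  also have "\<dots> = C * exp (- \<bar>of_int n\<bar>)"
    by (simp add: C_def exp_diff exp_minus field_simps)
  finally show "\<bar>of_int n + a\<bar> ^ k * exp (- pi * y * (of_int n + a)\<^sup>2 + 2 * pi * R * \<bar>of_int n + a\<bar>) \<le> C * exp (- \<bar>of_int n\<bar>)"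
    by (simp add: x_def)
qed

text \<open>The weights \<open>(n + a)\<^sup>k\<close> make the family closed under differentiation in both variables.\<close>

definition theta_term :: "nat \<Rightarrow> real \<Rightarrow> int \<Rightarrow> complex \<Rightarrow> complex \<Rightarrow> complex" where
  "theta_term k a n u \<tau> = of_real (of_int n + a) ^ k *
     exp (pi * \<i> * of_real (of_int n + a) ^ 2 * \<tau> + 2 * pi * \<i> * of_real (of_int n + a) * u)"

definition theta :: "nat \<Rightarrow> real \<Rightarrow> complex \<Rightarrow> complex \<Rightarrow> complex" where
  "theta k a u \<tau> = (\<Sum>\<^sub>\<infinity>n\<in>UNIV. theta_term k a n u \<tau>)"

lemma norm_theta_term:
  "norm (theta_term k a n u \<tau>) =
     \<bar>of_int n + a\<bar> ^ k * exp (- pi * Im \<tau> * (of_int n + a)\<^sup>2 - 2 * pi * Im u * (of_int n + a))"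
proof -
  have "Im (complex_of_real (of_int n + a) ^ 2) = 0" "Re (complex_of_real (of_int n + a) ^ 2) = (of_int n + a)\<^sup>2"
    by (simp_all flip: of_real_power)
  then show ?thesis
    unfolding theta_term_def norm_mult norm_power norm_of_real norm_exp_eq_Re
    by (simp add: algebra_simps del: of_real_add)
qed

text \<open>A single majorant for a strip of \<open>u\<close> and a half-plane of \<tau>
  simultaneously. This serves joint continuity as well as differentiation along a curve on which
  both arguments move.\<close>

lemma theta_term_bound:
  assumes "y > 0"
  obtains M where "M summable_on (UNIV::int set)"
    "\<And>n u \<tau>. Im \<tau> \<ge> y \<Longrightarrow> \<bar>Im u\<bar> \<le> R \<Longrightarrow> norm (theta_term k a n u \<tau>) \<le> M n"
proof -
  obtain M where M: "M summable_on (UNIV::int set)"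
    "\<And>n. \<bar>of_int n + a\<bar> ^ k * exp (- pi * y * (of_int n + a)\<^sup>2 + 2 * pi * R * \<bar>of_int n + a\<bar>) \<le> M n"
    using summable_gauss[OF assms] by blast
  show ?thesis
  proof
    fix n u \<tau> assume *: "Im \<tau> \<ge> y" "\<bar>Im u\<bar> \<le> R"
    let ?x = "of_int n + a :: real"
    have "- (Im u * ?x) \<le> \<bar>Im u\<bar> * \<bar>?x\<bar>" by (metis abs_ge_minus_self abs_mult)
    also have "\<dots> \<le> R * \<bar>?x\<bar>" using * by (intro mult_right_mono) auto
    finally have 1: "2 * pi * - (Im u * ?x) \<le> 2 * pi * (R * \<bar>?x\<bar>)" by (intro mult_left_mono) auto
    have 2: "y * ?x\<^sup>2 \<le> Im \<tau> * ?x\<^sup>2" using * by (intro mult_right_mono) auto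
    have "norm (theta_term k a n u \<tau>) \<le> \<bar>?x\<bar> ^ k * exp (- pi * y * ?x\<^sup>2 + 2 * pi * R * \<bar>?x\<bar>)"
      unfolding norm_theta_term
    proof (intro mult_left_mono)
      show "exp (- pi * Im \<tau> * ?x\<^sup>2 - 2 * pi * Im u * ?x) \<le> exp (- pi * y * ?x\<^sup>2 + 2 * pi * R * \<bar>?x\<bar>)"
        unfolding exp_le_cancel_iff using 1 mult_left_mono[OF 2, of pi, OF pi_ge_zero]
        by (simp only: mult.assoc mult_minus_left mult_minus_right)
    qed auto
    then show "norm (theta_term k a n u \<tau>) \<le> M n" using M(2)[of n] by linarith
  qed (rule M(1))
qed

lemma normally_summable_theta_term:
  assumes S: "open S" and U: "U holomorphic_on S" and T: "T holomorphic_on S"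
    and pos: "\<And>z. z \<in> S \<Longrightarrow> Im (T z) > 0"
  shows "normally_summable_on (\<lambda>n z. theta_term k a n (U z) (T z)) UNIV S"
  unfolding normally_summable_on_def
proof
  fix z assume "z \<in> S"
  then obtain r where r: "r > 0" "cball z r \<subseteq> S" using S open_contains_cball by blast
  have cT: "continuous_on (cball z r) (\<lambda>z. Im (T z))" and cU: "continuous_on (cball z r) (\<lambda>z. \<bar>Im (U z)\<bar>)"
    using U T r(2) by (auto intro!: continuous_intros dest!: holomorphic_on_imp_continuous_on intro: continuous_on_subset)
  obtain z1 where z1: "z1 \<in> cball z r" "\<And>w. w \<in> cball z r \<Longrightarrow> Im (T z1) \<le> Im (T w)"
    using continuous_attains_inf[OF compact_cball _ cT] r by force
  obtain z2 where z2: "\<And>w. w \<in> cball z r \<Longrightarrow> \<bar>Im (U w)\<bar> \<le> \<bar>Im (U z2)\<bar>"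
    using continuous_attains_sup[OF compact_cball _ cU] r by force
  obtain M where "M summable_on (UNIV::int set)"
    "\<And>n u \<tau>. Im \<tau> \<ge> Im (T z1) \<Longrightarrow> \<bar>Im u\<bar> \<le> \<bar>Im (U z2)\<bar> \<Longrightarrow> norm (theta_term k a n u \<tau>) \<le> M n"
    using theta_term_bound[of "Im (T z1)"] pos r z1(1) by blast
  then show "\<exists>r>0. \<exists>M. cball z r \<subseteq> S \<and> M summable_on (UNIV::int set) \<and>
      (\<forall>w\<in>cball z r. \<forall>n\<in>UNIV. norm (theta_term k a n (U w) (T w)) \<le> M n)"
    using r z1 z2 by (intro exI[of _ r] exI[of _ M]) auto
qed

lemma theta_term_has_sum:
  assumes "Im \<tau> > 0"
  shows "((\<lambda>n. theta_term k a n u \<tau>) has_sum theta k a u \<tau>) UNIV"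
  using normally_summable_has_sum[OF normally_summable_theta_term[of UNIV "\<lambda>_. u" "\<lambda>_. \<tau>" k a]] assms
  by (auto simp: theta_def theta_term_def)

lemma theta_term_DERIV:
  assumes "(U has_field_derivative U') (at z)" "(T has_field_derivative T') (at z)"
  shows "((\<lambda>z. theta_term k a n (U z) (T z)) has_field_derivative
     (2 * pi * \<i> * U' * theta_term (Suc k) a n (U z) (T z) + pi * \<i> * T' * theta_term (Suc (Suc k)) a n (U z) (T z))) (at z)"
  unfolding theta_term_def
  by (rule derivative_eq_intros assms refl)+ (simp add: algebra_simps power2_eq_square)

text \<open>A general holomorphic path \<open>(U z, T z)\<close> is needed because in
  \<open>vartheta (\<alpha> * \<tau> + \<beta>) \<tau>\<close> both arguments depend on \<tau>. A
  derivative in the first argument raises the weight by one, in the second by two: this is the heat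
  equation.\<close>

lemma theta_DERIV:
  assumes S: "open S" "z \<in> S"
    and U: "\<And>w. w \<in> S \<Longrightarrow> (U has_field_derivative U' w) (at w)"
    and T: "\<And>w. w \<in> S \<Longrightarrow> (T has_field_derivative T' w) (at w)"
    and pos: "\<And>w. w \<in> S \<Longrightarrow> Im (T w) > 0"
  shows "((\<lambda>z. theta k a (U z) (T z)) has_field_derivative
     (2 * pi * \<i> * U' z * theta (Suc k) a (U z) (T z) + pi * \<i> * T' z * theta (Suc (Suc k)) a (U z) (T z))) (at z)"
proof -
  have hol: "U holomorphic_on S" "T holomorphic_on S"
    using S U T by (auto simp: holomorphic_on_open)
  show ?thesis
    unfolding theta_def[of k]
  proof (rule normally_summable_DERIV[OF normally_summable_theta_term[OF S(1) hol pos] S])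
    show "((\<lambda>n. 2 * pi * \<i> * U' z * theta_term (Suc k) a n (U z) (T z) +
            pi * \<i> * T' z * theta_term (Suc (Suc k)) a n (U z) (T z)) has_sum
          2 * pi * \<i> * U' z * theta (Suc k) a (U z) (T z) +
            pi * \<i> * T' z * theta (Suc (Suc k)) a (U z) (T z)) UNIV"
      using pos[OF S(2)] by (intro has_sum_add has_sum_cmult_right theta_term_has_sum)
  qed (auto intro: theta_term_DERIV[OF U T] simp del: of_real_mult)
qed

lemma theta_DERIV_u [derivative_intros]:
  assumes "(g has_field_derivative g') (at z within A)" "Im \<tau> > 0"
  shows "((\<lambda>z. theta k a (g z) \<tau>) has_field_derivative (2 * pi * \<i> * theta (Suc k) a (g z) \<tau>) * g') (at z within A)"
proof -
  have "((\<lambda>u. theta k a u \<tau>) has_field_derivative (2 * pi * \<i> * theta (Suc k) a (g z) \<tau>)) (at (g z))"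
    using theta_DERIV[of UNIV "g z" "\<lambda>u. u" "\<lambda>_. 1" "\<lambda>_. \<tau>" "\<lambda>_. 0" k a] assms(2) by auto
  from DERIV_chain'[OF assms(1) this] show ?thesis by simp
qed

lemma open_upper_half_plane: "open upper_half_plane"
  unfolding upper_half_plane_def by (rule open_halfspace_Im_gt)

lemma theta_continuous_on: "continuous_on (UNIV \<times> upper_half_plane) (\<lambda>p. theta k a (fst p) (snd p))"
proof (rule continuous_at_imp_continuous_on, rule ballI)
  fix p :: "complex \<times> complex" assume "p \<in> UNIV \<times> upper_half_plane"
  then have p: "Im (snd p) > 0" by (auto simp: upper_half_plane_def)
  define S where "S = {q::complex\<times>complex. Im (snd q) > Im (snd p) / 2 \<and> \<bar>Im (fst q)\<bar> < \<bar>Im (fst p)\<bar> + 1}"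
  have S: "open S" unfolding S_def
    by (intro open_Collect_conj open_Collect_less continuous_intros)
  obtain M where M: "M summable_on (UNIV::int set)"
    "\<And>n u \<tau>. Im \<tau> \<ge> Im (snd p) / 2 \<Longrightarrow> \<bar>Im u\<bar> \<le> \<bar>Im (fst p)\<bar> + 1 \<Longrightarrow> norm (theta_term k a n u \<tau>) \<le> M n"
    using theta_term_bound[of "Im (snd p) / 2"] p by (metis half_gt_zero)
  have "uniform_limit S (\<lambda>X q. \<Sum>n\<in>X. theta_term k a n (fst q) (snd q))
          (\<lambda>q. \<Sum>\<^sub>\<infinity>n\<in>UNIV. theta_term k a n (fst q) (snd q)) (finite_subsets_at_top UNIV)"
    by (rule Weierstrass_m_test_general[OF _ M(1)]) (auto simp: S_def intro!: M(2))
  then have "continuous_on S (\<lambda>q. theta k a (fst q) (snd q))"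
    unfolding theta_def
    by (rule uniform_limit_theorem[rotated])
       (auto intro!: always_eventually continuous_intros simp: theta_term_def)
  then show "isCont (\<lambda>q. theta k a (fst q) (snd q)) p"
    using continuous_on_eq_continuous_at[OF S, of "\<lambda>q. theta k a (fst q) (snd q)"] p
    by (cases p) (simp add: S_def)
qed

section \<open>Quasi-periodicity and parity\<close>

lemma theta_shift_one:
  "theta k a (u + 1) \<tau> = exp (2 * pi * \<i> * a) * theta k a u \<tau>"
proof -
  have "theta_term k a n (u + 1) \<tau> = exp (2 * pi * \<i> * a) * theta_term k a n u \<tau>" for n
  proof -
    have "exp (2 * pi * \<i> * of_int n) = 1"
      using exp_integer_2pi[of "of_int n"] by (simp add: mult_ac)
    then show ?thesis
      unfolding theta_term_def by (simp add: algebra_simps exp_add)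
  qed
  then show ?thesis unfolding theta_def by (simp add: infsum_cmult_right')
qed

text \<open>Completing the square turns the shift by \<tau> into the index shift from
  \<open>n\<close> to \<open>n + 1\<close>. The weight is 0 because a factor
  \<open>(n + a) ^ k\<close> would not survive that index shift.\<close>

lemma theta_shift_tau:
  "theta 0 a (u + \<tau>) \<tau> = exp (- pi * \<i> * \<tau> - 2 * pi * \<i> * u) * theta 0 a u \<tau>"
proof -
  have "theta 0 a (u + \<tau>) \<tau> = (\<Sum>\<^sub>\<infinity>n\<in>UNIV. exp (- pi * \<i> * \<tau> - 2 * pi * \<i> * u) * theta_term 0 a (n + 1) u \<tau>)"
    unfolding theta_def theta_term_def mult_1 power_0 mult_exp_exp
    by (intro infsum_cong arg_cong[of _ _ exp]) (simp add: algebra_simps power2_eq_square)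
  also have "\<dots> = exp (- pi * \<i> * \<tau> - 2 * pi * \<i> * u) * theta 0 a u \<tau>"
    unfolding infsum_cmult_right' theta_def
    by (rule arg_cong[of _ _ "(*) _"], rule infsum_reindex_bij_witness[of _ "\<lambda>n. n - 1" "\<lambda>n. n + 1"]) auto
  finally show ?thesis .
qed

lemma vartheta_eq_theta: "vartheta u \<tau> = theta 0 (1/2) (u + 1/2) \<tau>"
  by (simp add: vartheta_def theta_def theta_term_def)

lemma vartheta0_eq_theta: "vartheta0 u \<tau> = theta 0 0 u \<tau>"
  by (simp add: vartheta0_def theta_def theta_term_def)

lemma vartheta1_eq_theta: "vartheta1 u \<tau> = theta 0 (1/2) u \<tau>"
  by (simp add: vartheta1_def theta_def theta_term_def)

lemma vartheta_shift_one: "vartheta (u + 1) \<tau> = - vartheta u \<tau>"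
  using theta_shift_one[of 0 "1/2" "u + 1/2" \<tau>] by (simp add: vartheta_eq_theta algebra_simps)

lemma vartheta_shift_tau:
  "vartheta (u + \<tau>) \<tau> = - exp (- pi * \<i> * \<tau> - 2 * pi * \<i> * u) * vartheta u \<tau>"
proof -
  have "exp (- pi * \<i> * \<tau> - 2 * pi * \<i> * (u + 1/2)) = - exp (- pi * \<i> * \<tau> - 2 * pi * \<i> * u)"
    by (simp add: algebra_simps exp_diff exp_add exp_minus)
  then show ?thesis
    using theta_shift_tau[of "1/2" "u + 1/2" \<tau>] by (simp add: vartheta_eq_theta algebra_simps)
qed

text \<open>The reflection \<open>n \<mapsto> - n - 1\<close> changes the sign of
  \<open>n + 1/2\<close>, so \<open>theta 0 (1/2)\<close> is even; the half period built into
  \<open>vartheta\<close> then produces the sign through \<open>vartheta_shift_one\<close>.\<close>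

lemma vartheta_uminus:
  "vartheta (- u) \<tau> = - vartheta u \<tau>"
proof -
  have "theta 0 (1/2) (- w) \<tau> = theta 0 (1/2) w \<tau>" for w
    unfolding theta_def
    by (rule infsum_reindex_bij_witness[of _ "\<lambda>n. - n - 1" "\<lambda>n. - n - 1"])
       (auto simp: theta_term_def algebra_simps power2_eq_square)
  from this[of "u - 1/2"] have "vartheta (- u) \<tau> = vartheta (u - 1) \<tau>"
    by (simp add: vartheta_eq_theta algebra_simps)
  then show ?thesis using vartheta_shift_one[of "u - 1" \<tau>] by simp
qed

section \<open>The Jacobi triple product\<close>

text \<open>The nome is written as \<open>q = exp t\<close>, so that half-integral powers of \<open>q\<close> are available.\<close>

definition q_poch :: "complex \<Rightarrow> nat \<Rightarrow> complex" where
  "q_poch t m = (\<Prod>i<m. 1 - exp (t * of_nat (Suc i)))"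

text \<open>The default 0 for \<open>k > m\<close> makes the Pascal rule hold also at
  \<open>k = m\<close> and lets sums over \<open>k \<le> m\<close> be extended by one term.\<close>

definition q_binomial :: "complex \<Rightarrow> nat \<Rightarrow> nat \<Rightarrow> complex" where
  "q_binomial t m k = (if k \<le> m then q_poch t m / (q_poch t k * q_poch t (m - k)) else 0)"

lemma q_power_neq_1:
  assumes "Re t < 0"
  shows "exp (t * of_nat (Suc i)) \<noteq> 1"
proof
  assume "exp (t * of_nat (Suc i)) = 1"
  then have "norm (exp (t * of_nat (Suc i))) = 1" by simp
  then have "Re t * real (Suc i) = 0" by (simp add: algebra_simps)
  with assms show False by auto
qed

lemma q_poch_nonzero: "Re t < 0 \<Longrightarrow> q_poch t m \<noteq> 0"
  by (auto simp: q_poch_def q_power_neq_1[symmetric] simp del: of_nat_Suc)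

lemma q_poch_Suc: "q_poch t (Suc m) = q_poch t m * (1 - exp (t * of_nat (Suc m)))"
  by (simp add: q_poch_def)

lemma q_binomial_0: "Re t < 0 \<Longrightarrow> q_binomial t m 0 = 1"
  using q_poch_nonzero[of t m] by (simp add: q_binomial_def) (simp add: q_poch_def)

text \<open>Over a common denominator this is \<open>1 - x * y = (1 - y) + y * (1 - x)\<close> with
  \<open>x = q^(k+1)\<close> and \<open>y = q^(m-k)\<close>. Of the two q-Pascal rules this is the
  one that fits multiplication by the last factor \<open>1 + x * q^m\<close> of the product.\<close>

lemma q_binomial_Suc_Suc:
  assumes t: "Re t < 0" and k: "k \<le> m"
  shows "q_binomial t (Suc m) (Suc k) = q_binomial t m (Suc k) + exp (t * of_nat (m - k)) * q_binomial t m k"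
proof (cases "k = m")
  case True
  then show ?thesis
    using q_poch_nonzero[OF t, of m] q_poch_nonzero[OF t, of "Suc m"]
    by (simp add: q_binomial_def q_poch_def)
next
  case False
  then obtain j where j: "m = Suc (k + j)" using k by (metis add_Suc_right le_neq_implies_less less_iff_Suc_add)
  define x y where "x = exp (t * of_nat (Suc k))" and "y = exp (t * of_nat (Suc j))"
  have nz: "q_poch t k \<noteq> 0" "q_poch t j \<noteq> 0" "1 - x \<noteq> 0" "1 - y \<noteq> 0"
    using q_poch_nonzero[OF t] q_power_neq_1[OF t] by (auto simp: x_def y_def simp del: of_nat_Suc)
  have e: "exp (t * of_nat (Suc m)) = x * y"
    by (simp add: j x_def y_def algebra_simps flip: exp_add)
  have 1: "q_binomial t (Suc m) (Suc k) = q_poch t m * (1 - x * y) / (q_poch t k * (1 - x) * (q_poch t j * (1 - y)))"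
    using j e by (simp add: q_binomial_def q_poch_Suc x_def y_def del: of_nat_Suc)
  have 2: "q_binomial t m (Suc k) = q_poch t m / (q_poch t k * (1 - x) * q_poch t j)"
    using j by (simp add: q_binomial_def q_poch_Suc x_def y_def del: of_nat_Suc)
  have 3: "q_binomial t m k = q_poch t m / (q_poch t k * (q_poch t j * (1 - y)))"
    using j by (simp add: q_binomial_def q_poch_Suc x_def y_def Suc_diff_le del: of_nat_Suc)
  have 4: "exp (t * of_nat (m - k)) = y" using j by (simp add: y_def Suc_diff_le)
  show ?thesis unfolding 1 2 3 4 using nz by (simp add: divide_simps) (simp add: algebra_simps)
qed

lemma q_binomial_theorem:
  assumes t: "Re t < 0"
  shows "(\<Prod>i<m. 1 + x * exp (t * of_nat i)) =
     (\<Sum>k\<le>m. q_binomial t m k * exp (t * (of_nat k * (of_nat k - 1) / 2)) * x ^ k)"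
proof (induction m)
  case 0
  show ?case using q_binomial_0[OF t] by simp
next
  case (Suc m)
  define a where "a k = exp (t * (of_nat k * (of_nat k - 1) / 2)) * x ^ k" for k :: nat
  have a: "a (Suc k) * exp (t * of_nat (m - k)) = a k * (x * exp (t * of_nat m))" if "k \<le> m" for k
  proof -
    have "exp (t * (of_nat (Suc k) * (of_nat (Suc k) - 1) / 2)) * exp (t * of_nat (m - k)) =
        exp (t * (of_nat k * (of_nat k - 1) / 2)) * exp (t * of_nat m)"
      unfolding mult_exp_exp using that by (intro arg_cong[of _ _ exp]) (simp add: of_nat_diff field_simps)
    then show ?thesis by (simp add: a_def mult_ac)
  qed
  have "(\<Sum>k\<le>Suc m. q_binomial t (Suc m) k * a k)
      = q_binomial t (Suc m) 0 * a 0 + (\<Sum>k\<le>m. q_binomial t (Suc m) (Suc k) * a (Suc k))"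
    by (rule sum.atMost_Suc_shift)
  also have "(\<Sum>k\<le>m. q_binomial t (Suc m) (Suc k) * a (Suc k)) =
      (\<Sum>k\<le>m. q_binomial t m (Suc k) * a (Suc k)) + (\<Sum>k\<le>m. q_binomial t m k * a k * (x * exp (t * of_nat m)))"
    unfolding sum.distrib[symmetric]
  proof (rule sum.cong[OF refl])
    fix k assume "k \<in> {..m}"
    then have k: "k \<le> m" by simp
    show "q_binomial t (Suc m) (Suc k) * a (Suc k) =
        q_binomial t m (Suc k) * a (Suc k) + q_binomial t m k * a k * (x * exp (t * of_nat m))"
      unfolding q_binomial_Suc_Suc[OF t k] using a[OF k] by (simp add: algebra_simps)
  qed
  also have "q_binomial t (Suc m) 0 * a 0 + (\<dots>) =
      (\<Sum>k\<le>Suc m. q_binomial t m k * a k) + (\<Sum>k\<le>m. q_binomial t m k * a k) * (x * exp (t * of_nat m))"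
    unfolding sum.atMost_Suc_shift[of _ m] sum_distrib_right q_binomial_0[OF t] by simp
  also have "(\<Sum>k\<le>Suc m. q_binomial t m k * a k) = (\<Sum>k\<le>m. q_binomial t m k * a k)"
    by (simp add: q_binomial_def)
  finally show ?case
    using Suc.IH by (simp add: a_def algebra_simps)
qed

text \<open>The q-binomial theorem with \<open>2 * N\<close> factors, recentred. For
  \<open>x = exp w * q^(1-N)\<close> the first \<open>N\<close> factors, read backwards, are
  \<open>1 + exp (w - t * i) = exp (w - t * i) * (1 + exp (t * i - w))\<close>, the last
  \<open>N\<close> are \<open>1 + exp (t * (i + 1) + w)\<close>, and the summation index becomes
  \<open>n = k - N\<close>. The extracted exponentials multiply to \<open>C\<close>, which
  cancels.\<close>

lemma finite_triple_product:
  assumes t: "Re t < 0"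
  shows "(\<Prod>i<N. (1 + exp (t * of_nat (Suc i) + w)) * (1 + exp (t * of_nat i - w))) =
     (\<Sum>n\<in>{- int N..int N}. q_binomial t (2 * N) (nat (int N + n)) *
        exp (t * (of_int n * (of_int n + 1) / 2) + of_int n * w))"
proof -
  define x where "x = exp (w + t * (1 - of_nat N))"
  define C where "C = exp (of_nat N * w - t * (of_nat N * (of_nat N - 1) / 2))"
  have C: "(\<Prod>i<N. exp (w - t * of_nat i)) = C"
    unfolding C_def
  proof (induction N)
    case (Suc N)
    show ?case
      unfolding prod.lessThan_Suc Suc.IH mult_exp_exp
      by (intro arg_cong[of _ _ exp]) (simp add: field_simps)
  qed simp
  have "(\<Prod>i<2 * N. 1 + x * exp (t * of_nat i)) = (\<Prod>i<N. 1 + x * exp (t * of_nat i)) * (\<Prod>i<N. 1 + x * exp (t * of_nat (N + i)))"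
  proof -
    have *: "(\<Prod>i<N + M. f i) = (\<Prod>i<N. f i) * (\<Prod>i<M. f (N + i))" for f :: "nat \<Rightarrow> complex" and M
      by (induction M) (auto simp: mult_ac)
    show ?thesis using *[of _ N] by (simp only: mult_2)
  qed
  also have "(\<Prod>i<N. 1 + x * exp (t * of_nat i)) = (\<Prod>i<N. 1 + x * exp (t * of_nat (N - Suc i)))"
    by (rule prod.nat_diff_reindex[symmetric])
  also have "\<dots> = (\<Prod>i<N. exp (w - t * of_nat i) * (1 + exp (t * of_nat i - w)))"
  proof (rule prod.cong[OF refl])
    fix i assume "i \<in> {..<N}"
    then have "w + t * (1 - of_nat N) + t * of_nat (N - Suc i) = w - t * of_nat i"
      by (simp add: of_nat_diff algebra_simps)
    then have "x * exp (t * of_nat (N - Suc i)) = exp (w - t * of_nat i)"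
      by (simp only: x_def mult_exp_exp)
    then show "1 + x * exp (t * of_nat (N - Suc i)) = exp (w - t * of_nat i) * (1 + exp (t * of_nat i - w))"
      by (simp add: distrib_left mult_exp_exp)
  qed
  also have "(\<Prod>i<N. 1 + x * exp (t * of_nat (N + i))) = (\<Prod>i<N. 1 + exp (t * of_nat (Suc i) + w))"
  proof (rule prod.cong[OF refl])
    fix i assume "i \<in> {..<N}"
    have "w + t * (1 - of_nat N) + t * of_nat (N + i) = t * of_nat (Suc i) + w"
      by (simp add: algebra_simps)
    then show "1 + x * exp (t * of_nat (N + i)) = 1 + exp (t * of_nat (Suc i) + w)"
      by (simp only: x_def mult_exp_exp)
  qed
  finally have L: "(\<Prod>i<2 * N. 1 + x * exp (t * of_nat i)) =
      C * (\<Prod>i<N. (1 + exp (t * of_nat (Suc i) + w)) * (1 + exp (t * of_nat i - w)))"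
    by (simp add: prod.distrib C)
  have "(\<Prod>i<2 * N. 1 + x * exp (t * of_nat i)) =
     (\<Sum>k\<le>2 * N. q_binomial t (2 * N) k * exp (t * (of_nat k * (of_nat k - 1) / 2)) * x ^ k)"
    by (rule q_binomial_theorem[OF t])
  also have "\<dots> = (\<Sum>n\<in>{- int N..int N}. C * (q_binomial t (2 * N) (nat (int N + n)) *
        exp (t * (of_int n * (of_int n + 1) / 2) + of_int n * w)))"
  proof (rule sum.reindex_bij_witness[of _ "\<lambda>n. nat (int N + n)" "\<lambda>k. int k - int N"])
    fix k assume "k \<in> {..2 * N}"
    have "exp (t * (of_nat k * (of_nat k - 1) / 2)) * x ^ k =
        C * exp (t * (of_int (int k - int N) * (of_int (int k - int N) + 1) / 2) + of_int (int k - int N) * w)"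
      unfolding C_def x_def exp_of_nat_mult[symmetric] mult_exp_exp
      by (intro arg_cong[of _ _ exp]) (simp add: field_simps)
    then show "C * (q_binomial t (2 * N) (nat (int N + (int k - int N))) *
        exp (t * (of_int (int k - int N) * (of_int (int k - int N) + 1) / 2) + of_int (int k - int N) * w)) =
        q_binomial t (2 * N) k * exp (t * (of_nat k * (of_nat k - 1) / 2)) * x ^ k"
      by simp
  qed auto
  finally have "C * (\<Prod>i<N. (1 + exp (t * of_nat (Suc i) + w)) * (1 + exp (t * of_nat i - w))) =
     C * (\<Sum>n\<in>{- int N..int N}. q_binomial t (2 * N) (nat (int N + n)) *
        exp (t * (of_int n * (of_int n + 1) / 2) + of_int n * w))"
    unfolding L sum_distrib_left .
  then show ?thesis by (simp add: C_def)
qed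

section \<open>Limit of the finite triple product\<close>

lemma convergent_prod_one_plus_exp:
  assumes t: "Re t < 0"
  shows "convergent_prod (\<lambda>i. 1 + c * exp (t * of_nat i))"
proof (rule abs_convergent_prod_imp_convergent_prod, rule summable_imp_abs_convergent_prod)
  have "summable (\<lambda>i. norm c * exp (Re t) ^ i)"
    using t by (intro summable_mult summable_geometric) auto
  then show "summable (\<lambda>i. norm (1 + c * exp (t * of_nat i) - 1))"
    by (simp add: norm_mult mult.commute[of "Re t"] exp_of_nat_mult)
qed

lemma q_poch_tendsto:
  assumes t: "Re t < 0"
  shows "(\<lambda>N. q_poch t N) \<longlonglongrightarrow> (\<Prod>i. 1 - exp t ^ Suc i)" "(\<Prod>i. 1 - exp t ^ Suc i) \<noteq> 0"
proof -
  have e: "1 + (- exp t) * exp (t * of_nat i) = 1 - exp t ^ Suc i" for i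
    by (simp add: mult.commute[of t] exp_of_nat_mult)
  have c: "convergent_prod (\<lambda>i. 1 - exp t ^ Suc i)"
    using convergent_prod_one_plus_exp[OF t, of "- exp t"] unfolding e .
  have eq: "exp t ^ Suc i = exp (t * of_nat (Suc i))" for i
    by (metis exp_of_nat_mult mult.commute)
  show "(\<Prod>i. 1 - exp t ^ Suc i) \<noteq> 0"
    using q_power_neq_1[OF t] by (intro prodinf_nonzero c) (metis eq right_minus_eq)
  show "(\<lambda>N. q_poch t N) \<longlonglongrightarrow> (\<Prod>i. 1 - exp t ^ Suc i)"
    using convergent_prod_LIMSEQ[OF c] unfolding q_poch_def eq
    by (subst (asm) LIMSEQ_lessThan_iff_atMost[symmetric]) auto
qed

text \<open>Tannery's theorem: for fixed \<open>n\<close> the coefficient tends to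
  \<open>L / (L * L)\<close>, and all coefficients share one bound, so a multiple of
  \<open>norm (a n)\<close> dominates. The sequence \<open>a\<close> stays general because the lemma
  serves the product itself and its derivative in \<open>w\<close>.\<close>

lemma q_binomial_sum_tendsto:
  fixes a :: "int \<Rightarrow> complex"
  assumes t: "Re t < 0" and a: "a summable_on UNIV"
  shows "(\<lambda>N. \<Sum>n\<in>{- int N..int N}. q_binomial t (2 * N) (nat (int N + n)) * a n)
      \<longlonglongrightarrow> (\<Sum>\<^sub>\<infinity>n. a n) / (\<Prod>i. 1 - exp t ^ Suc i)"
proof -
  define L where "L = (\<Prod>i. 1 - exp t ^ Suc i)"
  have L: "q_poch t \<longlonglongrightarrow> L" "L \<noteq> 0"
    using q_poch_tendsto[OF t] by (simp_all add: L_def)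
  have inv: "(\<lambda>N. inverse (q_poch t N)) \<longlonglongrightarrow> inverse L" by (intro tendsto_inverse L)
  obtain K1 where K1: "K1 > 0" "\<And>N. norm (q_poch t N) \<le> K1"
    using convergent_imp_Bseq[OF convergentI[OF L(1)]] by (auto simp: Bseq_def)
  obtain K2 where K2: "K2 > 0" "\<And>N. norm (inverse (q_poch t N)) \<le> K2"
    using convergent_imp_Bseq[OF convergentI[OF inv]] by (auto simp: Bseq_def)
  define g where "g n N = (if n \<in> {- int N..int N} then q_binomial t (2 * N) (nat (int N + n)) * a n else 0)" for n N
  have bound: "norm (g n N) \<le> K1 * (K2 * K2) * norm (a n)" for n N
  proof -
    have "norm (q_binomial t m k) \<le> K1 * (K2 * K2)" for m k
    proof (cases "k \<le> m")
      case True
      then have "norm (q_binomial t m k) = norm (q_poch t m) * (norm (inverse (q_poch t k)) * norm (inverse (q_poch t (m - k))))"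
        by (simp add: q_binomial_def norm_divide norm_mult norm_inverse divide_inverse)
      also have "\<dots> \<le> K1 * (K2 * K2)"
        using K1 K2 by (intro mult_mono) auto
      finally show ?thesis .
    qed (use K1 K2 in \<open>simp add: q_binomial_def\<close>)
    then show ?thesis
      using K1 K2 by (auto simp: g_def norm_mult intro!: mult_right_mono)
  qed
  have "uniform_limit UNIV (\<lambda>X N. \<Sum>n\<in>X. g n N) (\<lambda>N. \<Sum>\<^sub>\<infinity>n. g n N) (finite_subsets_at_top UNIV)"
  proof (rule Weierstrass_m_test_general)
    show "(\<lambda>n. K1 * (K2 * K2) * norm (a n)) summable_on UNIV"
      using a by (intro summable_on_cmult_right) (simp add: summable_on_iff_abs_summable_on_complex)
  qed (use bound in auto)
  then have "((\<lambda>N. \<Sum>\<^sub>\<infinity>n. g n N) \<longlongrightarrow> (\<Sum>\<^sub>\<infinity>n. a n) / L) sequentially"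
  proof (rule swap_uniform_limit'[rotated 2])
    show "\<forall>\<^sub>F X in finite_subsets_at_top UNIV. ((\<lambda>N. \<Sum>n\<in>X. g n N) \<longlongrightarrow> (\<Sum>n\<in>X. a n / L)) sequentially"
    proof (intro always_eventually allI tendsto_sum)
      fix n :: int
      have "(\<lambda>N. q_poch t (2 * N) * (inverse (q_poch t (nat (int N + n))) * inverse (q_poch t (2 * N - nat (int N + n)))) * a n)
          \<longlonglongrightarrow> L * (inverse L * inverse L) * a n"
      proof (intro tendsto_mult tendsto_const)
        have f1: "filterlim (\<lambda>N. 2 * N) sequentially sequentially"
          by (rule filterlim_subseq) (simp add: strict_mono_def)
        have f2: "filterlim (\<lambda>N. nat (int N + n)) sequentially sequentially" for n
          unfolding filterlim_at_top eventually_sequentially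
          by (intro allI) (rule_tac x="nat (int Z - n)" in exI, auto)
        \<comment> \<open>Subtraction on naturals is truncated; the difference equals
          \<open>N - n\<close> once \<open>N \<ge> \<bar>n\<bar>\<close>.\<close>
        have f3: "filterlim (\<lambda>N. 2 * N - nat (int N + n)) sequentially sequentially"
        proof (rule filterlim_cong[THEN iffD1, OF refl refl _ f2[of "- n"]])
          show "\<forall>\<^sub>F N in sequentially. nat (int N + - n) = 2 * N - nat (int N + n)"
            using eventually_ge_at_top[of "nat \<bar>n\<bar>"] by eventually_elim auto
        qed
        show "(\<lambda>N. q_poch t (2 * N)) \<longlonglongrightarrow> L" by (rule filterlim_compose[OF L(1) f1])
        show "(\<lambda>N. inverse (q_poch t (nat (int N + n)))) \<longlonglongrightarrow> inverse L" by (rule filterlim_compose[OF inv f2])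
        show "(\<lambda>N. inverse (q_poch t (2 * N - nat (int N + n)))) \<longlonglongrightarrow> inverse L" by (rule filterlim_compose[OF inv f3])
      qed
      moreover have "\<forall>\<^sub>F N in sequentially. q_poch t (2 * N) * (inverse (q_poch t (nat (int N + n))) * inverse (q_poch t (2 * N - nat (int N + n)))) * a n = g n N"
        using eventually_ge_at_top[of "nat \<bar>n\<bar>"]
        by eventually_elim (auto simp: g_def q_binomial_def divide_inverse)
      ultimately have "g n \<longlonglongrightarrow> L * (inverse L * inverse L) * a n"
        by (rule Lim_transform_eventually)
      then show "g n \<longlonglongrightarrow> a n / L" using L(2) by (simp add: field_simps)
    qed
    show "((\<lambda>X. \<Sum>n\<in>X. a n / L) \<longlongrightarrow> (\<Sum>\<^sub>\<infinity>n. a n) / L) (finite_subsets_at_top UNIV)"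
      using has_sum_divide_const[OF has_sum_infsum[OF a], of L] by (simp add: has_sum_def)
  qed auto
  moreover have "(\<Sum>\<^sub>\<infinity>n. g n N) = (\<Sum>n\<in>{- int N..int N}. q_binomial t (2 * N) (nat (int N + n)) * a n)" for N
    by (subst infsum_cong_neutral[where T = "{- int N..int N}" and g = "\<lambda>n. g n N"]) (auto simp: g_def)
  ultimately show ?thesis by (simp add: L_def)
qed

section \<open>The zeros of \<open>vartheta\<close> and its derivative at 0\<close>

lemma exp_half_pi: "exp (pi * \<i> / 2) = \<i>"
  using cis_conv_exp[of "pi / 2"] by (simp add: mult.commute)

lemma has_sum_diff:
  fixes f g :: "'i \<Rightarrow> complex"
  assumes "(f has_sum a) A" "(g has_sum b) A"
  shows "((\<lambda>x. f x - g x) has_sum a - b) A"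
  using has_sum_add[OF assms(1) has_sum_uminusI[OF assms(2)]] by simp

text \<open>The codomain is arbitrary because \<open>P\<close> is also instantiated by predicates:
  vanishing of \<open>vartheta\<close>, membership in the lattice, existence of a
  multiplier.\<close>

lemma doubly_periodic_lattice:
  fixes P :: "complex \<Rightarrow> 'a"
  assumes one: "\<And>u. P (u + 1) = P u" and tau: "\<And>u. P (u + \<tau>) = P u"
    and l: "l \<in> period_lattice \<tau>"
  shows "P (u + l) = P u"
proof -
  have int: "P (u + of_int n * w) = P u" if "\<And>u. P (u + w) = P u" for n u w
  proof (induction n rule: int_induct[of _ 0])
    case (step1 i)
    then show ?case using that[of "u + of_int i * w"] by (simp add: algebra_simps)
  next
    case (step2 i)
    then show ?case using that[of "u + of_int (i - 1) * w"] by (simp add: algebra_simps)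
  qed simp
  obtain m n where "l = of_int m * \<tau> + of_int n" using l by (auto simp: period_lattice_def)
  then show ?thesis
    using int[OF one, of "u + of_int m * \<tau>" n] int[OF tau, of u m] by (simp add: add.assoc)
qed

lemma vartheta_lattice:
  assumes "Im \<tau> > 0" "l \<in> period_lattice \<tau>"
  shows "vartheta l \<tau> = 0"
proof -
  have "(vartheta (0 + l) \<tau> = 0) = (vartheta 0 \<tau> = 0)"
    by (rule doubly_periodic_lattice[of "\<lambda>u. vartheta u \<tau> = 0" \<tau> l 0])
       (use assms in \<open>simp_all add: vartheta_shift_one vartheta_shift_tau\<close>)
  moreover have "vartheta 0 \<tau> = 0" using vartheta_uminus[of 0 \<tau>] by simp
  ultimately show ?thesis by simp
qed

lemma theta_term_half:
  "theta_term 0 (1/2) n u \<tau> = exp (pi * \<i> * \<tau> / 4 + pi * \<i> * u) *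
     exp (2 * pi * \<i> * \<tau> * (of_int n * (of_int n + 1) / 2) + of_int n * (2 * pi * \<i> * u))"
  unfolding theta_term_def mult_exp_exp power_0 mult_1
  by (intro arg_cong[of _ _ exp]) (simp add: field_simps power2_eq_square)

lemma theta_half_product:
  fixes \<tau> u
  assumes \<tau>: "Im \<tau> > 0"
  defines "t \<equiv> 2 * pi * \<i> * \<tau>"
  shows "(\<lambda>N. \<Prod>i<N. (1 + exp (t * of_nat (Suc i) + 2 * pi * \<i> * u)) * (1 + exp (t * of_nat i - 2 * pi * \<i> * u)))
     \<longlonglongrightarrow> exp (- (pi * \<i> * \<tau> / 4 + pi * \<i> * u)) * theta 0 (1/2) u \<tau> / (\<Prod>i. 1 - exp t ^ Suc i)"
proof -
  have t: "Re t < 0" using \<tau> by (simp add: t_def)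
  let ?a = "\<lambda>n::int. exp (t * (of_int n * (of_int n + 1) / 2) + of_int n * (2 * pi * \<i> * u))"
  have "((\<lambda>n. exp (- (pi * \<i> * \<tau> / 4 + pi * \<i> * u)) * theta_term 0 (1/2) n u \<tau>) has_sum
      exp (- (pi * \<i> * \<tau> / 4 + pi * \<i> * u)) * theta 0 (1/2) u \<tau>) UNIV"
    by (intro has_sum_cmult_right theta_term_has_sum \<tau>)
  also have "(\<lambda>n. exp (- (pi * \<i> * \<tau> / 4 + pi * \<i> * u)) * theta_term 0 (1/2) n u \<tau>) = ?a"
    unfolding theta_term_half t_def exp_minus
    by (simp only: mult.assoc[symmetric] left_inverse[OF exp_not_eq_zero] mult_1)
  finally have "?a summable_on UNIV" "infsum ?a UNIV = exp (- (pi * \<i> * \<tau> / 4 + pi * \<i> * u)) * theta 0 (1/2) u \<tau>"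
    by (simp_all only: has_sum_iff)
  then show ?thesis
    using q_binomial_sum_tendsto[OF t, of ?a] by (simp only: finite_triple_product[OF t])
qed

lemma exp_2pi_eq_1_imp_int:
  assumes "exp (2 * pi * \<i> * x) = 1"
  obtains n :: int where "x = of_int n"
proof -
  have "Re (2 * pi * \<i> * x) = 0" "\<exists>n::int. Im (2 * pi * \<i> * x) = of_int (2 * n) * pi"
    using assms unfolding exp_eq_1 by blast+
  then obtain n :: int where "Im x = 0" "Re x = of_int n"
    by auto
  then have "x = of_int n" by (auto simp: complex_eq_iff)
  then show ?thesis ..
qed

text \<open>A convergent infinite product vanishes only if a factor does. The half period in
  \<open>vartheta\<close> turns the factors \<open>1 + ...\<close> into \<open>1 - ...\<close>, and
  a vanishing one places \<open>u\<close> at \<open>- (i + 1) * \<tau> + n\<close> or at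
  \<open>i * \<tau> - n\<close>.\<close>

lemma vartheta_nonzero:
  assumes \<tau>: "Im \<tau> > 0" and u: "u \<notin> period_lattice \<tau>"
  shows "vartheta u \<tau> \<noteq> 0"
proof
  assume 0: "vartheta u \<tau> = 0"
  define t where "t = 2 * pi * \<i> * \<tau>"
  have t: "Re t < 0" using \<tau> by (simp add: t_def)
  define w where "w = 2 * pi * \<i> * (u + 1/2)"
  define f where "f i = 1 + exp (t + w) * exp (t * of_nat i)" for i :: nat
  define g where "g i = 1 + exp (- w) * exp (t * of_nat i)" for i :: nat
  have fg: "convergent_prod f" "convergent_prod g"
    unfolding f_def g_def by (intro convergent_prod_one_plus_exp t)+
  have "(\<lambda>N. \<Prod>i<N. f i * g i) \<longlonglongrightarrow> 0"
    using theta_half_product[OF \<tau>, of "u + 1/2"] 0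
    by (simp add: f_def g_def t_def w_def vartheta_eq_theta mult_exp_exp algebra_simps)
  moreover have "(\<lambda>N. \<Prod>i<N. f i * g i) \<longlonglongrightarrow> prodinf f * prodinf g"
    using tendsto_mult[OF convergent_prod_LIMSEQ[OF fg(1)] convergent_prod_LIMSEQ[OF fg(2)]]
    unfolding prod.distrib[symmetric] LIMSEQ_lessThan_iff_atMost .
  ultimately have "prodinf f * prodinf g = 0" using LIMSEQ_unique by blast
  then obtain i where "f i = 0 \<or> g i = 0"
    using prodinf_nonzero[OF fg(1)] prodinf_nonzero[OF fg(2)] by auto
  then have "exp (2 * pi * \<i> * (of_nat (Suc i) * \<tau> + u)) = 1 \<or> exp (2 * pi * \<i> * (of_nat i * \<tau> - u)) = 1"
  proof (elim disjE)
    assume "f i = 0"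
    moreover have "exp (t + w) * exp (t * of_nat i) = - exp (2 * pi * \<i> * (of_nat (Suc i) * \<tau> + u))"
      by (simp add: t_def w_def algebra_simps exp_add)
    ultimately show ?thesis by (simp add: f_def)
  next
    assume "g i = 0"
    moreover have "exp (- w) * exp (t * of_nat i) = - exp (2 * pi * \<i> * (of_nat i * \<tau> - u))"
      by (simp add: t_def w_def algebra_simps exp_add exp_diff exp_minus)
    ultimately show ?thesis by (simp add: g_def)
  qed
  then obtain n :: int where "of_nat (Suc i) * \<tau> + u = of_int n \<or> of_nat i * \<tau> - u = of_int n"
    by (elim disjE exp_2pi_eq_1_imp_int) blast+
  then have "u = of_int (- int (Suc i)) * \<tau> + of_int n \<or> u = of_int (int i) * \<tau> + of_int (- n)"
    by (auto simp: algebra_simps)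
  then show False using u unfolding period_lattice_def by blast
qed

text \<open>The left-hand side is the derivative of \<open>vartheta\<close> at 0 divided by 2 pi i.
  The finite triple product is differentiated at its zero \<open>w = pi * \<i>\<close>, where
  \<open>1 + exp (- w)\<close> is the vanishing factor and the remaining ones form
  \<open>q_poch t N * q_poch t M\<close>; only then is the limit taken, so that no infinite product
  has to be differentiated.\<close>

lemma dedekind_eta_cube:
  assumes \<tau>: "Im \<tau> > 0"
  shows "theta 1 (1/2) (1/2) \<tau> = \<i> * dedekind_eta \<tau> ^ 3"
proof -
  define t where "t = 2 * pi * \<i> * \<tau>"
  have t: "Re t < 0" using \<tau> by (simp add: t_def)
  define L where "L = (\<Prod>i. 1 - exp t ^ Suc i)"
  have L: "q_poch t \<longlonglongrightarrow> L" "L \<noteq> 0" using q_poch_tendsto[OF t] by (simp_all add: L_def)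
  define a where "a n w = exp (t * (of_int n * (of_int n + 1) / 2) + of_int n * w)" for n :: int and w
  define C where "C = exp (pi * \<i> * \<tau> / 4 + pi * \<i> / 2)"
  have "vartheta 0 \<tau> = 0" using vartheta_uminus[of 0 \<tau>] by simp
  then have "theta 0 (1/2) (1/2) \<tau> = 0" by (simp add: vartheta_eq_theta)
  \<comment> \<open>The weight in \<open>theta 1\<close> is \<open>n + 1/2\<close>. Subtracting half
    of the vanishing sum of weight 0 leaves the weight \<open>n\<close> that differentiation in
    \<open>w\<close> produces.\<close>
  then have "((\<lambda>n. inverse C * (theta_term 1 (1/2) n (1/2) \<tau> - theta_term 0 (1/2) n (1/2) \<tau> / 2))
      has_sum inverse C * (theta 1 (1/2) (1/2) \<tau> - 0 / 2)) UNIV"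
    using theta_term_has_sum[OF \<tau>, of 0 "1/2" "1/2"] theta_term_has_sum[OF \<tau>, of 1 "1/2" "1/2"]
    by (intro has_sum_cmult_right has_sum_diff has_sum_divide_const) auto
  moreover have "inverse C * (theta_term 1 (1/2) n (1/2) \<tau> - theta_term 0 (1/2) n (1/2) \<tau> / 2) = of_int n * a n (pi * \<i>)" for n
  proof -
    have "theta_term 1 (1/2) n (1/2) \<tau> = (of_int n + 1/2) * theta_term 0 (1/2) n (1/2) \<tau>"
      by (simp add: theta_term_def)
    moreover have "theta_term 0 (1/2) n (1/2) \<tau> = C * a n (pi * \<i>)"
      unfolding theta_term_half by (simp add: C_def a_def t_def)
    moreover have "C \<noteq> 0" by (simp add: C_def)
    ultimately show ?thesis by (simp add: field_simps)
  qed
  ultimately have S: "((\<lambda>n. of_int n * a n (pi * \<i>)) has_sum inverse C * theta 1 (1/2) (1/2) \<tau>) UNIV"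
    by simp
  have fin: "(\<Sum>n\<in>{- int N..int N}. q_binomial t (2 * N) (nat (int N + n)) * (of_int n * a n (pi * \<i>))) =
      q_poch t N * q_poch t M" if N: "N = Suc M" for N M
  proof -
    define R where "R w = (\<Prod>i<N. 1 + exp (t * of_nat (Suc i) + w)) * (\<Prod>i<M. 1 + exp (t * of_nat (Suc i) - w))" for w
    have "R holomorphic_on UNIV" unfolding R_def by (intro holomorphic_intros)
    then obtain R' where R': "(R has_field_derivative R') (at (pi * \<i>))"
      by (meson UNIV_I field_differentiable_def holomorphic_on_imp_differentiable_at open_UNIV)
    have e: "exp (x + pi * \<i>) = - exp x" "exp (x - pi * \<i>) = - exp x" for x
      by (simp_all add: exp_add exp_diff)
    have Rpi: "R (pi * \<i>) = q_poch t N * q_poch t M"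
      unfolding R_def e q_poch_def by simp
    have "(\<Prod>i<N. (1 + exp (t * of_nat (Suc i) + w)) * (1 + exp (t * of_nat i - w))) = (1 + exp (- w)) * R w" for w
      unfolding prod.distrib R_def N prod.lessThan_Suc_shift[of "\<lambda>i. 1 + exp (t * of_nat i - w)"] by simp
    then have eq: "(\<lambda>w. \<Sum>n\<in>{- int N..int N}. q_binomial t (2 * N) (nat (int N + n)) * a n w) = (\<lambda>w. (1 + exp (- w)) * R w)"
      unfolding a_def using finite_triple_product[OF t, of _ N] by presburger
    \<comment> \<open>At \<open>w = pi * \<i>\<close> the first factor is 0 and its derivative
      \<open>- exp (- w)\<close> is 1, so the derivative of \<open>R\<close> drops out.\<close>
    have "((\<lambda>w. (1 + exp (- w)) * R w) has_field_derivative R (pi * \<i>)) (at (pi * \<i>))"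
      by (rule derivative_eq_intros R' refl)+ (simp add: exp_minus)
    moreover have "((\<lambda>w. \<Sum>n\<in>{- int N..int N}. q_binomial t (2 * N) (nat (int N + n)) * a n w) has_field_derivative
        (\<Sum>n\<in>{- int N..int N}. q_binomial t (2 * N) (nat (int N + n)) * (of_int n * a n (pi * \<i>)))) (at (pi * \<i>))"
      unfolding a_def by (rule derivative_eq_intros refl)+ (simp add: mult_ac)
    ultimately show ?thesis unfolding eq Rpi by (rule DERIV_unique[symmetric])
  qed
  have "(\<lambda>N. \<Sum>n\<in>{- int N..int N}. q_binomial t (2 * N) (nat (int N + n)) * (of_int n * a n (pi * \<i>)))
      \<longlonglongrightarrow> inverse C * theta 1 (1/2) (1/2) \<tau> / L"
    using q_binomial_sum_tendsto[OF t, of "\<lambda>n. of_int n * a n (pi * \<i>)"] S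
    unfolding L_def has_sum_iff by simp
  \<comment> \<open>The factorisation \<open>fin\<close> requires \<open>N = Suc M\<close>, hence
    the shifted sequence.\<close>
  from LIMSEQ_Suc[OF this] have "(\<lambda>M. q_poch t (Suc M) * q_poch t M) \<longlonglongrightarrow> inverse C * theta 1 (1/2) (1/2) \<tau> / L"
    unfolding fin[OF refl] .
  moreover have "(\<lambda>M. q_poch t (Suc M) * q_poch t M) \<longlonglongrightarrow> L * L"
    by (intro tendsto_mult L LIMSEQ_Suc)
  ultimately have "inverse C * theta 1 (1/2) (1/2) \<tau> / L = L * L" by (rule LIMSEQ_unique)
  then have "theta 1 (1/2) (1/2) \<tau> = C * L ^ 3"
    using L(2) by (simp add: C_def field_simps power3_eq_cube)
  moreover have "C = \<i> * exp (pi * \<i> * \<tau> / 4)" by (simp add: C_def exp_add exp_half_pi)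
  moreover have "dedekind_eta \<tau> ^ 3 = exp (pi * \<i> * \<tau> / 4) * L ^ 3"
  proof -
    have "exp (2 * pi * \<i> * \<tau> / 24) ^ 3 = exp (pi * \<i> * \<tau> / 4)"
      unfolding exp_of_nat_mult[symmetric] by (intro arg_cong[of _ _ exp]) simp
    then show ?thesis unfolding dedekind_eta_def L_def t_def power_mult_distrib by simp
  qed
  ultimately show ?thesis by simp
qed

section \<open>The Wronskian of the index-one theta functions\<close>

lemma has_sum_Times_mult:
  fixes f :: "'a \<Rightarrow> complex" and g :: "'b \<Rightarrow> complex"
  assumes f: "(f has_sum a) A" and g: "(g has_sum b) B"
  shows "((\<lambda>(x, y). f x * g y) has_sum a * b) (A \<times> B)"
proof (rule has_sum_SigmaI[where g = "\<lambda>x. f x * b"])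
  show "((\<lambda>x. f x * b) has_sum a * b) A" by (rule has_sum_cmult_left[OF f])
  show "((\<lambda>y. case (x, y) of (x, y) \<Rightarrow> f x * g y) has_sum f x * b) B" for x
    using has_sum_cmult_right[OF g] by simp
  have "(\<lambda>x. norm (f x)) summable_on A" "(\<lambda>x. norm (g x)) summable_on B"
    using f g has_sum_imp_summable summable_on_iff_abs_summable_on_complex by blast+
  then have "(\<lambda>p. norm ((\<lambda>(x, y). f x * g y) p)) summable_on A \<times> B"
    unfolding Infinite_Sum.abs_summable_on_Sigma_iff
    by (auto simp: norm_mult infsum_cmult_right' infsum_nonneg abs_mult intro!: summable_on_cmult_right summable_on_cmult_left)
  then show "(\<lambda>(x, y). f x * g y) summable_on A \<times> B" by (rule abs_summable_summable)
qed

text \<open>With \<open>s = m + n\<close> and \<open>x = s + 1/2\<close>, the identity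
  \<open>2((x - n)\<^sup>2 + n\<^sup>2) = x\<^sup>2 + (x - 2n)\<^sup>2\<close> separates the double series.\<close>

lemma theta_wronskian:
  assumes \<tau>: "Im \<tau> > 0"
  shows "theta 1 (1/2) v (2 * \<tau>) * theta 0 0 v (2 * \<tau>) - theta 1 0 v (2 * \<tau>) * theta 0 (1/2) v (2 * \<tau>)
       = - (1/2) * theta 1 (1/2) (1/2) \<tau> * vartheta v \<tau>"
    (is "?W = _")
proof -
  define h where "h x = x * exp (pi * \<i> * \<tau> * x\<^sup>2)" for x :: complex
  have h: "h (- x) = - h x" for x by (simp add: h_def)
  define e where "e s = exp (pi * \<i> * (of_int s + 1/2)\<^sup>2 * \<tau> + 2 * pi * \<i> * (of_int s + 1/2) * v)" for s :: int
  have \<tau>2: "Im (2 * \<tau>) > 0" using \<tau> by simp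
  have th: "((\<lambda>n. theta_term k a n v (2 * \<tau>)) has_sum theta k a v (2 * \<tau>)) UNIV" for k a
    by (rule theta_term_has_sum[OF \<tau>2])
  have "((\<lambda>p. (case p of (m, n) \<Rightarrow> theta_term 1 (1/2) m v (2 * \<tau>) * theta_term 0 0 n v (2 * \<tau>)) -
            (case p of (m, n) \<Rightarrow> theta_term 0 (1/2) m v (2 * \<tau>) * theta_term 1 0 n v (2 * \<tau>)))
      has_sum theta 1 (1/2) v (2 * \<tau>) * theta 0 0 v (2 * \<tau>) - theta 0 (1/2) v (2 * \<tau>) * theta 1 0 v (2 * \<tau>)) (UNIV \<times> UNIV)"
    by (intro has_sum_diff has_sum_Times_mult th)
  also have "?this \<longleftrightarrow> ((\<lambda>(s, n). e s * h (of_int s + 1/2 - 2 * of_int n)) has_sum ?W) (UNIV \<times> UNIV)"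
  proof (rule has_sum_reindex_bij_witness[of _ "\<lambda>(s, n). (s - n, n)" "\<lambda>(m, n). (m + n, n)"])
    fix p :: "int \<times> int"
    obtain m n where p: "p = (m, n)" by (cases p)
    let ?E = "exp (pi * \<i> * (of_int m + 1/2)\<^sup>2 * (2 * \<tau>) + 2 * pi * \<i> * (of_int m + 1/2) * v) *
              exp (pi * \<i> * (of_int n)\<^sup>2 * (2 * \<tau>) + 2 * pi * \<i> * of_int n * v)"
    have "e (m + n) * h (of_int (m + n) + 1/2 - 2 * of_int n) = (of_int m + 1/2 - of_int n) * ?E"
    proof -
      have "e (m + n) * exp (pi * \<i> * \<tau> * (of_int (m + n) + 1/2 - 2 * of_int n)\<^sup>2) = ?E"
        unfolding e_def mult_exp_exp
        by (intro arg_cong[of _ _ exp]) (simp add: field_simps power2_eq_square)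
      then show ?thesis by (simp add: h_def algebra_simps)
    qed
    then show "(case case p of (m, n) \<Rightarrow> (m + n, n) of (s, n) \<Rightarrow> e s * h (of_int s + 1/2 - 2 * of_int n)) =
        (case p of (m, n) \<Rightarrow> theta_term 1 (1/2) m v (2 * \<tau>) * theta_term 0 0 n v (2 * \<tau>)) -
            (case p of (m, n) \<Rightarrow> theta_term 0 (1/2) m v (2 * \<tau>) * theta_term 1 0 n v (2 * \<tau>))"
      unfolding p by (simp add: theta_term_def algebra_simps)
  qed (auto simp: algebra_simps)
  finally have W: "((\<lambda>(s, n). e s * h (of_int s + 1/2 - 2 * of_int n)) has_sum ?W) (UNIV \<times> UNIV)" .

  define a where "a n = theta_term 1 (1/2) n (1/2) \<tau>" for n
  \<comment> \<open>The double series is now summed over \<open>n\<close> for fixed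
    \<open>s\<close>. Its arguments run through 1/2 + 2Z or -1/2 + 2Z according to the parity of
    \<open>s\<close>, and \<open>h\<close> is odd, so up to sign the single constant
    \<open>\<kappa>\<close> occurs.\<close>
  define \<kappa> where "\<kappa> = (\<Sum>\<^sub>\<infinity>n. h (1/2 - 2 * of_int n))"
  have a: "(a has_sum theta 1 (1/2) (1/2) \<tau>) UNIV"
    unfolding a_def by (rule theta_term_has_sum[OF \<tau>])
  have half: "exp (pi * \<i> * (of_int s + 1/2)) = \<i> * (-1) powi s" for s
  proof -
    have "exp (pi * \<i> * (of_int s + 1/2)) = exp (pi * \<i> / 2) * exp (of_int s * (pi * \<i>))"
      by (simp add: mult_exp_exp algebra_simps)
    also have "\<dots> = \<i> * exp (pi * \<i>) powi s"
      unfolding exp_half_pi exp_power_int by (simp add: mult.commute)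
    finally show ?thesis by simp
  qed
  have a_eq: "a n = \<i> * (-1) powi n * h (of_int n + 1/2)" for n
  proof -
    have "a n = (of_int n + 1/2) * exp (pi * \<i> * \<tau> * (of_int n + 1/2)\<^sup>2) * exp (pi * \<i> * (of_int n + 1/2))"
      unfolding a_def theta_term_def mult.assoc mult_exp_exp by (simp add: algebra_simps)
    then show ?thesis unfolding half h_def by (simp add: mult_ac)
  qed
  \<comment> \<open>The series for \<open>theta 1 (1/2) (1/2) \<tau>\<close> is split by the parity
    of its index. Its alternating sign compensates the sign change of \<open>h\<close> between the
    two classes, so each half contributes \<open>\<i> * \<kappa>\<close>.\<close>
  have inj: "inj (\<lambda>k::int. - 2 * k)" "inj (\<lambda>k::int. 2 * k - 1)" by (auto simp: inj_on_def)
  have even: "a (- 2 * k) = \<i> * h (1/2 - 2 * of_int k)" for k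
    unfolding a_eq by (simp add: power_int_minus_left algebra_simps)
  have odd: "a (2 * k - 1) = \<i> * h (1/2 - 2 * of_int k)" for k
  proof -
    have "h (of_int (2 * k - 1) + 1/2) = - h (1/2 - 2 * of_int k)"
      unfolding h[symmetric] by (rule arg_cong[of _ _ h]) (simp add: algebra_simps)
    then show ?thesis unfolding a_eq by (simp add: power_int_minus_left)
  qed
  have "(a \<circ> (\<lambda>k. - 2 * k)) summable_on UNIV"
    using summable_on_subset[OF has_sum_imp_summable[OF a], of "range (\<lambda>k. - 2 * k)"] summable_on_reindex[OF inj(1)] by blast
  then have "(\<lambda>k. \<i> * h (1/2 - 2 * of_int k)) summable_on UNIV" unfolding o_def even .
  then have \<kappa>: "((\<lambda>k. h (1/2 - 2 * of_int k)) has_sum \<kappa>) UNIV"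
    unfolding \<kappa>_def by (subst (asm) summable_on_cmult_right') auto
  have "(a has_sum \<i> * \<kappa> + \<i> * \<kappa>) (range (\<lambda>k. - 2 * k) \<union> range (\<lambda>k. 2 * k - 1))"
  proof (rule has_sum_Un_disjoint)
    show "(a has_sum \<i> * \<kappa>) (range (\<lambda>k. - 2 * k))"
      unfolding has_sum_reindex[OF inj(1)] o_def even by (rule has_sum_cmult_right[OF \<kappa>])
    show "(a has_sum \<i> * \<kappa>) (range (\<lambda>k. 2 * k - 1))"
      unfolding has_sum_reindex[OF inj(2)] o_def odd by (rule has_sum_cmult_right[OF \<kappa>])
    show "range (\<lambda>k::int. - 2 * k) \<inter> range (\<lambda>k. 2 * k - 1) = {}" by auto presburger
  qed
  also have "range (\<lambda>k::int. - 2 * k) \<union> range (\<lambda>k. 2 * k - 1) = UNIV"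
  proof (rule UNIV_eq_I[symmetric])
    fix n :: int
    show "n \<in> range (\<lambda>k::int. - 2 * k) \<union> range (\<lambda>k. 2 * k - 1)"
    proof (cases "even n")
      case True
      then have "n = - 2 * (- (n div 2))" by simp
      then show ?thesis by blast
    next
      case False
      then have "n = 2 * ((n + 1) div 2) - 1" by presburger
      then show ?thesis by blast
    qed
  qed
  finally have \<kappa>_eq: "theta 1 (1/2) (1/2) \<tau> = 2 * \<i> * \<kappa>"
    using has_sum_unique[OF a] by fastforce

  have inner: "((\<lambda>n. h (of_int s + 1/2 - 2 * of_int n)) has_sum (-1) powi s * \<kappa>) UNIV" for s
  proof (cases "even s")
    case True
    then obtain j where s: "s = 2 * j" by auto
    have "((\<lambda>n. h (of_int s + 1/2 - 2 * of_int n)) has_sum \<kappa>) UNIV \<longleftrightarrow> ((\<lambda>k. h (1/2 - 2 * of_int k)) has_sum \<kappa>) UNIV"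
      by (rule has_sum_reindex_bij_witness[of _ "\<lambda>k. k + j" "\<lambda>k. k - j"])
         (auto simp: s algebra_simps)
    with \<kappa> True show ?thesis by (simp add: power_int_minus_left)
  next
    case False
    then have "s = 2 * ((s + 1) div 2) - 1" by presburger
    then obtain j where s: "s = 2 * j - 1" by blast
    have "((\<lambda>n. h (of_int s + 1/2 - 2 * of_int n)) has_sum - \<kappa>) UNIV \<longleftrightarrow> ((\<lambda>k. - h (1/2 - 2 * of_int k)) has_sum - \<kappa>) UNIV"
      by (rule has_sum_reindex_bij_witness[of _ "\<lambda>k. j - k" "\<lambda>k. j - k"])
         (auto simp: s algebra_simps simp flip: h)
    with \<kappa> False show ?thesis by (simp add: power_int_minus_left has_sum_uminus)
  qed
  have W': "((\<lambda>s. e s * ((-1) powi s * \<kappa>)) has_sum ?W) UNIV"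
    using has_sum_SigmaD[OF W, of "\<lambda>s. e s * ((-1) powi s * \<kappa>)"] has_sum_cmult_right[OF inner] by simp
  \<comment> \<open>The sign \<open>(-1) powi s\<close> left by the inner sum is what the half
    period in \<open>vartheta v \<tau>\<close> puts into its series, up to the factor
    \<open>\<i>\<close>.\<close>
  have "((\<lambda>s. - \<i> * \<kappa> * theta_term 0 (1/2) s (v + 1/2) \<tau>) has_sum - \<i> * \<kappa> * vartheta v \<tau>) UNIV"
    unfolding vartheta_eq_theta by (intro has_sum_cmult_right theta_term_has_sum \<tau>)
  moreover have "- \<i> * \<kappa> * theta_term 0 (1/2) s (v + 1/2) \<tau> = e s * ((-1) powi s * \<kappa>)" for s
  proof -
    have "theta_term 0 (1/2) s (v + 1/2) \<tau> = e s * exp (pi * \<i> * (of_int s + 1/2))"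
      unfolding theta_term_def e_def mult_exp_exp by (simp add: algebra_simps)
    then show ?thesis unfolding half by (simp add: algebra_simps)
  qed
  ultimately have "((\<lambda>s. e s * ((-1) powi s * \<kappa>)) has_sum - \<i> * \<kappa> * vartheta v \<tau>) UNIV"
    by (simp only:)
  with W' have "?W = - \<i> * \<kappa> * vartheta v \<tau>" by (rule has_sum_unique)
  then show ?thesis unfolding \<kappa>_eq by simp
qed

lemma exp_2pi_neq_1:
  assumes "u \<notin> period_lattice \<tau>"
  shows "exp (2 * pi * \<i> * (u + of_int n * \<tau>)) \<noteq> 1"
proof
  assume "exp (2 * pi * \<i> * (u + of_int n * \<tau>)) = 1"
  then obtain k :: int where "u + of_int n * \<tau> = of_int k" by (rule exp_2pi_eq_1_imp_int)
  then have "u = of_int (- n) * \<tau> + of_int k" by (simp add: algebra_simps)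
  with assms show False unfolding period_lattice_def by blast
qed

section \<open>The Lerch sum\<close>

text \<open>With \<open>P = 1 / (1 - exp (2\<pi>iw))\<close> one has \<open>P' = 2\<pi>i (P\<^sup>2 - P)\<close>, so the derivatives of
  \<open>exp (2\<pi>iaw) P\<close> are polynomials in \<open>P\<close> times \<open>exp (2\<pi>iaw)\<close>.\<close>

definition lerch_pole :: "complex \<Rightarrow> complex" where
  "lerch_pole w = 1 / (1 - exp (2 * pi * \<i> * w))"

definition lerch_kernel :: "complex \<Rightarrow> complex \<Rightarrow> complex" where
  "lerch_kernel a w = exp (2 * pi * \<i> * a * w) * lerch_pole w"

definition lerch_kernel' :: "complex \<Rightarrow> complex \<Rightarrow> complex" where
  "lerch_kernel' a w = 2 * pi * \<i> * exp (2 * pi * \<i> * a * w) *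
     (a * lerch_pole w + (lerch_pole w ^ 2 - lerch_pole w))"

definition lerch_kernel'' :: "complex \<Rightarrow> complex \<Rightarrow> complex" where
  "lerch_kernel'' a w = (2 * pi * \<i>) ^ 2 * exp (2 * pi * \<i> * a * w) *
     (a ^ 2 * lerch_pole w + 2 * a * (lerch_pole w ^ 2 - lerch_pole w)
      + (2 * lerch_pole w - 1) * (lerch_pole w ^ 2 - lerch_pole w))"

lemma lerch_pole_DERIV:
  assumes "exp (2 * pi * \<i> * w) \<noteq> 1"
  shows "(lerch_pole has_field_derivative 2 * pi * \<i> * (lerch_pole w ^ 2 - lerch_pole w)) (at w)"
proof -
  have alg: "k * x / (1 - x)\<^sup>2 = k * ((1 / (1 - x))\<^sup>2 - 1 / (1 - x))" if "x \<noteq> 1" for k x :: complex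
    using that by (simp add: divide_simps power2_eq_square)
  have "(lerch_pole has_field_derivative 2 * pi * \<i> * exp (2 * pi * \<i> * w) / (1 - exp (2 * pi * \<i> * w))\<^sup>2) (at w)"
    unfolding lerch_pole_def
    by (rule derivative_eq_intros refl)+ (use assms in \<open>auto simp: power2_eq_square\<close>)
  then show ?thesis
    using alg[OF assms, of "2 * pi * \<i>"] by (simp only: lerch_pole_def)
qed

lemma lerch_kernel_DERIV:
  assumes "exp (2 * pi * \<i> * w) \<noteq> 1"
  shows "(lerch_kernel a has_field_derivative lerch_kernel' a w) (at w)"
    and "(lerch_kernel' a has_field_derivative lerch_kernel'' a w) (at w)"
proof -
  note [derivative_intros] = lerch_pole_DERIV[OF assms]
  show "(lerch_kernel a has_field_derivative lerch_kernel' a w) (at w)"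
    unfolding lerch_kernel_def lerch_kernel'_def
    by (rule derivative_eq_intros refl)+ (simp add: algebra_simps)
  show "(lerch_kernel' a has_field_derivative lerch_kernel'' a w) (at w)"
    unfolding lerch_kernel'_def lerch_kernel''_def
    by (rule derivative_eq_intros refl)+ (simp add: algebra_simps power2_eq_square)
qed

lemma lerch_pole_shift_one: "lerch_pole (w + 1) = lerch_pole w"
  by (simp add: lerch_pole_def distrib_left exp_add)

lemma lerch_kernel_shift_one:
  "lerch_kernel a (w + 1) = exp (2 * pi * \<i> * a) * lerch_kernel a w"
  "lerch_kernel' a (w + 1) = exp (2 * pi * \<i> * a) * lerch_kernel' a w"
  "lerch_kernel'' a (w + 1) = exp (2 * pi * \<i> * a) * lerch_kernel'' a w"
  by (simp_all add: lerch_kernel_def lerch_kernel'_def lerch_kernel''_def lerch_pole_shift_one distrib_left exp_add)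

text \<open>In the exponential prefactor times the \<open>n\<close>-th Lerch summand, all dependence
  on \<open>u\<close> can be collected in \<open>lerch_kernel (\<alpha> + 1/2)\<close> at
  \<open>u + n * \<tau>\<close>; this is the remaining factor.\<close>

definition lerch_coeff :: "real \<Rightarrow> real \<Rightarrow> int \<Rightarrow> complex \<Rightarrow> complex" where
  "lerch_coeff \<alpha> \<beta> n \<tau> = exp (pi * \<i> * of_int n * (1 + 2 * of_real \<beta>) + pi * \<i> * (of_int n ^ 2 - of_real \<alpha> ^ 2) * \<tau>)"

text \<open>The powers of \<open>n\<close> appear on differentiating in \<tau>: 1 comes from the
  inner argument \<open>u + n * \<tau>\<close>, 2 from \<open>lerch_coeff\<close>.\<close>

definition lerch_term :: "real \<Rightarrow> real \<Rightarrow> nat \<Rightarrow> int \<Rightarrow> complex \<Rightarrow> complex \<Rightarrow> complex" where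
  "lerch_term \<alpha> \<beta> j n u \<tau> = of_int n ^ j * lerch_coeff \<alpha> \<beta> n \<tau> * lerch_kernel (of_real \<alpha> + 1/2) (u + of_int n * \<tau>)"

text \<open>The index set is a parameter so that the summand \<open>n = 0\<close>, the one singular
  at \<open>u = 0\<close>, can be split off.\<close>

definition lerch_sum :: "real \<Rightarrow> real \<Rightarrow> nat \<Rightarrow> int set \<Rightarrow> complex \<Rightarrow> complex \<Rightarrow> complex" where
  "lerch_sum \<alpha> \<beta> j I u \<tau> = (\<Sum>\<^sub>\<infinity>n\<in>I. lerch_term \<alpha> \<beta> j n u \<tau>)"

lemma norm_lerch_term:
  "norm (lerch_term \<alpha> \<beta> j n u \<tau>) = norm (exp (2 * pi * \<i> * (of_real \<alpha> + 1/2) * u - pi * \<i> * of_real \<alpha> ^ 2 * \<tau>)) *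
     norm (theta_term j 0 n ((of_real \<alpha> + 1/2) * \<tau>) \<tau>) * norm (lerch_pole (u + of_int n * \<tau>))"
proof -
  have "norm (exp (pi * \<i> * of_int n * (1 + 2 * of_real \<beta>))) = 1"
    by (simp add: mult_ac)
  moreover have "lerch_term \<alpha> \<beta> j n u \<tau> = exp (pi * \<i> * of_int n * (1 + 2 * of_real \<beta>)) *
      (exp (2 * pi * \<i> * (of_real \<alpha> + 1/2) * u - pi * \<i> * of_real \<alpha> ^ 2 * \<tau>) *
       theta_term j 0 n ((of_real \<alpha> + 1/2) * \<tau>) \<tau> * lerch_pole (u + of_int n * \<tau>))"
  proof -
    have "lerch_coeff \<alpha> \<beta> n \<tau> * exp (2 * pi * \<i> * (of_real \<alpha> + 1/2) * (u + of_int n * \<tau>)) =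
      exp (pi * \<i> * of_int n * (1 + 2 * of_real \<beta>)) * (exp (2 * pi * \<i> * (of_real \<alpha> + 1/2) * u - pi * \<i> * of_real \<alpha> ^ 2 * \<tau>) *
       exp (pi * \<i> * of_int n ^ 2 * \<tau> + 2 * pi * \<i> * of_int n * ((of_real \<alpha> + 1/2) * \<tau>)))"
      unfolding lerch_coeff_def mult_exp_exp
      by (intro arg_cong[of _ _ exp]) (simp add: algebra_simps)
    then show ?thesis by (simp add: lerch_term_def lerch_kernel_def theta_term_def mult_ac)
  qed
  ultimately show ?thesis by (simp add: norm_mult)
qed

lemma norm_lerch_pole_le:
  assumes "\<bar>Im w\<bar> \<ge> 1"
  shows "norm (lerch_pole w) \<le> 2"
proof -
  have e: "exp (2 * pi) \<ge> 2" using exp_ge_add_one_self[of "2 * pi"] pi_ge_two by linarith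
  have n: "norm (exp (2 * pi * \<i> * w)) = exp (- 2 * pi * Im w)" by simp
  have "norm (1 - exp (2 * pi * \<i> * w)) \<ge> 1/2"
  proof (cases "Im w \<ge> 1")
    case True
    then have "exp (- 2 * pi * Im w) \<le> exp (- (2 * pi))" by simp
    also have "\<dots> \<le> 1/2" using e by (simp add: exp_minus field_simps)
    finally show ?thesis using n norm_triangle_ineq2[of 1 "exp (2 * pi * \<i> * w)"] by (simp add: norm_minus_commute)
  next
    case False
    then have "2 * pi * 1 \<le> 2 * pi * (- Im w)" using assms by (intro mult_left_mono) auto
    then have "exp (2 * pi) \<le> exp (- 2 * pi * Im w)" by simp
    then have "exp (- 2 * pi * Im w) \<ge> 2" using e by linarith
    then show ?thesis using n norm_triangle_ineq2[of "exp (2 * pi * \<i> * w)" 1] by (simp add: norm_minus_commute)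
  qed
  then have "1 / norm (1 - exp (2 * pi * \<i> * w)) \<le> 1 / (1/2)" by (intro divide_left_mono) auto
  then show ?thesis by (simp add: lerch_pole_def norm_divide)
qed

lemma continuous_on_cball_bound:
  fixes f :: "complex \<Rightarrow> complex"
  assumes "continuous_on (cball z r) f"
  shows "\<exists>K. \<forall>w\<in>cball z r. norm (f w) \<le> K"
proof -
  have "bounded (f ` cball z r)"
    by (intro compact_imp_bounded compact_continuous_image assms compact_cball)
  then show ?thesis by (auto simp: bounded_iff)
qed

text \<open>By \<open>norm_lerch_term\<close> a summand is a theta term times a pole factor. For
  large \<open>\<bar>n\<bar>\<close> the imaginary part of \<open>U w + n * T w\<close> is at least
  1 in modulus on the whole ball, which bounds the pole factor by 2; the finitely many other factors
  are bounded by compactness.\<close>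

lemma normally_summable_lerch_term:
  assumes S: "open S" and U: "U holomorphic_on S" and T: "T holomorphic_on S"
    and pos: "\<And>z. z \<in> S \<Longrightarrow> Im (T z) > 0"
    and ne: "\<And>z n. z \<in> S \<Longrightarrow> n \<in> I \<Longrightarrow> exp (2 * pi * \<i> * (U z + of_int n * T z)) \<noteq> 1"
  shows "normally_summable_on (\<lambda>n z. lerch_term \<alpha> \<beta> j n (U z) (T z)) I S"
  unfolding normally_summable_on_def
proof
  fix z assume z: "z \<in> S"
  have "normally_summable_on (\<lambda>n z. theta_term j 0 n ((of_real \<alpha> + 1/2) * T z) (T z)) UNIV S"
    by (intro normally_summable_theta_term S T pos holomorphic_intros)
  then obtain r M where r: "r > 0" "cball z r \<subseteq> S" and M: "M summable_on (UNIV :: int set)"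
    "\<And>w n. w \<in> cball z r \<Longrightarrow> norm (theta_term j 0 n ((of_real \<alpha> + 1/2) * T w) (T w)) \<le> M n"
    using z unfolding normally_summable_on_def by blast
  have c [continuous_intros]: "continuous_on (cball z r) T" "continuous_on (cball z r) U"
    using U T r(2) by (auto dest!: holomorphic_on_imp_continuous_on intro: continuous_on_subset)
  have "continuous_on (cball z r) (\<lambda>w. exp (2 * pi * \<i> * (of_real \<alpha> + 1/2) * U w - pi * \<i> * of_real \<alpha> ^ 2 * T w))"
    by (intro continuous_intros)
  then obtain K where "\<forall>w\<in>cball z r.
      norm (exp (2 * pi * \<i> * (of_real \<alpha> + 1/2) * U w - pi * \<i> * of_real \<alpha> ^ 2 * T w)) \<le> K"
    by (rule continuous_on_cball_bound[THEN exE])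
  note K = bspec[OF this]
  have cT: "continuous_on (cball z r) (\<lambda>z. Im (T z))" by (intro continuous_intros)
  obtain z1 where z1: "z1 \<in> cball z r" "\<And>w. w \<in> cball z r \<Longrightarrow> Im (T z1) \<le> Im (T w)"
    using continuous_attains_inf[OF compact_cball _ cT] r by force
  have cU: "continuous_on (cball z r) (\<lambda>z. \<bar>Im (U z)\<bar>)" by (intro continuous_intros)
  obtain z2 where z2: "\<And>w. w \<in> cball z r \<Longrightarrow> \<bar>Im (U w)\<bar> \<le> \<bar>Im (U z2)\<bar>"
    using continuous_attains_sup[OF compact_cball _ cU] r by force
  \<comment> \<open>For \<open>\<bar>n\<bar> > N\<close> one gets
    \<open>\<bar>n\<bar> * Im (T w) \<ge> \<bar>Im (U w)\<bar> + 1\<close>; \<open>z1\<close> and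
    \<open>z2\<close> are the extremal points on the ball.\<close>
  define N where "N = nat \<lceil>(\<bar>Im (U z2)\<bar> + 1) / Im (T z1)\<rceil>"
  have y: "Im (T z1) > 0" using pos z1(1) r(2) by blast
  have far: "norm (lerch_pole (U w + of_int n * T w)) \<le> 2" if w: "w \<in> cball z r" and n: "\<bar>n\<bar> > int N" for w n
  proof (rule norm_lerch_pole_le)
    have "(\<bar>Im (U z2)\<bar> + 1) / Im (T z1) \<le> real_of_int \<bar>n\<bar>"
      using n unfolding N_def by linarith
    then have "\<bar>Im (U z2)\<bar> + 1 \<le> of_int \<bar>n\<bar> * Im (T z1)" using y by (simp add: field_simps)
    also have "\<dots> \<le> of_int \<bar>n\<bar> * Im (T w)" using z1(2)[OF w] by (intro mult_left_mono) auto
    also have "\<dots> = \<bar>of_int n * Im (T w)\<bar>" using pos[of w] w r(2) by (auto simp: abs_mult)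
    finally show "1 \<le> \<bar>Im (U w + of_int n * T w)\<bar>" using z2[OF w] by simp
  qed
  have "\<forall>n\<in>I. \<exists>b. \<forall>w\<in>cball z r. norm (lerch_pole (U w + of_int n * T w)) \<le> b"
  proof
    fix n assume n: "n \<in> I"
    have "\<forall>w\<in>cball z r. 1 - exp (2 * pi * \<i> * (U w + of_int n * T w)) \<noteq> 0"
      using ne[OF _ n] r(2) by (auto dest!: subsetD)
    then have "continuous_on (cball z r) (\<lambda>w. lerch_pole (U w + of_int n * T w))"
      unfolding lerch_pole_def by (intro continuous_intros)
    then show "\<exists>b. \<forall>w\<in>cball z r. norm (lerch_pole (U w + of_int n * T w)) \<le> b"
      by (rule continuous_on_cball_bound)
  qed
  then obtain b where b: "\<And>n w. n \<in> I \<Longrightarrow> w \<in> cball z r \<Longrightarrow> norm (lerch_pole (U w + of_int n * T w)) \<le> b n"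
    by metis
  define D where "D = 2 + (\<Sum>n\<in>{- int N..int N}. \<bar>b n\<bar>)"
  have D: "norm (lerch_pole (U w + of_int n * T w)) \<le> D" if "n \<in> I" "w \<in> cball z r" for n w
  proof (cases "\<bar>n\<bar> > int N")
    case True
    have "(\<Sum>n\<in>{- int N..int N}. \<bar>b n\<bar>) \<ge> 0" by (intro sum_nonneg) auto
    with far[OF that(2) True] show ?thesis unfolding D_def by linarith
  next
    case False
    then have "\<bar>b n\<bar> \<le> (\<Sum>n\<in>{- int N..int N}. \<bar>b n\<bar>)" by (intro member_le_sum) auto
    then show ?thesis using b[OF that] by (simp add: D_def)
  qed
  have "norm (lerch_term \<alpha> \<beta> j n (U w) (T w)) \<le> K * M n * D" if "n \<in> I" "w \<in> cball z r" for n w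
  proof -
    have "0 \<le> K" using K[OF that(2)] norm_ge_zero by (rule order_trans[rotated])
    moreover have "0 \<le> M n" using M(2)[OF that(2)] norm_ge_zero by (rule order_trans[rotated])
    ultimately show ?thesis
      unfolding norm_lerch_term using K M(2) D that by (intro mult_mono) auto
  qed
  moreover have "(\<lambda>n. K * M n * D) summable_on I"
    by (intro summable_on_cmult_left summable_on_cmult_right summable_on_subset_banach[OF M(1)]) auto
  ultimately show "\<exists>r>0. \<exists>M. cball z r \<subseteq> S \<and> M summable_on I \<and>
      (\<forall>w\<in>cball z r. \<forall>n\<in>I. norm (lerch_term \<alpha> \<beta> j n (U w) (T w)) \<le> M n)"
    using r by (intro exI[of _ r] exI[of _ "\<lambda>n. K * M n * D"]) auto
qed

text \<open>Used in two instances: all \<open>n\<close> off the lattice, and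
  \<open>n \<noteq> 0\<close> on the strip \<open>\<bar>Im u\<bar> < Im \<tau>\<close> around the
  pole at 0.\<close>

definition lerch_domain :: "int set \<Rightarrow> complex \<Rightarrow> complex set \<Rightarrow> bool" where
  "lerch_domain I \<tau> S \<longleftrightarrow> open S \<and> Im \<tau> > 0 \<and> (\<forall>u\<in>S. \<forall>n\<in>I. exp (2 * pi * \<i> * (u + of_int n * \<tau>)) \<noteq> 1)"

context
  fixes \<alpha> \<beta> :: real and I :: "int set" and \<tau> :: complex and S :: "complex set"
  assumes S: "lerch_domain I \<tau> S"
begin

lemma lerch_term_DERIV_u:
  assumes "u \<in> S" "n \<in> I"
  shows "((\<lambda>u. lerch_term \<alpha> \<beta> j n u \<tau>) has_field_derivative
        of_int n ^ j * lerch_coeff \<alpha> \<beta> n \<tau> * lerch_kernel' (of_real \<alpha> + 1/2) (u + of_int n * \<tau>)) (at u)"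
    "((\<lambda>u. of_int n ^ j * lerch_coeff \<alpha> \<beta> n \<tau> * lerch_kernel' (of_real \<alpha> + 1/2) (u + of_int n * \<tau>)) has_field_derivative
        of_int n ^ j * lerch_coeff \<alpha> \<beta> n \<tau> * lerch_kernel'' (of_real \<alpha> + 1/2) (u + of_int n * \<tau>)) (at u)"
proof -
  have ne: "exp (2 * pi * \<i> * (u + of_int n * \<tau>)) \<noteq> 1" using S assms by (simp add: lerch_domain_def)
  have sh: "((\<lambda>u. u + of_int n * \<tau>) has_field_derivative 1) (at u)" by (auto intro!: derivative_eq_intros)
  show "((\<lambda>u. lerch_term \<alpha> \<beta> j n u \<tau>) has_field_derivative
        of_int n ^ j * lerch_coeff \<alpha> \<beta> n \<tau> * lerch_kernel' (of_real \<alpha> + 1/2) (u + of_int n * \<tau>)) (at u)"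
    unfolding lerch_term_def
    using DERIV_cmult[OF DERIV_chain'[OF sh lerch_kernel_DERIV(1)[OF ne]]] by simp
  show "((\<lambda>u. of_int n ^ j * lerch_coeff \<alpha> \<beta> n \<tau> * lerch_kernel' (of_real \<alpha> + 1/2) (u + of_int n * \<tau>)) has_field_derivative
        of_int n ^ j * lerch_coeff \<alpha> \<beta> n \<tau> * lerch_kernel'' (of_real \<alpha> + 1/2) (u + of_int n * \<tau>)) (at u)"
    using DERIV_cmult[OF DERIV_chain'[OF sh lerch_kernel_DERIV(2)[OF ne]]] by simp
qed

lemma normally_summable_lerch_term_u: "normally_summable_on (\<lambda>n u. lerch_term \<alpha> \<beta> j n u \<tau>) I S"
  using S normally_summable_lerch_term[of S "\<lambda>u. u" "\<lambda>_. \<tau>" I \<alpha> \<beta> j] by (auto simp: lerch_domain_def)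

lemma lerch_term_holomorphic: "n \<in> I \<Longrightarrow> (\<lambda>u. lerch_term \<alpha> \<beta> j n u \<tau>) holomorphic_on S"
  using S lerch_term_DERIV_u(1) by (auto simp: holomorphic_on_open lerch_domain_def)

lemma lerch_sum_holomorphic: "(\<lambda>u. lerch_sum \<alpha> \<beta> j I u \<tau>) holomorphic_on S"
  unfolding lerch_sum_def
  by (rule normally_summable_holomorphic[OF normally_summable_lerch_term_u lerch_term_holomorphic])

lemma lerch_term_has_sum:
  assumes u: "u \<in> S"
  shows "((\<lambda>n. lerch_term \<alpha> \<beta> j n u \<tau>) has_sum lerch_sum \<alpha> \<beta> j I u \<tau>) I"
    "((\<lambda>n. of_int n ^ j * lerch_coeff \<alpha> \<beta> n \<tau> * lerch_kernel' (of_real \<alpha> + 1/2) (u + of_int n * \<tau>))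
       has_sum deriv (\<lambda>u. lerch_sum \<alpha> \<beta> j I u \<tau>) u) I"
    "((\<lambda>n. of_int n ^ j * lerch_coeff \<alpha> \<beta> n \<tau> * lerch_kernel'' (of_real \<alpha> + 1/2) (u + of_int n * \<tau>))
       has_sum (deriv ^^ 2) (\<lambda>u. lerch_sum \<alpha> \<beta> j I u \<tau>) u) I"
proof -
  have oS: "open S" using S by (simp add: lerch_domain_def)
  have *: "((\<lambda>n. (deriv ^^ m) (\<lambda>u. lerch_term \<alpha> \<beta> j n u \<tau>) u) has_sum (deriv ^^ m) (\<lambda>u. lerch_sum \<alpha> \<beta> j I u \<tau>) u) I" for m
    unfolding lerch_sum_def
    by (rule normally_summable_higher_deriv(1)[OF normally_summable_lerch_term_u lerch_term_holomorphic u])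
  show "((\<lambda>n. lerch_term \<alpha> \<beta> j n u \<tau>) has_sum lerch_sum \<alpha> \<beta> j I u \<tau>) I"
    using *[of 0] by simp
  have d1: "deriv (\<lambda>u. lerch_term \<alpha> \<beta> j n u \<tau>) u = of_int n ^ j * lerch_coeff \<alpha> \<beta> n \<tau> * lerch_kernel' (of_real \<alpha> + 1/2) (u + of_int n * \<tau>)"
    if "u \<in> S" "n \<in> I" for n u
    using lerch_term_DERIV_u(1)[OF that] by (rule DERIV_imp_deriv)
  show "((\<lambda>n. of_int n ^ j * lerch_coeff \<alpha> \<beta> n \<tau> * lerch_kernel' (of_real \<alpha> + 1/2) (u + of_int n * \<tau>))
       has_sum deriv (\<lambda>u. lerch_sum \<alpha> \<beta> j I u \<tau>) u) I"
    using *[of 1] unfolding One_nat_def funpow.simps o_apply funpow_0 id_apply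
    by (rule has_sum_cong[THEN iffD1, rotated]) (rule d1[OF u])
  have d2: "(deriv ^^ 2) (\<lambda>u. lerch_term \<alpha> \<beta> j n u \<tau>) u = of_int n ^ j * lerch_coeff \<alpha> \<beta> n \<tau> * lerch_kernel'' (of_real \<alpha> + 1/2) (u + of_int n * \<tau>)"
    if n: "n \<in> I" for n
  proof -
    have "\<forall>\<^sub>F w in nhds u. w \<in> S" using oS u eventually_nhds_in_open by blast
    then have "\<forall>\<^sub>F w in nhds u. deriv (\<lambda>u. lerch_term \<alpha> \<beta> j n u \<tau>) w =
        of_int n ^ j * lerch_coeff \<alpha> \<beta> n \<tau> * lerch_kernel' (of_real \<alpha> + 1/2) (w + of_int n * \<tau>)"
      by eventually_elim (rule d1[OF _ n])
    then have "deriv (deriv (\<lambda>u. lerch_term \<alpha> \<beta> j n u \<tau>)) u =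
        deriv (\<lambda>w. of_int n ^ j * lerch_coeff \<alpha> \<beta> n \<tau> * lerch_kernel' (of_real \<alpha> + 1/2) (w + of_int n * \<tau>)) u"
      by (rule deriv_cong_ev) simp
    then show ?thesis
      using DERIV_imp_deriv[OF lerch_term_DERIV_u(2)[OF u n]] by (simp add: numeral_2_eq_2)
  qed
  show "((\<lambda>n. of_int n ^ j * lerch_coeff \<alpha> \<beta> n \<tau> * lerch_kernel'' (of_real \<alpha> + 1/2) (u + of_int n * \<tau>))
       has_sum (deriv ^^ 2) (\<lambda>u. lerch_sum \<alpha> \<beta> j I u \<tau>) u) I"
    using *[of 2] by (rule has_sum_cong[THEN iffD1, rotated]) (rule d2)
qed

end

text \<open>By termwise differentiation this is the heat operator applied to \<open>lerch_sum \<alpha> \<beta> 0\<close>, expressed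
  through derivatives in \<open>u\<close> only.\<close>

definition lerch_heat :: "real \<Rightarrow> real \<Rightarrow> int set \<Rightarrow> complex \<Rightarrow> complex \<Rightarrow> complex" where
  "lerch_heat \<alpha> \<beta> I u \<tau> = (deriv ^^ 2) (\<lambda>u. lerch_sum \<alpha> \<beta> 0 I u \<tau>) u + 4 * pi * \<i> * deriv (\<lambda>u. lerch_sum \<alpha> \<beta> 1 I u \<tau>) u
     - 4 * pi ^ 2 * (lerch_sum \<alpha> \<beta> 2 I u \<tau> - of_real \<alpha> ^ 2 * lerch_sum \<alpha> \<beta> 0 I u \<tau>)"

text \<open>The heat operator on one summand: the \<tau>-derivative of \<open>lerch_coeff\<close>
  contributes \<open>pi * \<i> * (n^2 - \<alpha>^2)\<close>, that of the inner argument the factor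
  \<open>n\<close>, both multiplied by \<open>4 * pi * \<i>\<close>.\<close>

definition lerch_heat_term :: "real \<Rightarrow> real \<Rightarrow> int \<Rightarrow> complex \<Rightarrow> complex \<Rightarrow> complex" where
  "lerch_heat_term \<alpha> \<beta> n u \<tau> = lerch_coeff \<alpha> \<beta> n \<tau> *
     (lerch_kernel'' (of_real \<alpha> + 1/2) (u + of_int n * \<tau>) + 4 * pi * \<i> * of_int n * lerch_kernel' (of_real \<alpha> + 1/2) (u + of_int n * \<tau>)
      - 4 * pi ^ 2 * (of_int n ^ 2 - of_real \<alpha> ^ 2) * lerch_kernel (of_real \<alpha> + 1/2) (u + of_int n * \<tau>))"

lemma lerch_heat_holomorphic:
  assumes "lerch_domain I \<tau> S"
  shows "(\<lambda>u. lerch_heat \<alpha> \<beta> I u \<tau>) holomorphic_on S"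
proof -
  have "open S" using assms by (simp add: lerch_domain_def)
  then show ?thesis
    unfolding lerch_heat_def
    by (intro holomorphic_intros holomorphic_deriv holomorphic_higher_deriv lerch_sum_holomorphic[OF assms])
qed

lemma lerch_heat_has_sum:
  assumes "lerch_domain I \<tau> S" "u \<in> S"
  shows "((\<lambda>n. lerch_heat_term \<alpha> \<beta> n u \<tau>) has_sum lerch_heat \<alpha> \<beta> I u \<tau>) I"
proof -
  note s = lerch_term_has_sum[OF assms]
  have "((\<lambda>n. of_int n ^ 0 * lerch_coeff \<alpha> \<beta> n \<tau> * lerch_kernel'' (of_real \<alpha> + 1/2) (u + of_int n * \<tau>)
        + 4 * pi * \<i> * (of_int n ^ 1 * lerch_coeff \<alpha> \<beta> n \<tau> * lerch_kernel' (of_real \<alpha> + 1/2) (u + of_int n * \<tau>))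
        - 4 * pi ^ 2 * (lerch_term \<alpha> \<beta> 2 n u \<tau> - of_real \<alpha> ^ 2 * lerch_term \<alpha> \<beta> 0 n u \<tau>)) has_sum lerch_heat \<alpha> \<beta> I u \<tau>) I"
    unfolding lerch_heat_def
    by (intro has_sum_add has_sum_diff has_sum_cmult_right s)
  then show ?thesis
    by (simp add: lerch_heat_term_def lerch_term_def algebra_simps)
qed

text \<open>The lattice is the zero set of the continuous function \<open>vartheta\<close>, which
  gives openness of its complement and, in the first claim, openness in \<open>t\<close> while the
  lattice itself moves.\<close>

lemma open_vartheta_nonzero:
  "open {t. Im t > 0 \<and> vartheta u t \<noteq> 0}"
  "Im \<tau> > 0 \<Longrightarrow> open (- period_lattice \<tau>)"
proof -
  have "continuous_on upper_half_plane (\<lambda>t. theta 0 (1/2) (fst (u + 1/2, t)) (snd (u + 1/2, t)))"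
    by (rule continuous_on_compose2[OF theta_continuous_on]) (auto intro!: continuous_intros)
  then have "continuous_on upper_half_plane (\<lambda>t. vartheta u t)" by (simp add: vartheta_eq_theta)
  then have "open (upper_half_plane \<inter> (\<lambda>t. vartheta u t) -` (- {0}))"
    by (rule continuous_open_preimage) (auto simp: open_upper_half_plane)
  also have "upper_half_plane \<inter> (\<lambda>t. vartheta u t) -` (- {0}) = {t. Im t > 0 \<and> vartheta u t \<noteq> 0}"
    by (auto simp: upper_half_plane_def)
  finally show "open {t. Im t > 0 \<and> vartheta u t \<noteq> 0}" .
  assume \<tau>: "Im \<tau> > 0"
  have "continuous_on UNIV (\<lambda>u. theta 0 (1/2) (fst (u + 1/2, \<tau>)) (snd (u + 1/2, \<tau>)))"
    by (rule continuous_on_compose2[OF theta_continuous_on]) (use \<tau> in \<open>auto simp: upper_half_plane_def intro!: continuous_intros\<close>)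
  then have "continuous_on UNIV (\<lambda>u. vartheta u \<tau>)" by (simp add: vartheta_eq_theta)
  then have "open (UNIV \<inter> (\<lambda>u. vartheta u \<tau>) -` (- {0}))"
    by (rule continuous_open_preimage) auto
  also have "UNIV \<inter> (\<lambda>u. vartheta u \<tau>) -` (- {0}) = - period_lattice \<tau>"
    using vartheta_nonzero[OF \<tau>] vartheta_lattice[OF \<tau>] by auto
  finally show "open (- period_lattice \<tau>)" .
qed

lemma lerch_domain_UNIV: "Im \<tau> > 0 \<Longrightarrow> lerch_domain UNIV \<tau> (- period_lattice \<tau>)"
  unfolding lerch_domain_def using open_vartheta_nonzero(2) exp_2pi_neq_1 by auto

lemma lerch_domain_nonzero:
  assumes "Im \<tau> > 0"
  shows "lerch_domain (- {0}) \<tau> {u. \<bar>Im u\<bar> < Im \<tau>}"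
  unfolding lerch_domain_def
proof (intro conjI ballI)
  show "open {u. \<bar>Im u\<bar> < Im \<tau>}" by (intro open_Collect_less continuous_intros)
  fix u and n :: int assume u: "u \<in> {u. \<bar>Im u\<bar> < Im \<tau>}" and n: "n \<in> - {0}"
  show "exp (2 * pi * \<i> * (u + of_int n * \<tau>)) \<noteq> 1"
  proof
    assume "exp (2 * pi * \<i> * (u + of_int n * \<tau>)) = 1"
    then obtain k :: int where "u + of_int n * \<tau> = of_int k" by (rule exp_2pi_eq_1_imp_int)
    then have "Im (u + of_int n * \<tau>) = 0" by simp
    then have "\<bar>Im u\<bar> = \<bar>real_of_int n\<bar> * Im \<tau>" using assms by (simp add: add_eq_0_iff2 abs_mult)
    moreover have "1 * Im \<tau> \<le> \<bar>real_of_int n\<bar> * Im \<tau>" using n assms by (intro mult_right_mono) auto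
    ultimately show False using u by simp
  qed
qed (rule assms)

text \<open>The poles move with \<open>t\<close>, so the series is differentiated on the open set of
  those \<open>t\<close> for which \<open>u\<close> is no lattice point. The summands
  \<open>n * k'\<close> are recognised as the \<open>u\<close>-derivative of the sum of weight
  1.\<close>

lemma lerch_sum_DERIV_tau:
  assumes \<tau>: "Im \<tau> > 0" and u: "u \<notin> period_lattice \<tau>"
  shows "((\<lambda>t. lerch_sum \<alpha> \<beta> 0 UNIV u t) has_field_derivative
     pi * \<i> * (lerch_sum \<alpha> \<beta> 2 UNIV u \<tau> - of_real \<alpha> ^ 2 * lerch_sum \<alpha> \<beta> 0 UNIV u \<tau>)
       + deriv (\<lambda>u. lerch_sum \<alpha> \<beta> 1 UNIV u \<tau>) u) (at \<tau>)"
proof -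
  define S where "S = {t. Im t > 0 \<and> vartheta u t \<noteq> 0}"
  define k where "k = lerch_kernel (of_real \<alpha> + 1/2)"
  define k' where "k' = lerch_kernel' (of_real \<alpha> + 1/2)"
  have S: "open S" "\<tau> \<in> S"
    using open_vartheta_nonzero(1) vartheta_nonzero[OF \<tau> u] \<tau> by (auto simp: S_def)
  have ne: "exp (2 * pi * \<i> * (u + of_int n * t)) \<noteq> 1" if "t \<in> S" for t n
    using that vartheta_lattice[of t u] exp_2pi_neq_1[of u t n] by (auto simp: S_def)
  note s = lerch_term_has_sum[OF lerch_domain_UNIV[OF \<tau>], of u]
  have u': "u \<in> - period_lattice \<tau>" using u by simp
  show ?thesis
    unfolding lerch_sum_def[of _ _ 0 UNIV u t for t]
  proof (rule normally_summable_DERIV[OF normally_summable_lerch_term S, where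
        f' = "\<lambda>n t. lerch_coeff \<alpha> \<beta> n t * (pi * \<i> * (of_int n ^ 2 - of_real \<alpha> ^ 2) * k (u + of_int n * t) + of_int n * k' (u + of_int n * t))"])
    have "((\<lambda>n. pi * \<i> * (lerch_term \<alpha> \<beta> 2 n u \<tau> - of_real \<alpha> ^ 2 * lerch_term \<alpha> \<beta> 0 n u \<tau>)
        + of_int n ^ 1 * lerch_coeff \<alpha> \<beta> n \<tau> * lerch_kernel' (of_real \<alpha> + 1/2) (u + of_int n * \<tau>)) has_sum
       (pi * \<i> * (lerch_sum \<alpha> \<beta> 2 UNIV u \<tau> - of_real \<alpha> ^ 2 * lerch_sum \<alpha> \<beta> 0 UNIV u \<tau>)
       + deriv (\<lambda>u. lerch_sum \<alpha> \<beta> 1 UNIV u \<tau>) u)) UNIV"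
      by (intro has_sum_add has_sum_diff has_sum_cmult_right s u')
    then show "((\<lambda>n. lerch_coeff \<alpha> \<beta> n \<tau> * (pi * \<i> * (of_int n ^ 2 - of_real \<alpha> ^ 2) * k (u + of_int n * \<tau>) + of_int n * k' (u + of_int n * \<tau>))) has_sum
       (pi * \<i> * (lerch_sum \<alpha> \<beta> 2 UNIV u \<tau> - of_real \<alpha> ^ 2 * (\<Sum>\<^sub>\<infinity>n. lerch_term \<alpha> \<beta> 0 n u \<tau>))
       + deriv (\<lambda>u. lerch_sum \<alpha> \<beta> 1 UNIV u \<tau>) u)) UNIV"
      by (simp add: lerch_term_def k_def k'_def lerch_sum_def[of _ _ 0] algebra_simps)
  next
    fix n t assume t: "t \<in> S"
    have sh: "((\<lambda>t. u + of_int n * t) has_field_derivative of_int n) (at t)" by (auto intro!: derivative_eq_intros)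
    note [derivative_intros] = DERIV_chain'[OF sh lerch_kernel_DERIV(1)[OF ne[OF t]]]
    show "((\<lambda>t. lerch_term \<alpha> \<beta> 0 n u t) has_field_derivative
       lerch_coeff \<alpha> \<beta> n t * (pi * \<i> * (of_int n ^ 2 - of_real \<alpha> ^ 2) * k (u + of_int n * t) + of_int n * k' (u + of_int n * t))) (at t)"
      unfolding lerch_term_def lerch_coeff_def k_def k'_def
      by (rule derivative_eq_intros refl)+ (simp add: algebra_simps)
  qed (use S ne in \<open>auto simp: S_def\<close>)
qed

lemma lerch_split_zero:
  assumes \<tau>: "Im \<tau> > 0" and u: "u \<notin> period_lattice \<tau>" "\<bar>Im u\<bar> < Im \<tau>"
  shows "lerch_sum \<alpha> \<beta> 0 UNIV u \<tau> = lerch_term \<alpha> \<beta> 0 0 u \<tau> + lerch_sum \<alpha> \<beta> 0 (- {0}) u \<tau>"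
    and "lerch_heat \<alpha> \<beta> UNIV u \<tau> = lerch_heat_term \<alpha> \<beta> 0 u \<tau> + lerch_heat \<alpha> \<beta> (- {0}) u \<tau>"
proof -
  have UNIV: "insert 0 (- {0}) = (UNIV :: int set)" by auto
  have u': "u \<in> - period_lattice \<tau>" "u \<in> {u. \<bar>Im u\<bar> < Im \<tau>}" using u by auto
  note d = lerch_domain_UNIV[OF \<tau>] lerch_domain_nonzero[OF \<tau>]
  show "lerch_sum \<alpha> \<beta> 0 UNIV u \<tau> = lerch_term \<alpha> \<beta> 0 0 u \<tau> + lerch_sum \<alpha> \<beta> 0 (- {0}) u \<tau>"
    using has_sum_insert[OF _ lerch_term_has_sum(1)[OF d(2) u'(2), of \<alpha> \<beta> 0], of 0]
      lerch_term_has_sum(1)[OF d(1) u'(1), of \<alpha> \<beta> 0]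
    by (auto simp: UNIV intro: has_sum_unique)
  show "lerch_heat \<alpha> \<beta> UNIV u \<tau> = lerch_heat_term \<alpha> \<beta> 0 u \<tau> + lerch_heat \<alpha> \<beta> (- {0}) u \<tau>"
    using has_sum_insert[OF _ lerch_heat_has_sum[OF d(2) u'(2), of \<alpha> \<beta>], of 0]
      lerch_heat_has_sum[OF d(1) u'(1), of \<alpha> \<beta>]
    by (auto simp: UNIV intro: has_sum_unique)
qed

section \<open>The Lerch series under shifts of \<open>u\<close> by the periods\<close>

lemma period_lattice_shift:
  "u + 1 \<in> period_lattice \<tau> \<longleftrightarrow> u \<in> period_lattice \<tau>"
  "u + \<tau> \<in> period_lattice \<tau> \<longleftrightarrow> u \<in> period_lattice \<tau>"
proof -
  have eq: "u \<in> period_lattice \<tau> \<longleftrightarrow> (\<exists>m n :: int. u = of_int m * \<tau> + of_int n)" for u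
    by (auto simp: period_lattice_def)
  have 1: "(\<exists>m n :: int. u + 1 = of_int m * \<tau> + of_int n) \<longleftrightarrow> (\<exists>m n :: int. u = of_int m * \<tau> + of_int n)"
  proof safe
    fix m n :: int assume "u + 1 = of_int m * \<tau> + of_int n"
    then have "u = of_int m * \<tau> + of_int (n - 1)" by (simp add: algebra_simps)
    then show "\<exists>m n :: int. u = of_int m * \<tau> + of_int n" by blast
  next
    fix m n :: int
    have "of_int m * \<tau> + of_int n + 1 = of_int m * \<tau> + of_int (n + 1)" by simp
    then show "\<exists>ma na :: int. of_int m * \<tau> + of_int n + 1 = of_int ma * \<tau> + of_int na" by blast
  qed
  have 2: "(\<exists>m n :: int. u + \<tau> = of_int m * \<tau> + of_int n) \<longleftrightarrow> (\<exists>m n :: int. u = of_int m * \<tau> + of_int n)"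
  proof safe
    fix m n :: int assume "u + \<tau> = of_int m * \<tau> + of_int n"
    then have "u = of_int (m - 1) * \<tau> + of_int n" by (simp add: algebra_simps)
    then show "\<exists>m n :: int. u = of_int m * \<tau> + of_int n" by blast
  next
    fix m n :: int
    have "of_int m * \<tau> + of_int n + \<tau> = of_int (m + 1) * \<tau> + of_int n" by (simp add: algebra_simps)
    then show "\<exists>ma na :: int. of_int m * \<tau> + of_int n + \<tau> = of_int ma * \<tau> + of_int na" by blast
  qed
  show "u + 1 \<in> period_lattice \<tau> \<longleftrightarrow> u \<in> period_lattice \<tau>" "u + \<tau> \<in> period_lattice \<tau> \<longleftrightarrow> u \<in> period_lattice \<tau>"
    unfolding eq using 1 2 by blast+
qed

lemma lerch_shift_one:
  assumes \<tau>: "Im \<tau> > 0" and u: "u \<notin> period_lattice \<tau>"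
  shows "lerch_sum \<alpha> \<beta> 0 UNIV (u + 1) \<tau> = - exp (2 * pi * \<i> * of_real \<alpha>) * lerch_sum \<alpha> \<beta> 0 UNIV u \<tau>"
    and "lerch_heat \<alpha> \<beta> UNIV (u + 1) \<tau> = - exp (2 * pi * \<i> * of_real \<alpha>) * lerch_heat \<alpha> \<beta> UNIV u \<tau>"
proof -
  have u': "u \<in> - period_lattice \<tau>" "u + 1 \<in> - period_lattice \<tau>" using u period_lattice_shift by auto
  note d = lerch_domain_UNIV[OF \<tau>]
  have e: "exp (2 * pi * \<i> * (of_real \<alpha> + 1/2)) = - exp (2 * pi * \<i> * of_real \<alpha>)"
    by (simp add: distrib_left exp_add)
  have w: "u + 1 + of_int n * \<tau> = u + of_int n * \<tau> + 1" for n by simp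
  have "lerch_term \<alpha> \<beta> 0 n (u + 1) \<tau> = - exp (2 * pi * \<i> * of_real \<alpha>) * lerch_term \<alpha> \<beta> 0 n u \<tau>" for n
    unfolding lerch_term_def w lerch_kernel_shift_one e by simp
  then have "((\<lambda>n. lerch_term \<alpha> \<beta> 0 n (u + 1) \<tau>) has_sum - exp (2 * pi * \<i> * of_real \<alpha>) * lerch_sum \<alpha> \<beta> 0 UNIV u \<tau>) UNIV"
    using has_sum_cmult_right[OF lerch_term_has_sum(1)[OF d u'(1)], of "- exp (2 * pi * \<i> * of_real \<alpha>)"] by (simp only:)
  with lerch_term_has_sum(1)[OF d u'(2)]
  show "lerch_sum \<alpha> \<beta> 0 UNIV (u + 1) \<tau> = - exp (2 * pi * \<i> * of_real \<alpha>) * lerch_sum \<alpha> \<beta> 0 UNIV u \<tau>"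
    by (rule has_sum_unique)
  have "lerch_heat_term \<alpha> \<beta> n (u + 1) \<tau> = - exp (2 * pi * \<i> * of_real \<alpha>) * lerch_heat_term \<alpha> \<beta> n u \<tau>" for n
    unfolding lerch_heat_term_def w lerch_kernel_shift_one e by (simp add: algebra_simps)
  then have "((\<lambda>n. lerch_heat_term \<alpha> \<beta> n (u + 1) \<tau>) has_sum - exp (2 * pi * \<i> * of_real \<alpha>) * lerch_heat \<alpha> \<beta> UNIV u \<tau>) UNIV"
    using has_sum_cmult_right[OF lerch_heat_has_sum[OF d u'(1)], of "- exp (2 * pi * \<i> * of_real \<alpha>)"] by (simp only:)
  with lerch_heat_has_sum[OF d u'(2)]
  show "lerch_heat \<alpha> \<beta> UNIV (u + 1) \<tau> = - exp (2 * pi * \<i> * of_real \<alpha>) * lerch_heat \<alpha> \<beta> UNIV u \<tau>"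
    by (rule has_sum_unique)
qed

text \<open>The terms containing \<open>n\<close> complete the square (d/du + 2 pi i n)^2, so in the
  formula for the second derivative \<open>\<alpha> + 1/2\<close> is replaced by
  \<open>b = \<alpha> + 1/2 + n\<close>.\<close>

lemma lerch_heat_term_altdef:
  "lerch_heat_term \<alpha> \<beta> n u \<tau> = (let P = lerch_pole (u + of_int n * \<tau>); b = of_real \<alpha> + 1/2 + of_int n in
     lerch_coeff \<alpha> \<beta> n \<tau> * (-4 * pi ^ 2) * exp (2 * pi * \<i> * (of_real \<alpha> + 1/2) * (u + of_int n * \<tau>)) *
       ((b ^ 2 - of_real \<alpha> ^ 2) * P + 2 * b * (P ^ 2 - P) + (2 * P - 1) * (P ^ 2 - P)))"
  unfolding lerch_heat_term_def lerch_kernel_def lerch_kernel'_def lerch_kernel''_def Let_def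
  by (simp add: algebra_simps power2_eq_square)

text \<open>The index moves from \<open>n\<close> to \<open>n + 1\<close>, and
  \<open>x n * P n = P n - 1\<close> leaves a remainder without poles that sums to a theta series.
  As \<open>P0\<close> solves the heat equation, the remainder in the second claim is
  \<open>P0\<close> times \<open>4 * pi * \<i>\<close> times the \<tau>-derivative of
  \<open>vartheta (\<alpha> * \<tau> + \<beta>) \<tau>\<close>.\<close>

lemma lerch_shift_tau:
  fixes \<alpha> \<beta> :: real and \<tau> u :: complex
  assumes \<tau>: "Im \<tau> > 0" and u: "u \<notin> period_lattice \<tau>"
  defines "\<mu> \<equiv> exp (- pi * \<i> * (1 + 2 * of_real \<beta>) + pi * \<i> * \<tau> + 2 * pi * \<i> * u)"
    and "P0 \<equiv> exp (2 * pi * \<i> * (of_real \<alpha> - 1/2) * u - pi * \<i> * (of_real \<alpha> - 1/2) ^ 2 * \<tau> + pi * \<i> * of_real \<beta> + pi * \<i> / 2)"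
    and "w \<equiv> of_real \<alpha> * \<tau> + of_real \<beta> + 1/2"
  shows "lerch_sum \<alpha> \<beta> 0 UNIV (u + \<tau>) \<tau> = \<mu> * (lerch_sum \<alpha> \<beta> 0 UNIV u \<tau> + P0 * theta 0 (1/2) w \<tau>)" (is ?sum)
    and "lerch_heat \<alpha> \<beta> UNIV (u + \<tau>) \<tau> = \<mu> * (lerch_heat \<alpha> \<beta> UNIV u \<tau> +
       P0 * (- 4 * pi ^ 2 * (theta 2 (1/2) w \<tau> + 2 * of_real \<alpha> * theta 1 (1/2) w \<tau>)))" (is ?heat)
proof -
  have u': "u \<in> - period_lattice \<tau>" "u + \<tau> \<in> - period_lattice \<tau>" using u period_lattice_shift by auto
  note d = lerch_domain_UNIV[OF \<tau>]
  define A where "A = complex_of_real \<alpha>"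
  define y where "y n = exp (2 * pi * \<i> * (A - 1/2) * (u + of_int (n + 1) * \<tau>))" for n :: int
  define x where "x n = exp (2 * pi * \<i> * (u + of_int (n + 1) * \<tau>))" for n :: int
  define P where "P n = lerch_pole (u + of_int (n + 1) * \<tau>)" for n :: int
  define c where "c n = lerch_coeff \<alpha> \<beta> n \<tau>" for n
  have sh: "u + \<tau> + of_int n * \<tau> = u + of_int (n + 1) * \<tau>" for n :: int by (simp add: algebra_simps)
  have E: "exp (2 * pi * \<i> * (A + 1/2) * (u + of_int (n + 1) * \<tau>)) = y n * x n" for n
    unfolding y_def x_def mult_exp_exp by (intro arg_cong[of _ _ exp]) (simp add: algebra_simps)
  have cx: "c n * x n = \<mu> * c (n + 1)" for n
    unfolding c_def lerch_coeff_def x_def \<mu>_def mult_exp_exp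
    by (intro arg_cong[of _ _ exp]) (simp add: algebra_simps power2_eq_square)
  have cy: "c (n + 1) * y n = P0 * theta_term 0 (1/2) n w \<tau>" for n
    unfolding c_def lerch_coeff_def y_def P0_def theta_term_def w_def A_def power_0 mult_1 mult_exp_exp
    by (intro arg_cong[of _ _ exp]) (simp add: field_simps power2_eq_square)
  have xP: "x n * P n = P n - 1" for n
    using exp_2pi_neq_1[OF u, of "n + 1"] unfolding x_def P_def lerch_pole_def by (simp add: field_simps)
  have sum: "lerch_term \<alpha> \<beta> 0 n (u + \<tau>) \<tau> = \<mu> * (lerch_term \<alpha> \<beta> 0 (n + 1) u \<tau> + P0 * theta_term 0 (1/2) n w \<tau>)" for n
  proof -
    have "lerch_term \<alpha> \<beta> 0 n (u + \<tau>) \<tau> = (c n * x n) * y n * P n"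
      unfolding lerch_term_def lerch_kernel_def sh A_def[symmetric] E by (simp add: P_def c_def)
    also have "\<dots> = \<mu> * (c (n + 1) * y n * (x n * P n) + c (n + 1) * y n)"
      unfolding cx xP by (simp add: algebra_simps)
    also have "c (n + 1) * y n * (x n * P n) = lerch_term \<alpha> \<beta> 0 (n + 1) u \<tau>"
      unfolding lerch_term_def lerch_kernel_def A_def[symmetric] E by (simp add: P_def c_def)
    finally show ?thesis unfolding cy .
  qed
  have heat: "lerch_heat_term \<alpha> \<beta> n (u + \<tau>) \<tau> = \<mu> * (lerch_heat_term \<alpha> \<beta> (n + 1) u \<tau> +
      P0 * (- 4 * pi ^ 2 * (theta_term 2 (1/2) n w \<tau> + 2 * of_real \<alpha> * theta_term 1 (1/2) n w \<tau>)))" for n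
  proof -
    define b where "b = A + 1/2 + of_int (n + 1)"
    let ?Q = "\<lambda>b. (b ^ 2 - A ^ 2) * P n + 2 * b * (P n ^ 2 - P n) + (2 * P n - 1) * (P n ^ 2 - P n)"
    \<comment> \<open>Here \<open>z\<close> stands for \<open>x n * P n\<close>. Passing from
      \<open>b - 1\<close> to \<open>b\<close> while absorbing one factor \<open>x n\<close> leaves
      only a term constant in the pole.\<close>
    have alg: "(b - 1)\<^sup>2 * p + 2 * (b - 1) * (p\<^sup>2 - p) + (2 * p - 1) * (p\<^sup>2 - p) - A\<^sup>2 * p
       = b\<^sup>2 * z + 2 * b * (z * (p - 1)) + (2 * p - 1) * (z * (p - 1)) - A\<^sup>2 * z + ((b - 1)\<^sup>2 - A\<^sup>2)"
      if "z = p - 1" for p z :: complex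
      unfolding that by (simp add: algebra_simps power2_eq_square)
    have alg': "?Q (b - 1) = x n * ?Q b + ((b - 1)\<^sup>2 - A\<^sup>2)"
      using alg[OF xP[of n]] by (simp add: algebra_simps power2_eq_square)
    have b1: "A + 1/2 + of_int n = b - 1" by (simp add: b_def)
    have "lerch_heat_term \<alpha> \<beta> n (u + \<tau>) \<tau> = (c n * x n) * (- 4 * pi ^ 2) * y n * ?Q (b - 1)"
      unfolding lerch_heat_term_altdef Let_def sh A_def[symmetric] E b1 by (simp add: P_def c_def)
    also have "\<dots> = \<mu> * (c (n + 1) * (- 4 * pi ^ 2) * (y n * x n) * ?Q b + - 4 * pi ^ 2 * ((b - 1)\<^sup>2 - A\<^sup>2) * (c (n + 1) * y n))"
      unfolding cx alg' by (simp add: algebra_simps)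
    also have "c (n + 1) * (- 4 * pi ^ 2) * (y n * x n) * ?Q b = lerch_heat_term \<alpha> \<beta> (n + 1) u \<tau>"
      unfolding lerch_heat_term_altdef Let_def A_def[symmetric] E b_def by (simp add: P_def c_def)
    also have "- 4 * pi ^ 2 * ((b - 1)\<^sup>2 - A\<^sup>2) * (c (n + 1) * y n) =
        P0 * (- 4 * pi ^ 2 * (theta_term 2 (1/2) n w \<tau> + 2 * of_real \<alpha> * theta_term 1 (1/2) n w \<tau>))"
    proof -
      \<comment> \<open>The constant term splits into the weights of \<open>theta 2\<close> and
        \<open>theta 1\<close>.\<close>
      have "(b - 1)\<^sup>2 - A\<^sup>2 = (of_int n + 1/2) ^ 2 + 2 * A * (of_int n + 1/2)"
        by (simp add: b_def field_simps power2_eq_square)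
      then show ?thesis unfolding cy by (simp add: theta_term_def A_def algebra_simps)
    qed
    finally show ?thesis .
  qed
  have reidx: "((\<lambda>n. f (n + 1)) has_sum s) UNIV" if "(f has_sum s) UNIV" for f :: "int \<Rightarrow> complex" and s
    using that has_sum_reindex[of "\<lambda>n::int. n + 1" UNIV f s] by (simp add: o_def surj_plus_right)
  have "((\<lambda>n. lerch_term \<alpha> \<beta> 0 n (u + \<tau>) \<tau>) has_sum \<mu> * (lerch_sum \<alpha> \<beta> 0 UNIV u \<tau> + P0 * theta 0 (1/2) w \<tau>)) UNIV"
    unfolding sum by (intro has_sum_cmult_right has_sum_add reidx lerch_term_has_sum(1)[OF d] theta_term_has_sum \<tau> u')
  with lerch_term_has_sum(1)[OF d u'(2)] show ?sum by (rule has_sum_unique)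
  have "((\<lambda>n. lerch_heat_term \<alpha> \<beta> n (u + \<tau>) \<tau>) has_sum \<mu> * (lerch_heat \<alpha> \<beta> UNIV u \<tau> +
       P0 * (- 4 * pi ^ 2 * (theta 2 (1/2) w \<tau> + 2 * of_real \<alpha> * theta 1 (1/2) w \<tau>)))) UNIV"
    unfolding heat by (intro has_sum_cmult_right has_sum_add reidx lerch_heat_has_sum[OF d] theta_term_has_sum \<tau> u')
  with lerch_heat_has_sum[OF d u'(2)] show ?heat by (rule has_sum_unique)
qed

text \<open>The numerator of the heat operator applied to \<open>lerch_sum \<alpha> \<beta> 0 / \<vartheta>(v)\<close> over the denominator
  \<open>\<vartheta>(v)\<^sup>2\<close>, where \<open>v = \<alpha>\<tau> + \<beta>\<close>. The inhomogeneous terms of its two parts under \<open>u \<mapsto> u + \<tau>\<close> cancel.\<close>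

definition vartheta_tau :: "real \<Rightarrow> real \<Rightarrow> complex \<Rightarrow> complex" where
  "vartheta_tau \<alpha> \<beta> \<tau> = pi * \<i> * (theta 2 (1/2) (of_real \<alpha> * \<tau> + of_real \<beta> + 1/2) \<tau>
     + 2 * of_real \<alpha> * theta 1 (1/2) (of_real \<alpha> * \<tau> + of_real \<beta> + 1/2) \<tau>)"

definition heat_numerator :: "real \<Rightarrow> real \<Rightarrow> complex \<Rightarrow> complex \<Rightarrow> complex" where
  "heat_numerator \<alpha> \<beta> u \<tau> = vartheta (of_real \<alpha> * \<tau> + of_real \<beta>) \<tau> * lerch_heat \<alpha> \<beta> UNIV u \<tau>
     - 4 * pi * \<i> * vartheta_tau \<alpha> \<beta> \<tau> * lerch_sum \<alpha> \<beta> 0 UNIV u \<tau>"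

lemma vartheta_DERIV_tau:
  assumes "Im \<tau> > 0"
  shows "((\<lambda>t. vartheta (of_real \<alpha> * t + of_real \<beta>) t) has_field_derivative vartheta_tau \<alpha> \<beta> \<tau>) (at \<tau>)"
proof -
  have "((\<lambda>t. theta 0 (1/2) (of_real \<alpha> * t + of_real \<beta> + 1/2) t) has_field_derivative
      (2 * pi * \<i> * of_real \<alpha> * theta (Suc 0) (1/2) (of_real \<alpha> * \<tau> + of_real \<beta> + 1/2) \<tau> +
       pi * \<i> * 1 * theta (Suc (Suc 0)) (1/2) (of_real \<alpha> * \<tau> + of_real \<beta> + 1/2) \<tau>)) (at \<tau>)"
    by (rule theta_DERIV[OF open_upper_half_plane])
       (use assms in \<open>auto simp: upper_half_plane_def intro!: derivative_eq_intros\<close>)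
  then show ?thesis
    by (simp add: vartheta_eq_theta vartheta_tau_def algebra_simps numeral_2_eq_2)
qed

lemma heat_numerator_shift_one:
  assumes "Im \<tau> > 0" "u \<notin> period_lattice \<tau>"
  shows "heat_numerator \<alpha> \<beta> (u + 1) \<tau> = - exp (2 * pi * \<i> * of_real \<alpha>) * heat_numerator \<alpha> \<beta> u \<tau>"
  unfolding heat_numerator_def lerch_shift_one[OF assms] by (simp add: algebra_simps)

lemma heat_numerator_shift_tau:
  assumes "Im \<tau> > 0" "u \<notin> period_lattice \<tau>"
  shows "heat_numerator \<alpha> \<beta> (u + \<tau>) \<tau> =
    exp (- pi * \<i> * (1 + 2 * of_real \<beta>) + pi * \<i> * \<tau> + 2 * pi * \<i> * u) * heat_numerator \<alpha> \<beta> u \<tau>"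
  unfolding heat_numerator_def lerch_shift_tau[OF assms] vartheta_tau_def vartheta_eq_theta
  by (simp add: algebra_simps power2_eq_square)

text \<open>An identity of total functions, so it can be rewritten under \<open>deriv\<close>
  without a neighbourhood argument.\<close>

lemma lerch_mu_eq_lerch_sum:
  "exp (2 * pi * \<i> * of_real \<alpha> * u - pi * \<i> * of_real \<alpha> ^ 2 * t) * lerch_mu u (of_real \<alpha> * t + of_real \<beta>) t =
     lerch_sum \<alpha> \<beta> 0 UNIV u t / vartheta (of_real \<alpha> * t + of_real \<beta>) t"
proof -
  define E where "E = exp (2 * pi * \<i> * of_real \<alpha> * u - pi * \<i> * of_real \<alpha> ^ 2 * t) * exp (pi * \<i> * u)"
  have pw: "(-1) powi n = exp (pi * \<i> * of_int n)" for n
  proof -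
    have "(-1) powi n = exp (pi * \<i>) powi n" by simp
    also have "\<dots> = exp (of_int n * (pi * \<i>))" by (simp only: exp_power_int mult.commute)
    finally show ?thesis by (simp only: mult.commute)
  qed
  have "E * ((-1) powi n * exp (pi * \<i> * (of_int n ^ 2 + of_int n) * t + 2 * pi * \<i> * (of_real \<alpha> * t + of_real \<beta>) * of_int n) /
        (1 - exp (2 * pi * \<i> * of_int n * t + 2 * pi * \<i> * u))) = lerch_term \<alpha> \<beta> 0 n u t" for n
  proof -
    have 1: "E * ((-1) powi n * exp (pi * \<i> * (of_int n ^ 2 + of_int n) * t + 2 * pi * \<i> * (of_real \<alpha> * t + of_real \<beta>) * of_int n))
      = lerch_coeff \<alpha> \<beta> n t * exp (2 * pi * \<i> * (of_real \<alpha> + 1/2) * (u + of_int n * t))"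
      unfolding E_def pw lerch_coeff_def mult_exp_exp
      by (intro arg_cong[of _ _ exp]) (simp add: algebra_simps)
    have 2: "2 * pi * \<i> * of_int n * t + 2 * pi * \<i> * u = 2 * pi * \<i> * (u + of_int n * t)"
      by (simp add: algebra_simps)
    show ?thesis unfolding times_divide_eq_right 1 2
      by (simp add: lerch_term_def lerch_kernel_def lerch_pole_def)
  qed
  then have "E * (\<Sum>\<^sub>\<infinity>n. (-1) powi n * exp (pi * \<i> * (of_int n ^ 2 + of_int n) * t + 2 * pi * \<i> * (of_real \<alpha> * t + of_real \<beta>) * of_int n) /
        (1 - exp (2 * pi * \<i> * of_int n * t + 2 * pi * \<i> * u))) = lerch_sum \<alpha> \<beta> 0 UNIV u t"
    unfolding lerch_sum_def infsum_cmult_right'[symmetric] by presburger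
  then show ?thesis unfolding lerch_mu_def E_def by (simp add: mult_ac)
qed

lemma heat_operator_lerch_mu:
  assumes \<tau>: "Im \<tau> > 0" and u: "u \<notin> period_lattice \<tau>"
    and v: "vartheta (of_real \<alpha> * \<tau> + of_real \<beta>) \<tau> \<noteq> 0"
  shows "heat_operator (\<lambda>u \<tau>. exp (2 * pi * \<i> * of_real \<alpha> * u - pi * \<i> * of_real \<alpha> ^ 2 * \<tau>) * lerch_mu u (of_real \<alpha> * \<tau> + of_real \<beta>) \<tau>) u \<tau>
     = heat_numerator \<alpha> \<beta> u \<tau> / vartheta (of_real \<alpha> * \<tau> + of_real \<beta>) \<tau> ^ 2"
proof -
  define V where "V = vartheta (of_real \<alpha> * \<tau> + of_real \<beta>) \<tau>"
  have u': "u \<in> - period_lattice \<tau>" using u by simp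
  define F1 where "F1 = deriv (\<lambda>u. lerch_sum \<alpha> \<beta> 1 UNIV u \<tau>) u"
  define F0'' where "F0'' = (deriv ^^ 2) (\<lambda>u. lerch_sum \<alpha> \<beta> 0 UNIV u \<tau>) u"
  define F0 where "F0 = lerch_sum \<alpha> \<beta> 0 UNIV u \<tau>"
  define F2 where "F2 = lerch_sum \<alpha> \<beta> 2 UNIV u \<tau>"
  have V: "V \<noteq> 0" using v by (simp add: V_def)
  have 1: "((\<lambda>t. lerch_sum \<alpha> \<beta> 0 UNIV u t / vartheta (of_real \<alpha> * t + of_real \<beta>) t) has_field_derivative
     ((pi * \<i> * (F2 - of_real \<alpha> ^ 2 * F0) + F1) * V - F0 * vartheta_tau \<alpha> \<beta> \<tau>) / (V * V)) (at \<tau>)"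
    unfolding V_def F0_def F1_def F2_def
    by (rule DERIV_divide[OF lerch_sum_DERIV_tau[OF \<tau> u] vartheta_DERIV_tau[OF \<tau>] v])
  have 2: "(deriv ^^ 2) (\<lambda>w. lerch_sum \<alpha> \<beta> 0 UNIV w \<tau> / V) u = F0'' / V"
  proof -
    have "(deriv ^^ 2) (\<lambda>w. inverse V * lerch_sum \<alpha> \<beta> 0 UNIV w \<tau>) u = inverse V * F0''"
      unfolding F0''_def
      using open_vartheta_nonzero(2)[OF \<tau>]
      by (intro higher_deriv_cmult[OF lerch_sum_holomorphic[OF lerch_domain_UNIV[OF \<tau>]]] u') auto
    then show ?thesis by (simp add: field_simps)
  qed
  have "heat_operator (\<lambda>u \<tau>. exp (2 * pi * \<i> * of_real \<alpha> * u - pi * \<i> * of_real \<alpha> ^ 2 * \<tau>) * lerch_mu u (of_real \<alpha> * \<tau> + of_real \<beta>) \<tau>) u \<tau>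
      = 4 * pi * \<i> * (((pi * \<i> * (F2 - of_real \<alpha> ^ 2 * F0) + F1) * V - F0 * vartheta_tau \<alpha> \<beta> \<tau>) / (V * V)) + F0'' / V"
    unfolding heat_operator_def lerch_mu_eq_lerch_sum V_def[symmetric] 2 DERIV_imp_deriv[OF 1] ..
  also have "\<dots> = heat_numerator \<alpha> \<beta> u \<tau> / V ^ 2"
    unfolding heat_numerator_def lerch_heat_def V_def[symmetric] F0_def[symmetric] F1_def[symmetric] F2_def[symmetric] F0''_def[symmetric]
    using V by (simp add: field_simps power2_eq_square)
  finally show ?thesis unfolding V_def .
qed

section \<open>Comparison of both sides\<close>

lemma period_lattice_small:
  assumes \<tau>: "Im \<tau> > 0" and u: "u \<in> period_lattice \<tau>" "norm u < min 1 (Im \<tau>)"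
  shows "u = 0"
proof -
  obtain m n :: int where mn: "u = of_int m * \<tau> + of_int n" using u by (auto simp: period_lattice_def)
  have "\<bar>real_of_int m\<bar> * Im \<tau> = \<bar>Im u\<bar>" using \<tau> by (simp add: mn abs_mult)
  also have "\<dots> < 1 * Im \<tau>" using abs_Im_le_cmod[of u] u(2) by simp
  finally have "\<bar>real_of_int m\<bar> < 1" using \<tau> by (simp only: mult_less_cancel_right)
  then have m: "m = 0" by linarith
  then have "\<bar>real_of_int n\<bar> < 1" using abs_Re_le_cmod[of u] u(2) by (simp add: mn)
  then have "n = 0" by linarith
  with m mn show ?thesis by simp
qed

lemma period_lattice_add:
  assumes "l \<in> period_lattice \<tau>"
  shows "u + l \<in> period_lattice \<tau> \<longleftrightarrow> u \<in> period_lattice \<tau>"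
  using doubly_periodic_lattice[of "\<lambda>u. u \<in> period_lattice \<tau>" \<tau> l u] period_lattice_shift assms by blast

lemma period_lattice_reduce:
  assumes "Im \<tau> > 0"
  obtains l s t where "l \<in> period_lattice \<tau>" "s \<in> {0..1::real}" "t \<in> {0..1}" "u = of_real s + of_real t * \<tau> + l"
proof
  define t s where "t = Im u / Im \<tau>" and "s = Re u - t * Re \<tau>"
  show "of_int \<lfloor>t\<rfloor> * \<tau> + of_int \<lfloor>s\<rfloor> \<in> period_lattice \<tau>" by (auto simp: period_lattice_def)
  show "frac s \<in> {0..1}" "frac t \<in> {0..1}" by (auto simp: less_imp_le frac_lt_1)
  have "u = of_real s + of_real t * \<tau>"
    using assms by (simp add: complex_eq_iff s_def t_def)
  then show "u = of_real (frac s) + of_real (frac t) * \<tau> + (of_int \<lfloor>t\<rfloor> * \<tau> + of_int \<lfloor>s\<rfloor>)"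
    by (simp add: frac_def algebra_simps)
qed

text \<open>Regularity is given at 0 alone; the multipliers carry it to every lattice point, so the
  singularities of \<open>K\<close> are removable. Multipliers of modulus 1 make
  \<open>norm (K u)\<close> doubly periodic, hence bounded by its maximum over a period
  parallelogram. The constant \<open>c\<close> from Liouville's theorem satisfies
  \<open>c = a * c\<close> and \<open>c = b * c\<close>.\<close>

lemma elliptic_multiplier_vanishes:
  assumes \<tau>: "Im \<tau> > 0" and K: "K holomorphic_on - period_lattice \<tau>"
    and g: "g holomorphic_on ball 0 \<rho>" "\<rho> > 0"
    and Kg: "\<And>u. u \<in> ball 0 \<rho> \<Longrightarrow> u \<notin> period_lattice \<tau> \<Longrightarrow> K u = g u"
    and one: "\<And>u. u \<notin> period_lattice \<tau> \<Longrightarrow> K (u + 1) = a * K u"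
    and tau: "\<And>u. u \<notin> period_lattice \<tau> \<Longrightarrow> K (u + \<tau>) = b * K u"
    and ab: "norm a = 1" "norm b = 1" "a \<noteq> 1 \<or> b \<noteq> 1"
    and u: "u \<notin> period_lattice \<tau>"
  shows "K u = 0"
proof -
  let ?L = "period_lattice \<tau>"
  note oL = open_vartheta_nonzero(2)[OF \<tau>]
  define \<rho>' where "\<rho>' = min \<rho> (min 1 (Im \<tau>))"
  have \<rho>': "\<rho>' > 0" using g(2) \<tau> by (simp add: \<rho>'_def)
  have near: "x \<notin> ?L" if "l \<in> ?L" "x \<in> ball l \<rho>' - {l}" for x l
  proof
    assume "x \<in> ?L"
    then have "x - l \<in> ?L" using period_lattice_add[OF that(1), of "x - l"] by simp
    moreover have "norm (x - l) < min 1 (Im \<tau>)" using that(2) by (auto simp: \<rho>'_def dist_norm norm_minus_commute)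
    ultimately show False using period_lattice_small[OF \<tau>, of "x - l"] that(2) by simp
  qed
  have a0: "a \<noteq> 0" "b \<noteq> 0" using ab by auto
  \<comment> \<open>The multiplier of \<open>l\<close> need not be computed: its mere existence is a
    predicate of \<open>l\<close> invariant under adding a period, so
    \<open>doubly_periodic_lattice\<close> applies to it.\<close>
  have mult: "\<exists>e. \<forall>w. w \<notin> ?L \<longrightarrow> K (w + l) = e * K w" if l: "l \<in> ?L" for l
  proof -
    let ?P = "\<lambda>l. \<exists>e. \<forall>w. w \<notin> ?L \<longrightarrow> K (w + l) = e * K w"
    have step: "?P (l + p) = ?P l" if p: "\<And>w. w + p \<in> ?L \<longleftrightarrow> w \<in> ?L" "\<And>w. w \<notin> ?L \<Longrightarrow> K (w + p) = c * K w" "c \<noteq> 0" for l p c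
    proof
      assume "?P (l + p)"
      then obtain e where e: "\<And>w. w \<notin> ?L \<Longrightarrow> K (w + (l + p)) = e * K w" by blast
      have "K (w + l) = (e / c) * K w" if w: "w \<notin> ?L" for w
      proof -
        have w': "w - p \<notin> ?L" using p(1)[of "w - p"] w by simp
        show ?thesis using e[OF w'] p(2)[OF w'] p(3) by (simp add: algebra_simps)
      qed
      then show "?P l" by blast
    next
      assume "?P l"
      then obtain e where e: "\<And>w. w \<notin> ?L \<Longrightarrow> K (w + l) = e * K w" by blast
      have "K (w + (l + p)) = (e * c) * K w" if w: "w \<notin> ?L" for w
        using e[of "w + p"] p(1)[of w] p(2)[OF w] w by (simp add: algebra_simps)
      then show "?P (l + p)" by blast
    qed
    have "?P (0 + l) = ?P 0"
      by (rule doubly_periodic_lattice[of ?P \<tau>, OF _ _ l])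
         (rule step[OF period_lattice_shift(1) one a0(1)] step[OF period_lattice_shift(2) tau a0(2)]; assumption)+
    moreover have "?P 0" by (intro exI[of _ 1]) simp
    ultimately show ?thesis by simp
  qed
  define G where "G = remove_sings K"
  have Kan: "K analytic_on - ?L" using K oL by (simp add: analytic_on_open)
  have GK: "G w = K w" if "w \<notin> ?L" for w
    unfolding G_def using that by (intro remove_sings_at_analytic analytic_on_subset[OF Kan]) auto
  have Gan: "G analytic_on {z}" for z
  proof (cases "z \<in> ?L")
    case False
    then show ?thesis unfolding G_def
      by (intro remove_sings_analytic_on analytic_on_subset[OF Kan]) auto
  next
    case True
    obtain e where e: "\<And>w. w \<notin> ?L \<Longrightarrow> K (w + z) = e * K w" using mult[OF True] by blast
    have eq: "K x = e * g (x - z)" if x: "x \<in> ball z \<rho>' - {z}" for x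
    proof -
      have "x - z \<notin> ?L" using near[OF True x] period_lattice_add[OF True, of "x - z"] by simp
      moreover have "x - z \<in> ball 0 \<rho>" using x by (auto simp: \<rho>'_def dist_norm norm_minus_commute)
      ultimately show ?thesis using e[of "x - z"] Kg[of "x - z"] by simp
    qed
    have "isCont g 0" using g by (metis centre_in_ball continuous_on_eq_continuous_at holomorphic_on_imp_continuous_on open_ball)
    then have "(\<lambda>x. e * g (x - z)) \<midarrow>z\<rightarrow> e * g (z - z)"
      by (intro tendsto_mult tendsto_const isCont_tendsto_compose[of _ g] tendsto_diff tendsto_ident_at) simp
    then have lim: "K \<midarrow>z\<rightarrow> e * g 0"
      unfolding diff_self
    proof (rule Lim_transform_eventually)
      have "eventually (\<lambda>x. x \<in> ball z \<rho>' - {z}) (at z)"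
        using \<rho>' by (intro eventually_at_in_open) auto
      then show "eventually (\<lambda>x. e * g (x - z) = K x) (at z)"
        by eventually_elim (simp add: eq)
    qed
    have "isolated_singularity_at K z"
      unfolding isolated_singularity_at_def using near[OF True] \<rho>'
      by (intro exI[of _ \<rho>'] conjI analytic_on_subset[OF Kan]) auto
    then show ?thesis unfolding G_def using lim by (rule remove_sings_analytic_at)
  qed
  have Ghol: "G holomorphic_on UNIV"
    using Gan by (meson analytic_imp_holomorphic analytic_on_analytic_at)
  have "compact ((\<lambda>p. of_real (fst p) + of_real (snd p) * \<tau>) ` ({0..1::real} \<times> {0..1::real}))"
    by (intro compact_continuous_image compact_Times compact_Icc continuous_intros)
  then have "compact (G ` (\<lambda>p. of_real (fst p) + of_real (snd p) * \<tau>) ` ({0..1::real} \<times> {0..1::real}))"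
    by (rule compact_continuous_image[OF continuous_on_subset[OF holomorphic_on_imp_continuous_on[OF Ghol]], rotated]) auto
  then obtain C where C: "\<And>s t. s \<in> {0..1::real} \<Longrightarrow> t \<in> {0..1::real} \<Longrightarrow> norm (G (of_real s + of_real t * \<tau>)) \<le> C"
    by (force dest!: compact_imp_bounded simp: bounded_iff)
  have bd: "norm (G w) \<le> C" if w: "w \<notin> ?L" for w
  proof -
    obtain l s t where l: "l \<in> ?L" and st: "s \<in> {0..1::real}" "t \<in> {0..1::real}" and w_eq: "w = of_real s + of_real t * \<tau> + l"
      using period_lattice_reduce[OF \<tau>] by blast
    \<comment> \<open>Setting the value to 0 on the lattice yields a function that is periodic at
      every point.\<close>
    let ?P = "\<lambda>w. if w \<in> ?L then 0 else norm (K w)"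
    have "?P (of_real s + of_real t * \<tau> + l) = ?P (of_real s + of_real t * \<tau>)"
      by (rule doubly_periodic_lattice[OF _ _ l]) (simp_all add: period_lattice_shift one tau ab norm_mult)
    moreover have "of_real s + of_real t * \<tau> \<notin> ?L"
      using w period_lattice_add[OF l, of "of_real s + of_real t * \<tau>"] w_eq by simp
    ultimately show ?thesis using w C[OF st] by (simp add: GK w_eq[symmetric])
  qed
  have bd': "norm (G w) \<le> C" for w
  proof (cases "w \<in> ?L")
    case True
    have "isCont G w" using Gan by (simp add: analytic_at_imp_isCont)
    then have lim: "((\<lambda>x. norm (G x)) \<longlongrightarrow> norm (G w)) (at w)" by (intro tendsto_norm) (simp add: isCont_def)
    have "eventually (\<lambda>x. x \<in> ball w \<rho>' - {w}) (at w)"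
      using \<rho>' by (intro eventually_at_in_open) auto
    then have "eventually (\<lambda>x. norm (G x) \<le> C) (at w)"
      by eventually_elim (rule bd[OF near[OF True]])
    then show ?thesis using lim by (intro tendsto_upperbound[of "\<lambda>x. norm (G x)"]) auto
  qed (rule bd)
  then have "G constant_on UNIV"
    by (intro Liouville_theorem[OF Ghol]) (auto simp: bounded_iff)
  then obtain c where c: "\<And>w. G w = c" by (auto simp: constant_on_def)
  have "c = a * c" "c = b * c"
    using one[OF u] tau[OF u] GK[OF u] GK[of "u + 1"] GK[of "u + \<tau>"] u by (simp_all add: period_lattice_shift c)
  then have "c = 0" using ab(3) by auto
  then show ?thesis using GK[OF u] c by simp
qed

section \<open>Local comparison at \<open>u = 0\<close>\<close>

text \<open>The witness is the difference quotient as a total function, so the factorisation holds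
  for every \<open>u\<close>, also outside the ball.\<close>

lemma holomorphic_factor_out_zero:
  assumes f: "f holomorphic_on ball 0 r" and f0: "f 0 = 0"
  obtains g where "g holomorphic_on ball 0 r" "g 0 = deriv f 0" "\<And>u. f u = u * g u"
proof
  show "(\<lambda>z. if z = 0 then deriv f 0 else (f z - f 0) / (z - 0)) holomorphic_on ball 0 r"
    by (rule pole_lemma_open[OF f open_ball])
qed (use f0 in auto)

text \<open>The pole is simple with residue -1/(2 pi i) = i/(2 pi). Differentiating
  \<open>1 / w\<close> twice doubles the constant and creates only a cubic term, so the principal
  part of \<open>lerch_kernel''\<close> has no other term.\<close>

lemma lerch_kernel_expansion:
  obtains h where "h holomorphic_on ball 0 1"
    "\<And>w. w \<in> ball 0 1 - {0} \<Longrightarrow> lerch_kernel a w = (\<i> / (2 * pi)) / w + h w"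
    "\<And>w. w \<in> ball 0 1 - {0} \<Longrightarrow> lerch_kernel'' a w = (\<i> / pi) / w ^ 3 + deriv (deriv h) w"
proof -
  have "(\<lambda>w. 1 - exp (2 * pi * \<i> * w)) holomorphic_on ball 0 1" by (intro holomorphic_intros)
  then obtain e where e: "e holomorphic_on ball 0 1" "e 0 = deriv (\<lambda>w. 1 - exp (2 * pi * \<i> * w)) 0"
    "\<And>w. 1 - exp (2 * pi * \<i> * w) = w * e w"
    by (rule holomorphic_factor_out_zero) auto
  have "((\<lambda>w. 1 - exp (2 * pi * \<i> * w)) has_field_derivative - (2 * pi * \<i>)) (at 0)"
    by (rule derivative_eq_intros refl | simp)+
  then have e0: "e 0 = - (2 * pi * \<i>)" unfolding e(2) by (rule DERIV_imp_deriv)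
  have ne: "exp (2 * pi * \<i> * w) \<noteq> 1" if w: "w \<in> ball 0 1 - {0}" for w
  proof
    assume "exp (2 * pi * \<i> * w) = 1"
    then obtain n :: int where n: "w = of_int n" by (rule exp_2pi_eq_1_imp_int)
    with w have "\<bar>of_int n :: real\<bar> < 1" by (simp add: dist_norm)
    then show False using w n by simp
  qed
  have enz: "e w \<noteq> 0" if "w \<in> ball 0 1" for w
  proof (cases "w = 0")
    case False
    then show ?thesis using ne[of w] e(3)[of w] that by auto
  qed (simp add: e0)
  define q where "q w = exp (2 * pi * \<i> * a * w) / e w" for w
  have "(\<lambda>w. q w - q 0) holomorphic_on ball 0 1"
    unfolding q_def using enz by (intro holomorphic_intros e) auto
  then obtain h where h: "h holomorphic_on ball 0 1" "\<And>w. q w - q 0 = w * h w"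
    by (rule holomorphic_factor_out_zero) auto
  have q0: "q 0 = \<i> / (2 * pi)" by (simp add: q_def e0 field_simps)
  have k: "lerch_kernel a w = (\<i> / (2 * pi)) / w + h w" if w: "w \<in> ball 0 1 - {0}" for w
  proof -
    have "lerch_kernel a w = q w / w"
      unfolding lerch_kernel_def lerch_pole_def e(3) q_def by simp
    also have "q w = q 0 + w * h w" using h(2)[of w] by (simp add: algebra_simps)
    finally show ?thesis using w by (simp add: q0 add_divide_distrib)
  qed
  have op: "open (ball 0 1 - {0} :: complex set)" by auto
  have k': "lerch_kernel' a w = - (\<i> / (2 * pi)) / w ^ 2 + deriv h w" if w: "w \<in> ball 0 1 - {0}" for w
  proof -
    have "(h has_field_derivative deriv h w) (at w)"
      using w by (intro holomorphic_derivI[OF h(1)]) auto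
    then have "((\<lambda>w. (\<i> / (2 * pi)) / w + h w) has_field_derivative - (\<i> / (2 * pi)) / w ^ 2 + deriv h w) (at w)"
      using w by (auto intro!: derivative_eq_intros simp: power2_eq_square)
    then have "(lerch_kernel a has_field_derivative - (\<i> / (2 * pi)) / w ^ 2 + deriv h w) (at w)"
      by (rule has_field_derivative_transform_within_open[OF _ op w]) (simp add: k)
    with lerch_kernel_DERIV(1)[OF ne[OF w]] show ?thesis by (rule DERIV_unique)
  qed
  have k'': "lerch_kernel'' a w = (\<i> / pi) / w ^ 3 + deriv (deriv h) w" if w: "w \<in> ball 0 1 - {0}" for w
  proof -
    have "(deriv h has_field_derivative deriv (deriv h) w) (at w)"
      using w by (intro holomorphic_derivI[OF holomorphic_deriv[OF h(1)]]) auto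
    then have "((\<lambda>w. - (\<i> / (2 * pi)) / w ^ 2 + deriv h w) has_field_derivative (\<i> / pi) / w ^ 3 + deriv (deriv h) w) (at w)"
      using w by (auto intro!: derivative_eq_intros simp: field_simps power2_eq_square power3_eq_cube)
    then have "(lerch_kernel' a has_field_derivative (\<i> / pi) / w ^ 3 + deriv (deriv h) w) (at w)"
      by (rule has_field_derivative_transform_within_open[OF _ op w]) (simp add: k')
    with lerch_kernel_DERIV(2)[OF ne[OF w]] show ?thesis by (rule DERIV_unique)
  qed
  show ?thesis using that[OF h(1) k k''] by blast
qed

lemma vartheta_DERIV:
  assumes "Im \<tau> > 0"
  shows "((\<lambda>u. vartheta u \<tau>) has_field_derivative 2 * pi * \<i> * theta 1 (1/2) (u + 1/2) \<tau>) (at u)"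
  unfolding vartheta_eq_theta
  by (rule derivative_eq_intros assms refl)+ simp

lemma theta_half_deriv_nonzero: "Im \<tau> > 0 \<Longrightarrow> theta 1 (1/2) (1/2) \<tau> \<noteq> 0"
  using q_poch_tendsto(2)[of "2 * pi * \<i> * \<tau>"]
  by (simp add: dedekind_eta_cube[unfolded One_nat_def] dedekind_eta_def)

text \<open>The exponent 2 pi i n^2 \<tau> belongs to the modulus \<open>2 * \<tau>\<close>;
  splitting the weight \<open>n + \<alpha> / 2\<close> gives a derivative and a value of one theta
  function at \<open>v\<close>.\<close>

lemma coeff_a_eq_theta:
  assumes "Im \<tau> > 0"
  shows "coeff_a0 \<alpha> \<beta> \<tau> = theta 1 0 (of_real \<alpha> * \<tau> + of_real \<beta>) (2 * \<tau>) + of_real \<alpha> / 2 * theta 0 0 (of_real \<alpha> * \<tau> + of_real \<beta>) (2 * \<tau>)"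
    and "coeff_a1 \<alpha> \<beta> \<tau> = theta 1 (1/2) (of_real \<alpha> * \<tau> + of_real \<beta>) (2 * \<tau>) + of_real \<alpha> / 2 * theta 0 (1/2) (of_real \<alpha> * \<tau> + of_real \<beta>) (2 * \<tau>)"
proof -
  define v where "v = of_real \<alpha> * \<tau> + of_real \<beta>"
  have s: "((\<lambda>n. theta_term 1 a n v (2 * \<tau>) + of_real \<alpha> / 2 * theta_term 0 a n v (2 * \<tau>)) has_sum
      theta 1 a v (2 * \<tau>) + of_real \<alpha> / 2 * theta 0 a v (2 * \<tau>)) UNIV" for a
    using assms by (intro has_sum_add has_sum_cmult_right theta_term_has_sum) auto
  show "coeff_a0 \<alpha> \<beta> \<tau> = theta 1 0 v (2 * \<tau>) + of_real \<alpha> / 2 * theta 0 0 v (2 * \<tau>)"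
    unfolding coeff_a0_def v_def[symmetric]
    by (rule infsumI, rule has_sum_cong[THEN iffD1, OF _ s]) (simp add: theta_term_def algebra_simps)
  show "coeff_a1 \<alpha> \<beta> \<tau> = theta 1 (1/2) v (2 * \<tau>) + of_real \<alpha> / 2 * theta 0 (1/2) v (2 * \<tau>)"
    unfolding coeff_a1_def v_def[symmetric]
    by (rule infsumI, rule has_sum_cong[THEN iffD1, OF _ s]) (simp add: theta_term_def algebra_simps)
qed

text \<open>The right-hand side times \<open>\<vartheta>(v)\<^sup>2\<close>, with \<open>\<eta>\<^sup>6\<close> expressed through \<open>\<vartheta>'(0)\<close>.\<close>

definition heat_rhs :: "real \<Rightarrow> real \<Rightarrow> complex \<Rightarrow> complex \<Rightarrow> complex" where
  "heat_rhs \<alpha> \<beta> u \<tau> = exp (2 * pi * \<i> * of_real \<alpha> * u - pi * \<i> * of_real \<alpha> ^ 2 * \<tau>) *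
     (- 16 * pi ^ 2 * theta 1 (1/2) (1/2) \<tau> ^ 2) *
     (coeff_a1 \<alpha> \<beta> \<tau> * theta 0 0 (2 * u + (of_real \<alpha> * \<tau> + of_real \<beta>)) (2 * \<tau>)
      - coeff_a0 \<alpha> \<beta> \<tau> * theta 0 (1/2) (2 * u + (of_real \<alpha> * \<tau> + of_real \<beta>)) (2 * \<tau>))"

lemma heat_rhs_shift_one:
  "heat_rhs \<alpha> \<beta> (u + 1) \<tau> = exp (2 * pi * \<i> * of_real \<alpha>) * heat_rhs \<alpha> \<beta> u \<tau>"
proof -
  define v where "v = of_real \<alpha> * \<tau> + of_real \<beta>"
  have t: "theta 0 a (2 * (u + 1) + v) (2 * \<tau>) = theta 0 a (2 * u + v) (2 * \<tau>)" if "a = 0 \<or> a = 1/2" for a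
  proof -
    have "2 * (u + 1) + v = 2 * u + v + 1 + 1" by simp
    then have "theta 0 a (2 * (u + 1) + v) (2 * \<tau>) = exp (2 * pi * \<i> * a) * (exp (2 * pi * \<i> * a) * theta 0 a (2 * u + v) (2 * \<tau>))"
      by (simp only: theta_shift_one)
    moreover have "exp (2 * pi * \<i> * a) * exp (2 * pi * \<i> * a) = 1"
      using that by (elim disjE) (hypsubst, simp)+
    ultimately show ?thesis by (simp add: mult.assoc[symmetric])
  qed
  have e: "exp (2 * pi * \<i> * of_real \<alpha> * (u + 1) - pi * \<i> * of_real \<alpha> ^ 2 * \<tau>) =
      exp (2 * pi * \<i> * of_real \<alpha>) * exp (2 * pi * \<i> * of_real \<alpha> * u - pi * \<i> * of_real \<alpha> ^ 2 * \<tau>)"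
    unfolding mult_exp_exp by (intro arg_cong[of _ _ exp]) (simp add: algebra_simps)
  show ?thesis unfolding heat_rhs_def v_def[symmetric] e using t[of 0] t[of "1/2"] by simp
qed

lemma heat_rhs_shift_tau:
  "heat_rhs \<alpha> \<beta> (u + \<tau>) \<tau> = exp (- 2 * pi * \<i> * of_real \<beta> - 2 * pi * \<i> * \<tau> - 4 * pi * \<i> * u) * heat_rhs \<alpha> \<beta> u \<tau>"
proof -
  define v where "v = of_real \<alpha> * \<tau> + of_real \<beta>"
  define m where "m = exp (- pi * \<i> * (2 * \<tau>) - 2 * pi * \<i> * (2 * u + v))"
  have t: "theta 0 a (2 * (u + \<tau>) + v) (2 * \<tau>) = m * theta 0 a (2 * u + v) (2 * \<tau>)" for a
  proof -
    have "2 * (u + \<tau>) + v = 2 * u + v + 2 * \<tau>" by simp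
    then show ?thesis by (simp only: theta_shift_tau m_def)
  qed
  have e: "exp (2 * pi * \<i> * of_real \<alpha> * (u + \<tau>) - pi * \<i> * of_real \<alpha> ^ 2 * \<tau>) * m =
      exp (- 2 * pi * \<i> * of_real \<beta> - 2 * pi * \<i> * \<tau> - 4 * pi * \<i> * u) * exp (2 * pi * \<i> * of_real \<alpha> * u - pi * \<i> * of_real \<alpha> ^ 2 * \<tau>)"
    unfolding mult_exp_exp m_def v_def by (intro arg_cong[of _ _ exp]) (simp add: algebra_simps)
  have "heat_rhs \<alpha> \<beta> (u + \<tau>) \<tau> = (exp (2 * pi * \<i> * of_real \<alpha> * (u + \<tau>) - pi * \<i> * of_real \<alpha> ^ 2 * \<tau>) * m) *
     (- 16 * pi ^ 2 * theta 1 (1/2) (1/2) \<tau> ^ 2) *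
     (coeff_a1 \<alpha> \<beta> \<tau> * theta 0 0 (2 * u + v) (2 * \<tau>) - coeff_a0 \<alpha> \<beta> \<tau> * theta 0 (1/2) (2 * u + v) (2 * \<tau>))"
    unfolding heat_rhs_def v_def[symmetric] t by (simp add: algebra_simps)
  then show ?thesis unfolding e by (simp add: heat_rhs_def v_def mult.assoc)
qed

lemma heat_rhs_at_0:
  assumes \<tau>: "Im \<tau> > 0"
  shows "heat_rhs \<alpha> \<beta> 0 \<tau> = 8 * pi ^ 2 * exp (- pi * \<i> * of_real \<alpha> ^ 2 * \<tau>) * theta 1 (1/2) (1/2) \<tau> ^ 3 * vartheta (of_real \<alpha> * \<tau> + of_real \<beta>) \<tau>"
    and "((\<lambda>u. heat_rhs \<alpha> \<beta> u \<tau>) has_field_derivative 0) (at 0)"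
    and "(\<lambda>u. heat_rhs \<alpha> \<beta> u \<tau>) holomorphic_on S"
proof -
  have \<tau>2: "Im (2 * \<tau>) > 0" using \<tau> by simp
  define v where "v = of_real \<alpha> * \<tau> + of_real \<beta>"
  define t0 t0' t1 t1' where "t0 = theta 0 0 v (2 * \<tau>)" and "t0' = theta 1 0 v (2 * \<tau>)"
    and "t1 = theta 0 (1/2) v (2 * \<tau>)" and "t1' = theta 1 (1/2) v (2 * \<tau>)"
  have a: "coeff_a0 \<alpha> \<beta> \<tau> = t0' + of_real \<alpha> / 2 * t0" "coeff_a1 \<alpha> \<beta> \<tau> = t1' + of_real \<alpha> / 2 * t1"
    unfolding t0_def t0'_def t1_def t1'_def v_def by (rule coeff_a_eq_theta[OF \<tau>])+
  have W: "t1' * t0 - t0' * t1 = - (1/2) * theta 1 (1/2) (1/2) \<tau> * vartheta v \<tau>"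
    unfolding t0_def t0'_def t1_def t1'_def by (rule theta_wronskian[OF \<tau>])
  \<comment> \<open>The contributions with \<alpha> are symmetric in the two functions and cancel,
    which leaves the Wronskian.\<close>
  have "coeff_a1 \<alpha> \<beta> \<tau> * t0 - coeff_a0 \<alpha> \<beta> \<tau> * t1 = t1' * t0 - t0' * t1"
    unfolding a by (simp add: algebra_simps del: One_nat_def)
  then show "heat_rhs \<alpha> \<beta> 0 \<tau> = 8 * pi ^ 2 * exp (- pi * \<i> * of_real \<alpha> ^ 2 * \<tau>) * theta 1 (1/2) (1/2) \<tau> ^ 3 * vartheta (of_real \<alpha> * \<tau> + of_real \<beta>) \<tau>"
    unfolding heat_rhs_def v_def[symmetric] using W
    by (simp add: t0_def t1_def power2_eq_square power3_eq_cube)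
  have D: "((\<lambda>u. heat_rhs \<alpha> \<beta> u \<tau>) has_field_derivative
     2 * pi * \<i> * exp (2 * pi * \<i> * of_real \<alpha> * u - pi * \<i> * of_real \<alpha> ^ 2 * \<tau>) *
     (- 16 * pi ^ 2 * theta 1 (1/2) (1/2) \<tau> ^ 2) *
     (of_real \<alpha> * (coeff_a1 \<alpha> \<beta> \<tau> * theta 0 0 (2 * u + v) (2 * \<tau>) - coeff_a0 \<alpha> \<beta> \<tau> * theta 0 (1/2) (2 * u + v) (2 * \<tau>))
     + 2 * (coeff_a1 \<alpha> \<beta> \<tau> * theta 1 0 (2 * u + v) (2 * \<tau>) - coeff_a0 \<alpha> \<beta> \<tau> * theta 1 (1/2) (2 * u + v) (2 * \<tau>)))) (at u)" for u
    unfolding heat_rhs_def v_def[symmetric]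
    by (rule derivative_eq_intros \<tau>2 refl)+ (simp add: algebra_simps)
  \<comment> \<open>Since \<open>\<alpha> * t0 + 2 * t0'\<close> is twice \<open>coeff_a0\<close>
    and \<open>\<alpha> * t1 + 2 * t1'\<close> twice \<open>coeff_a1\<close>, the expression is 2
    (a1 a0 - a0 a1).\<close>
  have "of_real \<alpha> * (coeff_a1 \<alpha> \<beta> \<tau> * t0 - coeff_a0 \<alpha> \<beta> \<tau> * t1) + 2 * (coeff_a1 \<alpha> \<beta> \<tau> * t0' - coeff_a0 \<alpha> \<beta> \<tau> * t1') = 0"
    unfolding a by (simp add: algebra_simps)
  then show "((\<lambda>u. heat_rhs \<alpha> \<beta> u \<tau>) has_field_derivative 0) (at 0)"
    using D[of 0] by (simp add: t0_def t0'_def t1_def t1'_def)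
  show "(\<lambda>u. heat_rhs \<alpha> \<beta> u \<tau>) holomorphic_on S"
    using D by (auto simp: holomorphic_on_def field_differentiable_def intro: has_field_derivative_at_within)
qed

text \<open>At \<open>u = 0\<close> the principal part of \<open>heat_numerator\<close> has a cubic and a simple term but no quadratic one, and
  \<open>\<vartheta>(u)/u\<close> is even. So \<open>\<vartheta>\<^sup>3 heat_numerator\<close> and \<open>heat_rhs\<close> agree to second order.\<close>

lemma heat_numerator_near_0:
  fixes \<alpha> \<beta> :: real and \<tau> :: complex
  assumes \<tau>: "Im \<tau> > 0"
  defines "\<rho> \<equiv> min 1 (Im \<tau>)"
  obtains g where "g holomorphic_on ball 0 \<rho>"
    "\<And>u. u \<in> ball 0 \<rho> \<Longrightarrow> u \<notin> period_lattice \<tau> \<Longrightarrow>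
       vartheta u \<tau> * heat_numerator \<alpha> \<beta> u \<tau> - heat_rhs \<alpha> \<beta> u \<tau> / vartheta u \<tau> ^ 2 = g u"
proof -
  define V where "V = vartheta (of_real \<alpha> * \<tau> + of_real \<beta>) \<tau>"
  define c0 where "c0 = exp (- pi * \<i> * of_real \<alpha> ^ 2 * \<tau>)"
  define \<theta> where "\<theta> = theta 1 (1/2) (1/2) \<tau>"
  have \<rho>: "\<rho> > 0" using \<tau> by (simp add: \<rho>_def)
  have b1: "ball 0 \<rho> \<subseteq> ball 0 (1::real)" "ball 0 \<rho> \<subseteq> ball (0::complex) 1" by (auto simp: \<rho>_def)
  have bI: "ball 0 \<rho> \<subseteq> {u. \<bar>Im u\<bar> < Im \<tau>}"
  proof
    fix u :: complex assume "u \<in> ball 0 \<rho>"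
    then show "u \<in> {u. \<bar>Im u\<bar> < Im \<tau>}" using abs_Im_le_cmod[of u] by (simp add: \<rho>_def)
  qed
  have hol_th: "(\<lambda>u. vartheta u \<tau>) holomorphic_on S" for S
    using vartheta_DERIV[OF \<tau>] by (auto simp: holomorphic_on_def field_differentiable_def intro: has_field_derivative_at_within)
  have th0: "vartheta 0 \<tau> = 0" using vartheta_uminus[of 0 \<tau>] by simp
  obtain t where t: "t holomorphic_on ball 0 \<rho>" "t 0 = deriv (\<lambda>u. vartheta u \<tau>) 0" "\<And>u. vartheta u \<tau> = u * t u"
    using holomorphic_factor_out_zero[OF hol_th th0] by blast
  have t0: "t 0 = 2 * pi * \<i> * \<theta>"
    using DERIV_imp_deriv[OF vartheta_DERIV[OF \<tau>, of 0]] by (simp add: t(2) \<theta>_def)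
  have tnz: "t u \<noteq> 0" if u: "u \<in> ball 0 \<rho>" for u
  proof (cases "u = 0")
    case True
    then show ?thesis using theta_half_deriv_nonzero[OF \<tau>] by (simp add: t0 \<theta>_def)
  next
    case False
    then have "u \<notin> period_lattice \<tau>" using period_lattice_small[OF \<tau>, of u] u by (auto simp: \<rho>_def)
    then show ?thesis using vartheta_nonzero[OF \<tau>, of u] t(3)[of u] by auto
  qed
  have teven: "t (- u) = t u" for u
    using vartheta_uminus[of u \<tau>] t(3)[of u] t(3)[of "- u"] by (cases "u = 0") auto
  have tD: "(t has_field_derivative 0) (at 0)"
  proof -
    have D: "(t has_field_derivative deriv t 0) (at 0)"
      using \<rho> by (intro holomorphic_derivI[OF t(1)]) auto
    have m: "(uminus has_field_derivative - 1) (at (0::complex))" by (auto intro!: derivative_eq_intros)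
    have "((\<lambda>u. t (- u)) has_field_derivative deriv t 0 * (- 1)) (at 0)"
      by (rule DERIV_chain'[OF m]) (use D in simp)
    then have "deriv t 0 = deriv t 0 * (- 1)" unfolding teven by (rule DERIV_unique[OF D])
    then show ?thesis using D by simp
  qed
  \<comment> \<open>Numerator of the cubic part of the difference, with
    \<open>vartheta u \<tau> = u * t u\<close>. A double zero at 0 is wanted, since division by
    \<open>vartheta u \<tau> ^ 2\<close> costs \<open>u ^ 2\<close>.\<close>
  define N where "N u = (\<i> / pi) * c0 * V * t u ^ 3 - heat_rhs \<alpha> \<beta> u \<tau>" for u
  have Nhol: "N holomorphic_on ball 0 \<rho>"
    unfolding N_def by (intro holomorphic_intros t heat_rhs_at_0(3)[OF \<tau>])
  have N0: "N 0 = 0"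
  proof -
    \<comment> \<open>Here the constants meet: (i / pi) (2 pi i \<theta>)^3 = 8 pi^2 \<theta>^3, the
      factor that the Wronskian gives in \<open>heat_rhs_at_0\<close>.\<close>
    have "(2 * pi * \<i> * \<theta>) ^ 3 = - 8 * pi ^ 3 * \<i> * \<theta> ^ 3"
      by (simp add: power_mult_distrib power3_eq_cube[of \<i>])
    then have "(\<i> / pi) * c0 * V * t 0 ^ 3 = 8 * pi ^ 2 * c0 * \<theta> ^ 3 * V"
      unfolding t0 by (simp add: power2_eq_square power3_eq_cube[of "complex_of_real pi"])
    then show ?thesis
      unfolding N_def heat_rhs_at_0(1)[OF \<tau>] by (simp only: c0_def V_def \<theta>_def diff_self)
  qed
  have "(N has_field_derivative (\<i> / pi) * c0 * V * (3 * t 0 ^ 2 * 0) - 0) (at 0)"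
    unfolding N_def by (rule derivative_eq_intros tD heat_rhs_at_0(2)[OF \<tau>] refl)+ simp
  then have N0': "deriv N 0 = 0" by (intro DERIV_imp_deriv) simp
  obtain N1 where N1: "N1 holomorphic_on ball 0 \<rho>" "N1 0 = deriv N 0" "\<And>u. N u = u * N1 u"
    using holomorphic_factor_out_zero[OF Nhol N0] by blast
  obtain M where M: "M holomorphic_on ball 0 \<rho>" "M 0 = deriv N1 0" "\<And>u. N1 u = u * M u"
    using holomorphic_factor_out_zero[OF N1(1)] N1(2) N0' by auto
  obtain h where h: "h holomorphic_on ball 0 1"
    "\<And>w. w \<in> ball 0 1 - {0} \<Longrightarrow> lerch_kernel (of_real \<alpha> + 1/2) w = (\<i> / (2 * pi)) / w + h w"
    "\<And>w. w \<in> ball 0 1 - {0} \<Longrightarrow> lerch_kernel'' (of_real \<alpha> + 1/2) w = (\<i> / pi) / w ^ 3 + deriv (deriv h) w"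
    by (rule lerch_kernel_expansion[of "of_real \<alpha> + 1/2"]) (rule that)
  \<comment> \<open>The total coefficient of the undifferentiated kernel for \<open>n = 0\<close>,
    from the \<alpha>-term of \<open>lerch_heat_term\<close> and from
    \<open>vartheta_tau\<close>.\<close>
  define A where "A = 4 * pi ^ 2 * of_real \<alpha> ^ 2 * V - 4 * pi * \<i> * vartheta_tau \<alpha> \<beta> \<tau>"
  define H where "H u = c0 * (V * deriv (deriv h) u + A * h u) + V * lerch_heat \<alpha> \<beta> (- {0}) u \<tau>
     - 4 * pi * \<i> * vartheta_tau \<alpha> \<beta> \<tau> * lerch_sum \<alpha> \<beta> 0 (- {0}) u \<tau>" for u
  have Hhol: "H holomorphic_on ball 0 \<rho>"
    unfolding H_def
    by (intro holomorphic_intros holomorphic_deriv holomorphic_on_subset[OF h(1) b1(2)] open_ball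
        holomorphic_on_subset[OF lerch_heat_holomorphic[OF lerch_domain_nonzero[OF \<tau>]] bI]
        holomorphic_on_subset[OF lerch_sum_holomorphic[OF lerch_domain_nonzero[OF \<tau>]] bI])
  \<comment> \<open>Three contributions: the cubic pole against \<open>heat_rhs\<close> leaves
    \<open>M u / t u ^ 2\<close>; the simple pole is cancelled by the zero of
    \<open>vartheta\<close>; the rest is holomorphic.\<close>
  define g where "g u = M u / t u ^ 2 + t u * (c0 * A * (\<i> / (2 * pi))) + u * t u * H u" for u
  show ?thesis
  proof
    show "g holomorphic_on ball 0 \<rho>"
      unfolding g_def by (intro holomorphic_intros t M Hhol) (use tnz in auto)
    fix u assume u: "u \<in> ball 0 \<rho>" "u \<notin> period_lattice \<tau>"
    have unz: "u \<noteq> 0" using u(2) vartheta_nonzero[OF \<tau> u(2)] th0 by auto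
    have u1: "u \<in> ball 0 1 - {0}" using u(1) b1(2) unz by auto
    have Im: "\<bar>Im u\<bar> < Im \<tau>" using bI u(1) by auto
    have c: "lerch_coeff \<alpha> \<beta> 0 \<tau> = c0" by (simp add: lerch_coeff_def c0_def)
    have B: "heat_numerator \<alpha> \<beta> u \<tau> = c0 * V * (\<i> / pi) / u ^ 3 + c0 * A * (\<i> / (2 * pi)) / u + H u"
    proof -
      define k0 k2 where "k0 = (\<i> / (2 * pi)) / u" and "k2 = (\<i> / pi) / u ^ 3"
      have "heat_numerator \<alpha> \<beta> u \<tau> = c0 * V * k2 + c0 * A * k0 + H u"
        unfolding heat_numerator_def V_def[symmetric] lerch_split_zero[OF \<tau> u(2) Im]
          lerch_heat_term_def lerch_term_def c H_def A_def
        by (simp add: h(2)[OF u1, folded k0_def] h(3)[OF u1, folded k2_def] algebra_simps)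
      then show ?thesis by (simp add: k0_def k2_def)
    qed
    have R: "heat_rhs \<alpha> \<beta> u \<tau> = (\<i> / pi) * c0 * V * t u ^ 3 - u * (u * M u)"
      using N1(3)[of u] M(3)[of u] by (simp add: N_def algebra_simps)
    show "vartheta u \<tau> * heat_numerator \<alpha> \<beta> u \<tau> - heat_rhs \<alpha> \<beta> u \<tau> / vartheta u \<tau> ^ 2 = g u"
    proof -
      define X where "X = c0 * V * (\<i> / pi)"
      define Y where "Y = c0 * A * (\<i> / (2 * pi))"
      have R': "heat_rhs \<alpha> \<beta> u \<tau> = X * t u ^ 3 - u * (u * M u)" unfolding R X_def by (simp add: mult_ac)
      show ?thesis
        unfolding B R' t(3)[of u] g_def X_def[symmetric] Y_def[symmetric]
        using unz tnz[OF u(1)] by (simp add: field_simps power2_eq_square power3_eq_cube)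
    qed
  qed
qed

lemma heat_identity:
  assumes \<tau>: "Im \<tau> > 0" and u: "u \<notin> period_lattice \<tau>"
    and v: "vartheta (of_real \<alpha> * \<tau> + of_real \<beta>) \<tau> \<noteq> 0"
  shows "vartheta u \<tau> ^ 3 * heat_numerator \<alpha> \<beta> u \<tau> = heat_rhs \<alpha> \<beta> u \<tau>"
proof -
  let ?L = "period_lattice \<tau>"
  define K where "K u = vartheta u \<tau> * heat_numerator \<alpha> \<beta> u \<tau> - heat_rhs \<alpha> \<beta> u \<tau> / vartheta u \<tau> ^ 2" for u
  obtain g where g: "g holomorphic_on ball 0 (min 1 (Im \<tau>))"
    "\<And>u. u \<in> ball 0 (min 1 (Im \<tau>)) \<Longrightarrow> u \<notin> ?L \<Longrightarrow> K u = g u"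
    unfolding K_def by (rule heat_numerator_near_0[OF \<tau>, of \<alpha> \<beta>]) blast
  have "K u = 0"
  proof (rule elliptic_multiplier_vanishes[OF \<tau> _ g(1) _ g(2), where a = "exp (2 * pi * \<i> * of_real \<alpha>)" and b = "exp (- 2 * pi * \<i> * of_real \<beta>)"])
    have "(\<lambda>u. vartheta u \<tau>) holomorphic_on - ?L"
      using vartheta_DERIV[OF \<tau>] by (auto simp: holomorphic_on_def field_differentiable_def intro: has_field_derivative_at_within)
    then show "K holomorphic_on - ?L"
      unfolding K_def heat_numerator_def using vartheta_nonzero[OF \<tau>]
      by (intro holomorphic_intros lerch_heat_holomorphic[OF lerch_domain_UNIV[OF \<tau>]]
          lerch_sum_holomorphic[OF lerch_domain_UNIV[OF \<tau>]] heat_rhs_at_0(3)[OF \<tau>]) auto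
    show "K (u + 1) = exp (2 * pi * \<i> * of_real \<alpha>) * K u" if "u \<notin> ?L" for u
      unfolding K_def heat_numerator_shift_one[OF \<tau> that] heat_rhs_shift_one vartheta_shift_one
      by (simp add: algebra_simps)
    show "K (u + \<tau>) = exp (- 2 * pi * \<i> * of_real \<beta>) * K u" if u: "u \<notin> ?L" for u
    proof -
      define p where "p = exp (- pi * \<i> * \<tau> - 2 * pi * \<i> * u)"
      define b where "b = exp (- 2 * pi * \<i> * of_real \<beta>)"
      \<comment> \<open>The sign in \<open>vartheta_shift_tau\<close> cancels
        \<open>exp (- pi * \<i>)\<close>, and the dependence on \<open>u\<close> and \<tau> cancels
        as well, which leaves a multiplier of modulus 1.\<close>
      have 1: "- p * exp (- pi * \<i> * (1 + 2 * of_real \<beta>) + pi * \<i> * \<tau> + 2 * pi * \<i> * u) = b"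
      proof -
        have "p * exp (- pi * \<i> * (1 + 2 * of_real \<beta>) + pi * \<i> * \<tau> + 2 * pi * \<i> * u) = b * exp (- (pi * \<i>))"
          unfolding p_def b_def mult_exp_exp by (intro arg_cong[of _ _ exp]) (simp add: algebra_simps)
        then show ?thesis by (simp add: exp_minus)
      qed
      have 2: "exp (- 2 * pi * \<i> * of_real \<beta> - 2 * pi * \<i> * \<tau> - 4 * pi * \<i> * u) = b * p ^ 2"
        unfolding p_def b_def power2_eq_square mult_exp_exp by (intro arg_cong[of _ _ exp]) (simp add: algebra_simps)
      have "p \<noteq> 0" by (simp add: p_def)
      have "K (u + \<tau>) = (- p * exp (- pi * \<i> * (1 + 2 * of_real \<beta>) + pi * \<i> * \<tau> + 2 * pi * \<i> * u)) * (vartheta u \<tau> * heat_numerator \<alpha> \<beta> u \<tau>)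
          - b * p ^ 2 * heat_rhs \<alpha> \<beta> u \<tau> / (p ^ 2 * vartheta u \<tau> ^ 2)"
        unfolding K_def heat_numerator_shift_tau[OF \<tau> u] heat_rhs_shift_tau vartheta_shift_tau 2 p_def[symmetric]
        by (simp add: power_mult_distrib mult_ac)
      also have "\<dots> = b * K u"
        unfolding 1 K_def using \<open>p \<noteq> 0\<close> by (simp add: field_simps)
      finally show ?thesis by (simp add: b_def)
    qed
    show "exp (2 * pi * \<i> * of_real \<alpha>) \<noteq> 1 \<or> exp (- 2 * pi * \<i> * of_real \<beta>) \<noteq> 1"
    proof (rule ccontr)
      assume "\<not> ?thesis"
      then have 1: "exp (2 * pi * \<i> * of_real \<alpha>) = 1" and 2: "exp (2 * pi * \<i> * (- of_real \<beta>)) = 1" by auto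
      obtain m n :: int where "complex_of_real \<alpha> = of_int m" "- complex_of_real \<beta> = of_int n"
        using exp_2pi_eq_1_imp_int[OF 1] exp_2pi_eq_1_imp_int[OF 2] by metis
      then have "complex_of_real \<alpha> * \<tau> + complex_of_real \<beta> = of_int m * \<tau> + of_int (- n)"
        by (simp add: minus_equation_iff)
      then have "complex_of_real \<alpha> * \<tau> + complex_of_real \<beta> \<in> ?L" unfolding period_lattice_def by blast
      with v vartheta_lattice[OF \<tau>] show False by blast
    qed
  qed (use \<tau> u in auto)
  then show ?thesis
    using vartheta_nonzero[OF \<tau> u] unfolding K_def by (simp add: field_simps power2_eq_square power3_eq_cube)
qed

section \<open>Meromorphy in two variables\<close>

lemma holomorphic2_on_const: "holomorphic2_on (\<lambda>_. c) S"
  by (auto simp: holomorphic2_on_def)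

lemma holomorphic2_on_mult:
  "holomorphic2_on f S \<Longrightarrow> holomorphic2_on g S \<Longrightarrow> holomorphic2_on (\<lambda>p. f p * g p) S"
  by (auto simp: holomorphic2_on_def intro!: continuous_intros field_differentiable_mult)

lemma holomorphic2_on_diff:
  "holomorphic2_on f S \<Longrightarrow> holomorphic2_on g S \<Longrightarrow> holomorphic2_on (\<lambda>p. f p - g p) S"
  by (auto simp: holomorphic2_on_def intro!: continuous_intros field_differentiable_diff)

lemma holomorphic2_on_add:
  "holomorphic2_on f S \<Longrightarrow> holomorphic2_on g S \<Longrightarrow> holomorphic2_on (\<lambda>p. f p + g p) S"
  by (auto simp: holomorphic2_on_def intro!: continuous_intros field_differentiable_add)

lemma holomorphic2_on_power: "holomorphic2_on f S \<Longrightarrow> holomorphic2_on (\<lambda>p. f p ^ n) S"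
  by (induction n) (auto intro: holomorphic2_on_const holomorphic2_on_mult)

lemma holomorphic2_on_exp_linear: "holomorphic2_on (\<lambda>p. exp (a * fst p - b * snd p)) S"
  unfolding holomorphic2_on_def field_differentiable_def
  by (auto intro!: continuous_intros derivative_eq_intros exI)

text \<open>One affine shape covers every theta factor: \<open>c = 0\<close> gives functions of
  \<tau> alone, \<open>s = 2\<close> the doubled modulus.\<close>

lemma holomorphic2_on_theta:
  fixes s :: real
  assumes "s > 0"
  shows "holomorphic2_on (\<lambda>p. theta k a (c * fst p + (x * snd p + y)) (of_real s * snd p)) (UNIV \<times> upper_half_plane)"
  unfolding holomorphic2_on_def
proof (intro conjI ballI)
  have "continuous_on (UNIV \<times> upper_half_plane)
      (\<lambda>p. (\<lambda>q. theta k a (fst q) (snd q)) (c * fst p + (x * snd p + y), of_real s * snd p))"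
    using assms
    by (intro continuous_on_compose2[OF theta_continuous_on] continuous_intros) (auto simp: upper_half_plane_def)
  then show "continuous_on (UNIV \<times> upper_half_plane) (\<lambda>p. theta k a (c * fst p + (x * snd p + y)) (of_real s * snd p))"
    by simp
  fix q :: "complex \<times> complex" assume "q \<in> UNIV \<times> upper_half_plane"
  then obtain u \<tau> where q: "q = (u, \<tau>)" and \<tau>: "Im \<tau> > 0" by (cases q) (auto simp: upper_half_plane_def)
  have s\<tau>: "Im (of_real s * \<tau>) > 0" using \<tau> assms by simp
  have 1: "(\<lambda>u. theta k a (c * u + (x * \<tau> + y)) (of_real s * \<tau>)) field_differentiable at u"
    unfolding field_differentiable_def
    by (rule exI) (rule derivative_eq_intros s\<tau> refl)+
  have "((\<lambda>t. theta k a (c * u + (x * t + y)) (of_real s * t)) has_field_derivative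
     (2 * pi * \<i> * x * theta (Suc k) a (c * u + (x * \<tau> + y)) (of_real s * \<tau>) + pi * \<i> * of_real s * theta (Suc (Suc k)) a (c * u + (x * \<tau> + y)) (of_real s * \<tau>))) (at \<tau>)"
    by (rule theta_DERIV[OF open_upper_half_plane])
       (use \<tau> assms in \<open>auto simp: upper_half_plane_def intro!: derivative_eq_intros\<close>)
  then have "(\<lambda>t. theta k a (c * u + (x * t + y)) (of_real s * t)) field_differentiable at \<tau>"
    by (auto simp: field_differentiable_def)
  with 1 show "case q of (a', b) \<Rightarrow>
      (\<lambda>z. theta k a (c * fst (z, b) + (x * snd (z, b) + y)) (of_real s * snd (z, b))) field_differentiable at a' \<and>
      (\<lambda>w. theta k a (c * fst (a', w) + (x * snd (a', w) + y)) (of_real s * snd (a', w))) field_differentiable at b"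
    by (simp add: q)
qed

lemma holomorphic2_on_cong:
  assumes S: "open S" and eq: "\<And>p. p \<in> S \<Longrightarrow> f p = g p" and g: "holomorphic2_on g S"
  shows "holomorphic2_on f S"
  unfolding holomorphic2_on_def
proof (intro conjI ballI)
  show "continuous_on S f"
    using g eq by (simp add: holomorphic2_on_def cong: continuous_on_cong)
  fix p assume p: "p \<in> S"
  obtain a b where ab: "p = (a, b)" by (cases p)
  obtain A B where AB: "open A" "open B" "a \<in> A" "b \<in> B" "A \<times> B \<subseteq> S"
    by (rule open_prod_elim[OF S p]) (use that ab in auto)
  obtain g1 g2 where g1: "((\<lambda>z. g (z, b)) has_field_derivative g1) (at a)"
    and g2: "((\<lambda>w. g (a, w)) has_field_derivative g2) (at b)"
    using g p ab by (auto simp: holomorphic2_on_def field_differentiable_def)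
  have "((\<lambda>z. f (z, b)) has_field_derivative g1) (at a)"
    by (rule has_field_derivative_transform_within_open[OF g1 AB(1,3)]) (use AB eq in force)
  moreover have "((\<lambda>w. f (a, w)) has_field_derivative g2) (at b)"
    by (rule has_field_derivative_transform_within_open[OF g2 AB(2,4)]) (use AB eq in force)
  ultimately show "case p of (a, b) \<Rightarrow> (\<lambda>z. f (z, b)) field_differentiable at a \<and> (\<lambda>w. f (a, w)) field_differentiable at b"
    unfolding ab field_differentiable_def by auto
qed

lemma open_UNIV_times_upper_half_plane: "open (UNIV \<times> upper_half_plane)"
  by (intro open_Times open_UNIV open_upper_half_plane)

lemma holomorphic2_on_vartheta: "holomorphic2_on (\<lambda>p. vartheta (fst p) (snd p)) (UNIV \<times> upper_half_plane)"
  using holomorphic2_on_theta[of 1 0 "1/2" 1 0 "1/2"] by (simp add: vartheta_eq_theta)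

lemma holomorphic2_on_vartheta_line:
  "holomorphic2_on (\<lambda>p. vartheta (a * snd p + b) (snd p)) (UNIV \<times> upper_half_plane)"
  using holomorphic2_on_theta[of 1 0 "1/2" 0 a "b + 1/2"] by (simp add: vartheta_eq_theta add.assoc)

lemma holomorphic2_on_heat_rhs: "holomorphic2_on (\<lambda>p. heat_rhs \<alpha> \<beta> (fst p) (snd p)) (UNIV \<times> upper_half_plane)"
proof (rule holomorphic2_on_cong[OF open_UNIV_times_upper_half_plane])
  define th where "th k a c p = theta k a (c * fst p + (of_real \<alpha> * snd p + of_real \<beta>)) (of_real 2 * snd p)" for k a c and p :: "complex \<times> complex"
  have th: "holomorphic2_on (th k a c) (UNIV \<times> upper_half_plane)" for k a c
    unfolding th_def by (rule holomorphic2_on_theta) simp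
  have th': "holomorphic2_on (\<lambda>p. theta 1 (1/2) (0 * fst p + (0 * snd p + 1/2)) (of_real 1 * snd p)) (UNIV \<times> upper_half_plane)"
    by (rule holomorphic2_on_theta) simp
  show "holomorphic2_on (\<lambda>p. exp (2 * pi * \<i> * of_real \<alpha> * fst p - pi * \<i> * of_real \<alpha> ^ 2 * snd p) *
     (- 16 * pi ^ 2 * theta 1 (1/2) (0 * fst p + (0 * snd p + 1/2)) (of_real 1 * snd p) ^ 2) *
     ((th 1 (1/2) 0 p + of_real \<alpha> / 2 * th 0 (1/2) 0 p) * th 0 0 2 p - (th 1 0 0 p + of_real \<alpha> / 2 * th 0 0 0 p) * th 0 (1/2) 2 p))
    (UNIV \<times> upper_half_plane)"
    by (intro holomorphic2_on_mult holomorphic2_on_diff holomorphic2_on_add holomorphic2_on_const holomorphic2_on_power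
        holomorphic2_on_exp_linear th th')
  fix p :: "complex \<times> complex" assume "p \<in> UNIV \<times> upper_half_plane"
  then have "Im (snd p) > 0" by (auto simp: upper_half_plane_def)
  then show "heat_rhs \<alpha> \<beta> (fst p) (snd p) = exp (2 * pi * \<i> * of_real \<alpha> * fst p - pi * \<i> * of_real \<alpha> ^ 2 * snd p) *
     (- 16 * pi ^ 2 * theta 1 (1/2) (0 * fst p + (0 * snd p + 1/2)) (of_real 1 * snd p) ^ 2) *
     ((th 1 (1/2) 0 p + of_real \<alpha> / 2 * th 0 (1/2) 0 p) * th 0 0 2 p - (th 1 0 0 p + of_real \<alpha> / 2 * th 0 0 0 p) * th 0 (1/2) 2 p)"
    by (simp add: heat_rhs_def coeff_a_eq_theta th_def)
qed

lemma countable_period_lattice: "countable (period_lattice \<tau>)"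
proof -
  have "period_lattice \<tau> = (\<lambda>(m, n). of_int m * \<tau> + of_int n) ` (UNIV :: (int \<times> int) set)"
    by (auto simp: period_lattice_def image_iff)
  then show ?thesis by simp
qed

text \<open>A disc is uncountable, the lattice countable.\<close>

lemma dense_off_period_lattice:
  assumes V: "open V" "(u, \<tau>) \<in> V"
  obtains w where "(w, \<tau>) \<in> V" "w \<notin> period_lattice \<tau>"
proof -
  obtain A B where AB: "open A" "u \<in> A" "\<tau> \<in> B" "A \<times> B \<subseteq> V"
    by (rule open_prod_elim[OF V]) (use that in auto)
  obtain r where r: "r > 0" "ball u r \<subseteq> A" using AB openE by blast
  have "\<not> ball u r \<subseteq> period_lattice \<tau>"
    using countable_subset[OF _ countable_period_lattice] uncountable_ball[OF r(1)] by blast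
  then show ?thesis using that AB r by blast
qed

lemma real_lattice_point:
  fixes \<alpha> \<beta> :: real
  assumes "Im \<tau> > 0" "of_real \<alpha> * \<tau> + of_real \<beta> \<in> period_lattice \<tau>"
  shows "\<alpha> \<in> \<int>" "\<beta> \<in> \<int>"
proof -
  obtain m n :: int where mn: "of_real \<alpha> * \<tau> + of_real \<beta> = of_int m * \<tau> + of_int n"
    using assms(2) by (auto simp: period_lattice_def)
  have "\<alpha> * Im \<tau> = of_int m * Im \<tau>" using arg_cong[OF mn, of Im] by simp
  then have \<alpha>: "\<alpha> = of_int m" using assms(1) by simp
  have "\<beta> = of_int n" using arg_cong[OF mn, of Re] by (simp add: \<alpha>)
  with \<alpha> show "\<alpha> \<in> \<int>" "\<beta> \<in> \<int>" by auto
qed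

theorem theorem1p2:
  fixes \<alpha> \<beta> :: real
  defines "v \<equiv> (\<lambda>\<tau>::complex. of_real \<alpha> * \<tau> + of_real \<beta>)"
  defines "E \<equiv> (\<lambda>u \<tau>::complex. exp (2 * pi * \<i> * of_real \<alpha> * u - pi * \<i> * of_real \<alpha> ^ 2 * \<tau>))"
  defines "lhs \<equiv> (\<lambda>u \<tau>. vartheta u \<tau> ^ 3 *
             heat_operator (\<lambda>u \<tau>. E u \<tau> * lerch_mu u (v \<tau>) \<tau>) u \<tau>)"
  defines "rhs \<equiv> (\<lambda>u \<tau>. E u \<tau> * (16 * pi ^ 2 * dedekind_eta \<tau> ^ 6 / vartheta (v \<tau>) \<tau> ^ 2) *
             (coeff_a1 \<alpha> \<beta> \<tau> * vartheta0 (2 * u + v \<tau>) (2 * \<tau>)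
              - coeff_a0 \<alpha> \<beta> \<tau> * vartheta1 (2 * u + v \<tau>) (2 * \<tau>)))"
  shows "meromorphic2_on (\<lambda>(u, \<tau>). lhs u \<tau>) (UNIV \<times> upper_half_plane)
       \<and> meromorphic2_on (\<lambda>(u, \<tau>). rhs u \<tau>) (UNIV \<times> upper_half_plane)
       \<and> (\<forall>\<tau>\<in>upper_half_plane. \<forall>u. u \<notin> period_lattice \<tau> \<longrightarrow> lhs u \<tau> = rhs u \<tau>)"
proof (cases "\<alpha> \<in> \<int> \<and> \<beta> \<in> \<int>")
  case True
  then obtain m n :: int where mn: "\<alpha> = of_int m" "\<beta> = of_int n" by (auto elim!: Ints_cases)
  have V: "vartheta (v \<tau>) \<tau> = 0" if "Im \<tau> > 0" for \<tau>
    using that by (intro vartheta_lattice) (auto simp: v_def mn period_lattice_def)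
  have mu: "lerch_mu u (v \<tau>) \<tau> = 0" if "Im \<tau> > 0" for u \<tau>
    using V[OF that] by (simp add: lerch_mu_def)
  have "lhs u \<tau> = 0" if \<tau>: "Im \<tau> > 0" for u \<tau>
  proof -
    \<comment> \<open>\<open>lerch_mu\<close> is known to vanish only for \<open>t\<close> in the
      upper half-plane, so the derivative is computed from a neighbourhood of
      \<open>\<tau>\<close>.\<close>
    have "\<forall>\<^sub>F t in nhds \<tau>. E u t * lerch_mu u (v t) t = 0"
      using eventually_nhds_in_open[OF open_upper_half_plane, of \<tau>] \<tau>
      by (auto simp: upper_half_plane_def mu elim!: eventually_mono)
    then have "deriv (\<lambda>t. E u t * lerch_mu u (v t) t) \<tau> = deriv (\<lambda>t. 0) \<tau>"
      by (intro deriv_cong_ev) auto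
    then show ?thesis using mu[OF \<tau>] by (simp add: lhs_def heat_operator_def numeral_2_eq_2)
  qed
  moreover have "rhs u \<tau> = 0" if "Im \<tau> > 0" for u \<tau>
    using V[OF that] by (simp add: rhs_def)
  moreover have "meromorphic2_on f (UNIV \<times> upper_half_plane)" if f: "\<And>u \<tau>. Im \<tau> > 0 \<Longrightarrow> f (u, \<tau>) = 0" for f
    unfolding meromorphic2_on_def
  proof (intro ballI exI conjI allI impI)
    fix p :: "complex \<times> complex" assume p: "p \<in> UNIV \<times> upper_half_plane"
    show "p \<in> UNIV \<times> upper_half_plane" by (rule p)
    show "open (UNIV \<times> upper_half_plane)" by (rule open_UNIV_times_upper_half_plane)
    show "holomorphic2_on (\<lambda>_. 0) (UNIV \<times> upper_half_plane)" "holomorphic2_on (\<lambda>_. 1) (UNIV \<times> upper_half_plane)"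
      by (rule holomorphic2_on_const)+
    show "\<exists>x\<in>W. (1::complex) \<noteq> 0" if "open W \<and> W \<noteq> {} \<and> W \<subseteq> UNIV \<times> upper_half_plane" for W
      using that by auto
    show "f x = 0 / 1" if "x \<in> UNIV \<times> upper_half_plane" for x
      using that f by (auto simp: upper_half_plane_def)
  qed
  ultimately show ?thesis by (auto simp: upper_half_plane_def)
next
  case False
  have V: "vartheta (v \<tau>) \<tau> \<noteq> 0" if "Im \<tau> > 0" for \<tau>
    using False real_lattice_point[OF that, of \<alpha> \<beta>] vartheta_nonzero[OF that] by (auto simp: v_def)
  have rhs: "rhs u \<tau> = heat_rhs \<alpha> \<beta> u \<tau> / vartheta (v \<tau>) \<tau> ^ 2" if \<tau>: "Im \<tau> > 0" for u \<tau>
  proof -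
    have eta: "16 * pi ^ 2 * dedekind_eta \<tau> ^ 6 = - 16 * pi ^ 2 * theta 1 (1/2) (1/2) \<tau> ^ 2"
      unfolding dedekind_eta_cube[OF \<tau>] by (simp add: power_mult_distrib flip: power_mult)
    then show ?thesis
      unfolding rhs_def heat_rhs_def E_def v_def vartheta0_eq_theta vartheta1_eq_theta eta
      by (simp only: times_divide_eq_right times_divide_eq_left)
  qed
  have eq: "lhs u \<tau> = rhs u \<tau>" if \<tau>: "Im \<tau> > 0" and u: "u \<notin> period_lattice \<tau>" for u \<tau>
    unfolding rhs[OF \<tau>] heat_identity[OF \<tau> u V[OF \<tau>, unfolded v_def], symmetric]
    unfolding lhs_def E_def v_def heat_operator_lerch_mu[OF \<tau> u V[OF \<tau>, unfolded v_def]] by simp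
  \<comment> \<open>The extra factor \<open>vartheta u \<tau>\<close> on both sides of the fraction
    makes the denominator vanish on the lattice, where the values of \<open>lhs\<close> are unknown.
    One pair \<open>g\<close>, \<open>h\<close> thus represents \<open>lhs\<close> and
    \<open>rhs\<close> alike.\<close>
  define g where "g p = vartheta (fst p) (snd p) * heat_rhs \<alpha> \<beta> (fst p) (snd p)" for p
  define h where "h p = vartheta (fst p) (snd p) * vartheta (v (snd p)) (snd p) ^ 2" for p
  have gh: "holomorphic2_on g (UNIV \<times> upper_half_plane)" "holomorphic2_on h (UNIV \<times> upper_half_plane)"
    unfolding g_def h_def v_def
    by (intro holomorphic2_on_mult holomorphic2_on_power holomorphic2_on_vartheta
        holomorphic2_on_vartheta_line holomorphic2_on_heat_rhs)+
  have hnz: "\<exists>x\<in>W. h x \<noteq> 0" if W: "open W" "W \<noteq> {}" "W \<subseteq> UNIV \<times> upper_half_plane" for W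
  proof -
    obtain u \<tau> where "(u, \<tau>) \<in> W" using W(2) by auto
    then obtain w where w: "(w, \<tau>) \<in> W" "w \<notin> period_lattice \<tau>" using dense_off_period_lattice[OF W(1)] by blast
    then have "Im \<tau> > 0" using W(3) by (auto simp: upper_half_plane_def)
    then show ?thesis using w V vartheta_nonzero by (intro bexI[of _ "(w, \<tau>)"]) (auto simp: h_def)
  qed
  have "meromorphic2_on f (UNIV \<times> upper_half_plane)"
    if f: "\<And>u \<tau>. Im \<tau> > 0 \<Longrightarrow> u \<notin> period_lattice \<tau> \<Longrightarrow> f (u, \<tau>) = rhs u \<tau>" for f
    unfolding meromorphic2_on_def
  proof (intro ballI exI conjI allI impI)
    fix p :: "complex \<times> complex" assume p: "p \<in> UNIV \<times> upper_half_plane"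
    show "p \<in> UNIV \<times> upper_half_plane" by (rule p)
    show "open (UNIV \<times> upper_half_plane)" by (rule open_UNIV_times_upper_half_plane)
    show "holomorphic2_on g (UNIV \<times> upper_half_plane)" "holomorphic2_on h (UNIV \<times> upper_half_plane)" by (fact gh)+
    show "\<exists>x\<in>W. h x \<noteq> 0" if "open W \<and> W \<noteq> {} \<and> W \<subseteq> UNIV \<times> upper_half_plane" for W
      using hnz that by blast
    fix x assume x: "x \<in> UNIV \<times> upper_half_plane" and hx: "h x \<noteq> 0"
    obtain u \<tau> where u\<tau>: "x = (u, \<tau>)" "Im \<tau> > 0" using x by (auto simp: upper_half_plane_def)
    have nz: "vartheta u \<tau> \<noteq> 0" using hx by (auto simp: h_def u\<tau>)
    then have "u \<notin> period_lattice \<tau>" using vartheta_lattice u\<tau>(2) by blast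
    then show "f x = g x / h x" using f nz u\<tau> by (simp add: rhs g_def h_def)
  qed
  from this[of "\<lambda>(u, \<tau>). lhs u \<tau>"] this[of "\<lambda>(u, \<tau>). rhs u \<tau>"] show ?thesis
    using eq by (auto simp: upper_half_plane_def)
qed

end
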